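(* Let $H$ be a finitely presented $\mathbb{Z}^d$-graded module over $R=\mathbb{k}[t_1,\dots,t_d]$ (a persistence module), let $f:F^1\to F^0$ be its minimal presentation map, and let $[f]$ be its presentation matrix. There are one-to-one correspondences between the following three structures: 1. a decomposition of the persistence module $H\simeq\bigoplus_i H^i$; 2. a decomposition of the presentation map $f\simeq\bigoplus_i f_i$; 3. a diagonalization of the presentation matrix $[f]\simeq\bigoplus_i [f]_i$.
   Context: $\mathbb{k}$ is a field, $d\ge1$, $R=\mathbb{k}[t_1,\dots,t_d]$. All modules are finitely generated. A $\mathbb{Z}^d$-graded $R$-module is an $R$-module $M=\bigoplus_{\mathbf{u}\in\mathbb{Z}^d}M_{\mathbf{u}}$ with $t_i\cdot M_{\mathbf{u}}\subseteq M_{\mathbf{u}+e_i}$; morphisms are $R$-linear maps preserving grades. A free graded module is a direct sum of shifts $R_{\to\mathbf{u}}$, where $(R_{\to\mathbf{u}})_{\mathbf{v}}=R_{\mathbf{v}-\mathbf{u}}$. A presentation of $H$ is an exact sequence $F^1\xrightarrow{f}F^0\to H\to0$ with $F^0,F^1$ free; $f$ is the presentation map, so $\mathrm{coker}\, f\simeq H$. The minimal presentation is the (unique up to isomorphism) one which is the tail $F^1\to F^0\to H\to 0$ of the minimal graded free resolution of $H$. The matrix $[f]$ of $f$ with respect to homogeneous bases of $F^1$ and $F^0$ is a presentation matrix of $H$. If $F^1=0$ it is an $\ell\times 0$ matrix. A decomposition of $H$ is an isomorphism $H\simeq\bigoplus H^i$. Two morphisms $f:M\to N$, $f':M'\to N'$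 are isomorphic, $f\simeq f'$, if there are isomorphisms $g:M\to M'$, $h:N\to N'$ with $h f=f' g$. For $f_1:M^1\to N^1$, $f_2:M^2\to N^2$, $f_1\oplus f_2:M^1\oplus M^2\to N^1\oplus N^2$ is $(m_1,m_2)\mapsto(f_1(m_1),f_2(m_2))$. A decomposition of $f$ is an isomorphism $f\simeq\bigoplus f_i$. Two matrices are equivalent if they present the same morphism (i.e. differ by homogeneous changes of bases of $F^1$ and $F^0$). An index block is a pair $B=[\mathrm{Row}(B),\mathrm{Col}(B)]$ of a set of row indices and a set of column indices. A diagonalization of $\mathbf{A}$ is an equivalent matrix $\mathbf{A}'$ with a set of nonempty index blocks $B_1,\dots,B_k$ (row sets partitioning the rows, column sets partitioning the columns) such that all nonzero entries of $\mathbf{A}'$ have indices in some $B_i$; one writes $\mathbf{A}\simeq\bigoplus\mathbf{A}'|_{B_i}$. All decompositions and diagonalizations are considered up to isomorphism (resp. equivalence) of the summands and permutation, and trivial summands ($0$, $0\to0$, empty blocks) are ignored. The correspondence between 2 and 3 matches $f_i$ with its presentation matrix $[f_i]=[f]_i$, and that between 1 and 2 matches a presentation map $f_i$ with the module $H^i\simeq\mathrm{coker}\, f_i$ it presents. *)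

theory Defs
  imports
    "HOL-Library.Poly_Mapping"
    "HOL-Library.Multiset"
    "HOL-Algebra.Algebraic_Closure_Type"
    "Jordan_Normal_Form.DL_Submatrix"
begin

section \<open>The multigraded polynomial ring\<close>

text \<open>
  The variables are indexed by a finite type \<^typ>\<open>'d\<close> (so d is the cardinality of the type, and
  d is at least 1 because types are inhabited). As \<^typ>\<open>'d\<close> is finite, \<^typ>\<open>'d \<Rightarrow>\<^sub>0 int\<close> is the
  group of all d-tuples of integers, and \<open>('d \<Rightarrow>\<^sub>0 nat) \<Rightarrow>\<^sub>0 'k\<close> with its convolution product is the
  polynomial ring over \<^typ>\<open>'k\<close>.
\<close>

type_synonym 'd grade = "'d \<Rightarrow>\<^sub>0 int"
type_synonym ('d, 'k) mpoly = "('d \<Rightarrow>\<^sub>0 nat) \<Rightarrow>\<^sub>0 'k"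

abbreviation poly_ring :: "('d::finite, 'k::field) mpoly ring" where
  "poly_ring \<equiv> ring_of_type_algebra"

definition indet :: "'d::finite \<Rightarrow> ('d, 'k::field) mpoly" where
  "indet i = Poly_Mapping.single (Poly_Mapping.single i 1) 1"

definition const :: "'k::field \<Rightarrow> ('d::finite, 'k) mpoly" where
  "const c = Poly_Mapping.single 0 c"

definition unit_grade :: "'d::finite \<Rightarrow> 'd grade" where
  "unit_grade i = Poly_Mapping.single i 1"

text \<open>The homogeneous component of grade \<open>w\<close>; it is zero if \<open>w\<close> has a negative entry.\<close>

definition homogeneous :: "'d::finite grade \<Rightarrow> ('d, 'k::field) mpoly set" where
  "homogeneous w = {p. \<forall>m \<in> Poly_Mapping.keys p. Poly_Mapping.map int m = w}"


section \<open>Graded modules\<close>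

record ('g, 'r, 'm) graded_module = "('r, 'm) module" +
  component :: "'g \<Rightarrow> 'm set"

type_synonym ('d, 'k, 'm) pmodule = "('d grade, ('d, 'k) mpoly, 'm) graded_module"

text \<open>
  The components are subspaces over the field (first two conditions), the module is their
  internal direct sum, and multiplication by the variables shifts the grade.
\<close>

definition is_graded_module :: "('d::finite, 'k::field, 'm) pmodule \<Rightarrow> bool" where
  "is_graded_module M \<longleftrightarrow>
     Module.module poly_ring M \<and>
     (\<forall>u. subgroup (component M u) (add_monoid M)) \<and>
     (\<forall>u c. \<forall>x \<in> component M u. const c \<odot>\<^bsub>M\<^esub> x \<in> component M u) \<and>
     (\<forall>x \<in> carrier M. \<exists>!xs. (\<forall>u. xs u \<in> component M u) \<and> finite {u. xs u \<noteq> \<zero>\<^bsub>M\<^esub>} \<and>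
        x = (\<Oplus>\<^bsub>M\<^esub>u \<in> {u. xs u \<noteq> \<zero>\<^bsub>M\<^esub>}. xs u)) \<and>
     (\<forall>i u. \<forall>x \<in> component M u. indet i \<odot>\<^bsub>M\<^esub> x \<in> component M (u + unit_grade i))"

definition finitely_generated :: "('d::finite, 'k::field, 'm) pmodule \<Rightarrow> bool" where
  "finitely_generated M \<longleftrightarrow>
     (\<exists>S. finite S \<and> S \<subseteq> carrier M \<and>
        (\<forall>N. submodule N poly_ring M \<and> S \<subseteq> N \<longrightarrow> N = carrier M))"

definition persistence_module :: "('d::finite, 'k::field, 'm) pmodule \<Rightarrow> bool" where
  "persistence_module M \<longleftrightarrow> is_graded_module M \<and> finitely_generated M"

definition trivial_module :: "('d::finite, 'k::field, 'm) pmodule \<Rightarrow> bool" where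
  "trivial_module M \<longleftrightarrow> carrier M = {\<zero>\<^bsub>M\<^esub>}"

definition graded_hom ::
  "('d::finite, 'k::field, 'm) pmodule \<Rightarrow> ('d, 'k, 'n) pmodule \<Rightarrow> ('m \<Rightarrow> 'n) \<Rightarrow> bool" where
  "graded_hom M N \<phi> \<longleftrightarrow>
     \<phi> \<in> hom (add_monoid M) (add_monoid N) \<and>
     (\<forall>r. \<forall>x \<in> carrier M. \<phi> (r \<odot>\<^bsub>M\<^esub> x) = r \<odot>\<^bsub>N\<^esub> \<phi> x) \<and>
     (\<forall>u. \<phi> ` component M u \<subseteq> component N u)"

definition graded_iso ::
  "('d::finite, 'k::field, 'm) pmodule \<Rightarrow> ('d, 'k, 'n) pmodule \<Rightarrow> ('m \<Rightarrow> 'n) \<Rightarrow> bool" where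
  "graded_iso M N \<phi> \<longleftrightarrow> graded_hom M N \<phi> \<and> bij_betw \<phi> (carrier M) (carrier N)"

definition isomorphic_modules ::
  "('d::finite, 'k::field, 'm) pmodule \<Rightarrow> ('d, 'k, 'n) pmodule \<Rightarrow> bool" where
  "isomorphic_modules M N \<longleftrightarrow> (\<exists>\<phi>. graded_iso M N \<phi>)"

text \<open>
  Elements of the direct sum of a list of modules are tuples, that is, extensional functions on
  the set of indices. The fields \<open>mult\<close> and \<open>one\<close>, which the record type of modules inherits from
  rings, carry no meaning for modules.
\<close>

definition direct_sum :: "('d::finite, 'k::field, 'm) pmodule list \<Rightarrow> ('d, 'k, nat \<Rightarrow> 'm) pmodule"
  where
  "direct_sum Ms =
     \<lparr>carrier = (\<Pi>\<^sub>E i \<in> {..<length Ms}. carrier (Ms ! i)),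
      monoid.mult = undefined, one = undefined,
      ring.zero = (\<lambda>i \<in> {..<length Ms}. \<zero>\<^bsub>Ms ! i\<^esub>),
      add = (\<lambda>x y. \<lambda>i \<in> {..<length Ms}. x i \<oplus>\<^bsub>Ms ! i\<^esub> y i),
      module.smult = (\<lambda>r x. \<lambda>i \<in> {..<length Ms}. r \<odot>\<^bsub>Ms ! i\<^esub> x i),
      component = (\<lambda>u. \<Pi>\<^sub>E i \<in> {..<length Ms}. component (Ms ! i) u)\<rparr>"

text \<open>The shift of the polynomial ring whose generator \<open>1\<close> has grade \<open>u\<close>.\<close>

definition shifted_ring :: "'d::finite grade \<Rightarrow> ('d, 'k::field, ('d, 'k) mpoly) pmodule" where
  "shifted_ring u =
     \<lparr>carrier = UNIV, monoid.mult = (*), one = 1, ring.zero = 0, add = (+), module.smult = (*),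
      component = (\<lambda>v. homogeneous (v - u))\<rparr>"

definition free_graded :: "('d::finite, 'k::field, 'm) pmodule \<Rightarrow> bool" where
  "free_graded M \<longleftrightarrow>
     is_graded_module M \<and> (\<exists>us. isomorphic_modules M (direct_sum (map shifted_ring us)))"


section \<open>Morphisms\<close>

record (overloaded) ('d, 'k::zero, 'm, 'n) gmorphism =
  src :: "('d, 'k, 'm) pmodule"
  tgt :: "('d, 'k, 'n) pmodule"
  app :: "'m \<Rightarrow> 'n"

definition is_gmorphism :: "('d::finite, 'k::field, 'm, 'n) gmorphism \<Rightarrow> bool" where
  "is_gmorphism f \<longleftrightarrow>
     persistence_module (src f) \<and> persistence_module (tgt f) \<and> graded_hom (src f) (tgt f) (app f)"

definition trivial_morphism :: "('d::finite, 'k::field, 'm, 'n) gmorphism \<Rightarrow> bool" where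
  "trivial_morphism f \<longleftrightarrow> trivial_module (src f) \<and> trivial_module (tgt f)"

definition isomorphic_morphisms ::
  "('d::finite, 'k::field, 'm, 'n) gmorphism \<Rightarrow> ('d, 'k, 'm2, 'n2) gmorphism \<Rightarrow> bool" where
  "isomorphic_morphisms f f' \<longleftrightarrow>
     (\<exists>g h. graded_iso (src f) (src f') g \<and> graded_iso (tgt f) (tgt f') h \<and>
        (\<forall>x \<in> carrier (src f). h (app f x) = app f' (g x)))"

definition direct_sum_morphism ::
  "('d::finite, 'k::field, 'm, 'n) gmorphism list \<Rightarrow> ('d, 'k, nat \<Rightarrow> 'm, nat \<Rightarrow> 'n) gmorphism" where
  "direct_sum_morphism fs =
     \<lparr>src = direct_sum (map src fs), tgt = direct_sum (map tgt fs),
      app = (\<lambda>x. \<lambda>i \<in> {..<length fs}. app (fs ! i) (x i))\<rparr>"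


section \<open>Presentations\<close>

definition mor_kernel ::
  "('d::finite, 'k::field, 'm) pmodule \<Rightarrow> ('d, 'k, 'n) pmodule \<Rightarrow> ('m \<Rightarrow> 'n) \<Rightarrow> 'm set" where
  "mor_kernel M N \<phi> = {x \<in> carrier M. \<phi> x = \<zero>\<^bsub>N\<^esub>}"

text \<open>\<open>f\<close> is a presentation map of \<open>H\<close>; the map \<open>p\<close> identifies \<open>H\<close> with the cokernel of \<open>f\<close>.\<close>

definition presents ::
  "('d::finite, 'k::field, 'm, 'n) gmorphism \<Rightarrow> ('d, 'k, 'h) pmodule \<Rightarrow> bool" where
  "presents f H \<longleftrightarrow>
     free_graded (src f) \<and> free_graded (tgt f) \<and> graded_hom (src f) (tgt f) (app f) \<and>
     (\<exists>p. graded_hom (tgt f) H p \<and> p ` carrier (tgt f) = carrier H \<and>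
        mor_kernel (tgt f) H p = app f ` carrier (src f))"

definition graded_free_resolution ::
  "(nat \<Rightarrow> ('d::finite, 'k::field, 'f) pmodule) \<Rightarrow> (nat \<Rightarrow> 'f \<Rightarrow> 'f) \<Rightarrow> ('f \<Rightarrow> 'h) \<Rightarrow>
     ('d, 'k, 'h) pmodule \<Rightarrow> bool" where
  "graded_free_resolution F \<delta> \<epsilon> H \<longleftrightarrow>
     (\<forall>k. free_graded (F k)) \<and>
     (\<forall>k. graded_hom (F (Suc k)) (F k) (\<delta> k)) \<and>
     graded_hom (F 0) H \<epsilon> \<and> \<epsilon> ` carrier (F 0) = carrier H \<and>
     mor_kernel (F 0) H \<epsilon> = \<delta> 0 ` carrier (F 1) \<and>
     (\<forall>k. mor_kernel (F (Suc k)) (F k) (\<delta> k) = \<delta> (Suc k) ` carrier (F (Suc (Suc k))))"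

text \<open>The product of \<open>M\<close> with the ideal generated by all variables.\<close>

definition max_ideal_times :: "('d::finite, 'k::field, 'm) pmodule \<Rightarrow> 'm set" where
  "max_ideal_times M =
     {\<Oplus>\<^bsub>M\<^esub>i \<in> UNIV. indet i \<odot>\<^bsub>M\<^esub> x i | x. \<forall>i::'d. x i \<in> carrier M}"

definition minimal_graded_free_resolution ::
  "(nat \<Rightarrow> ('d::finite, 'k::field, 'f) pmodule) \<Rightarrow> (nat \<Rightarrow> 'f \<Rightarrow> 'f) \<Rightarrow> ('f \<Rightarrow> 'h) \<Rightarrow>
     ('d, 'k, 'h) pmodule \<Rightarrow> bool" where
  "minimal_graded_free_resolution F \<delta> \<epsilon> H \<longleftrightarrow>
     graded_free_resolution F \<delta> \<epsilon> H \<and>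
     (\<forall>k. \<delta> k ` carrier (F (Suc k)) \<subseteq> max_ideal_times (F k))"

definition minimal_presentation_map ::
  "('d::finite, 'k::field, 'f, 'f) gmorphism \<Rightarrow> ('d, 'k, 'h) pmodule \<Rightarrow> bool" where
  "minimal_presentation_map f H \<longleftrightarrow>
     (\<exists>F \<delta> \<epsilon>. minimal_graded_free_resolution F \<delta> \<epsilon> H \<and>
        f = \<lparr>src = F 1, tgt = F 0, app = \<delta> 0\<rparr>)"


section \<open>Graded matrices\<close>

text \<open>
  A matrix of a morphism remembers the grades of the basis elements indexing its rows and columns
  (an \<open>n \<times> 0\<close> matrix would otherwise not determine the morphism).
\<close>

record (overloaded) ('d, 'k::zero) gmatrix =
  row_grades :: "'d grade list"
  col_grades :: "'d grade list"
  entries :: "('d, 'k) mpoly mat"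

definition is_gmatrix :: "('d::finite, 'k::field) gmatrix \<Rightarrow> bool" where
  "is_gmatrix A \<longleftrightarrow>
     entries A \<in> carrier_mat (length (row_grades A)) (length (col_grades A)) \<and>
     (\<forall>i < length (row_grades A). \<forall>j < length (col_grades A).
        entries A $$ (i, j) \<in> homogeneous (col_grades A ! j - row_grades A ! i))"

definition homogeneous_basis ::
  "('d::finite, 'k::field, 'm) pmodule \<Rightarrow> 'd grade list \<Rightarrow> 'm list \<Rightarrow> bool" where
  "homogeneous_basis M us bs \<longleftrightarrow>
     length bs = length us \<and>
     (\<forall>i < length us. bs ! i \<in> component M (us ! i)) \<and>
     (\<forall>x \<in> carrier M. \<exists>!cs. length cs = length bs \<and>
        x = (\<Oplus>\<^bsub>M\<^esub>i \<in> {..<length bs}. cs ! i \<odot>\<^bsub>M\<^esub> bs ! i))"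

definition matrix_of :: "('d::finite, 'k::field, 'm, 'n) gmorphism \<Rightarrow> ('d, 'k) gmatrix \<Rightarrow> bool"
  where
  "matrix_of f A \<longleftrightarrow>
     is_gmatrix A \<and>
     (\<exists>bs cs. homogeneous_basis (src f) (col_grades A) bs \<and>
        homogeneous_basis (tgt f) (row_grades A) cs \<and>
        (\<forall>j < length bs. app f (bs ! j) =
           (\<Oplus>\<^bsub>tgt f\<^esub>i \<in> {..<length cs}. entries A $$ (i, j) \<odot>\<^bsub>tgt f\<^esub> cs ! i)))"

text \<open>
  The columns of a base change matrix express a homogeneous basis with grades \<open>vs\<close> in one with
  grades \<open>us\<close>. Permutations of a basis are base changes.
\<close>

definition base_change :: "'d::finite grade list \<Rightarrow> 'd grade list \<Rightarrow> ('d, 'k::field) mpoly mat \<Rightarrow> bool"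
  where
  "base_change us vs Q \<longleftrightarrow>
     is_gmatrix \<lparr>row_grades = us, col_grades = vs, entries = Q\<rparr> \<and> invertible_mat Q"

definition equivalent_gmatrices ::
  "('d::finite, 'k::field) gmatrix \<Rightarrow> ('d, 'k) gmatrix \<Rightarrow> bool" where
  "equivalent_gmatrices A A' \<longleftrightarrow>
     is_gmatrix A \<and> is_gmatrix A' \<and>
     (\<exists>Q P. base_change (row_grades A') (row_grades A) Q \<and>
        base_change (col_grades A) (col_grades A') P \<and>
        entries A' = Q * entries A * P)"

type_synonym index_block = "nat set \<times> nat set"

definition restrict_block :: "('d::finite, 'k::field) gmatrix \<Rightarrow> index_block \<Rightarrow> ('d, 'k) gmatrix" where
  "restrict_block A B =
     \<lparr>row_grades = nths (row_grades A) (fst B),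
      col_grades = nths (col_grades A) (snd B),
      entries = submatrix (entries A) (fst B) (snd B)\<rparr>"

text \<open>A block is empty if it has neither rows nor columns; only one of both sets may be empty.\<close>

definition block_diagonal :: "('d::finite, 'k::field) gmatrix \<Rightarrow> index_block set \<Rightarrow> bool" where
  "block_diagonal A Bs \<longleftrightarrow>
     finite Bs \<and>
     (\<forall>B \<in> Bs. fst B \<noteq> {} \<or> snd B \<noteq> {}) \<and>
     (\<Union>B \<in> Bs. fst B) = {..<length (row_grades A)} \<and>
     (\<Union>B \<in> Bs. snd B) = {..<length (col_grades A)} \<and>
     pairwise (\<lambda>B B'. disjnt (fst B) (fst B') \<and> disjnt (snd B) (snd B')) Bs \<and>
     (\<forall>i < length (row_grades A). \<forall>j < length (col_grades A).
        entries A $$ (i, j) \<noteq> 0 \<longrightarrow> (\<exists>B \<in> Bs. i \<in> fst B \<and> j \<in> snd B))"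


section \<open>Decompositions and their comparison\<close>

text \<open>
  The summands are taken on the types of the given objects. Nothing is lost, since every summand
  is isomorphic to a submodule of the given module.
\<close>

definition module_decompositions ::
  "('d::finite, 'k::field, 'h) pmodule \<Rightarrow> ('d, 'k, 'h) pmodule list set" where
  "module_decompositions H =
     {Hs. (\<forall>M \<in> set Hs. persistence_module M) \<and> isomorphic_modules H (direct_sum Hs)}"

definition morphism_decompositions ::
  "('d::finite, 'k::field, 'm, 'n) gmorphism \<Rightarrow> ('d, 'k, 'm, 'n) gmorphism list set" where
  "morphism_decompositions f =
     {fs. (\<forall>g \<in> set fs. is_gmorphism g) \<and> isomorphic_morphisms f (direct_sum_morphism fs)}"

definition diagonalizations ::
  "('d::finite, 'k::field) gmatrix \<Rightarrow> (('d, 'k) gmatrix \<times> index_block set) set" where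
  "diagonalizations A = {(A', Bs). equivalent_gmatrices A A' \<and> block_diagonal A' Bs}"

text \<open>The nontrivial summands, as multisets since their order is irrelevant.\<close>

definition module_summands ::
  "('d::finite, 'k::field, 'h) pmodule list \<Rightarrow> ('d, 'k, 'h) pmodule multiset" where
  "module_summands Hs = mset (filter (\<lambda>M. \<not> trivial_module M) Hs)"

definition morphism_summands ::
  "('d::finite, 'k::field, 'm, 'n) gmorphism list \<Rightarrow> ('d, 'k, 'm, 'n) gmorphism multiset" where
  "morphism_summands fs = mset (filter (\<lambda>f. \<not> trivial_morphism f) fs)"

definition matrix_summands ::
  "('d::finite, 'k::field) gmatrix \<times> index_block set \<Rightarrow> ('d, 'k) gmatrix multiset" where
  "matrix_summands D = image_mset (restrict_block (fst D)) (mset_set (snd D))"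

definition same_module_decomposition ::
  "('d::finite, 'k::field, 'h) pmodule list \<Rightarrow> ('d, 'k, 'h) pmodule list \<Rightarrow> bool" where
  "same_module_decomposition Hs Hs' \<longleftrightarrow>
     rel_mset isomorphic_modules (module_summands Hs) (module_summands Hs')"

definition same_morphism_decomposition ::
  "('d::finite, 'k::field, 'm, 'n) gmorphism list \<Rightarrow> ('d, 'k, 'm, 'n) gmorphism list \<Rightarrow> bool" where
  "same_morphism_decomposition fs fs' \<longleftrightarrow>
     rel_mset isomorphic_morphisms (morphism_summands fs) (morphism_summands fs')"

definition same_diagonalization ::
  "('d::finite, 'k::field) gmatrix \<times> index_block set \<Rightarrow> ('d, 'k) gmatrix \<times> index_block set \<Rightarrow> bool"
  where
  "same_diagonalization D D' \<longleftrightarrow>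
     rel_mset equivalent_gmatrices (matrix_summands D) (matrix_summands D')"

definition module_morphism_match ::
  "('d::finite, 'k::field, 'h) pmodule list \<Rightarrow> ('d, 'k, 'm, 'n) gmorphism list \<Rightarrow> bool" where
  "module_morphism_match Hs fs \<longleftrightarrow>
     rel_mset (\<lambda>M f. presents f M) (module_summands Hs) (morphism_summands fs)"

definition morphism_matrix_match ::
  "('d::finite, 'k::field, 'm, 'n) gmorphism list \<Rightarrow> ('d, 'k) gmatrix \<times> index_block set \<Rightarrow> bool" where
  "morphism_matrix_match fs D \<longleftrightarrow>
     rel_mset matrix_of (morphism_summands fs) (matrix_summands D)"

text \<open>
  The relation \<open>C\<close> between \<open>S\<close> and \<open>T\<close> is the graph of a bijection between the classes of \<open>S\<close>
  modulo \<open>E\<close> and the classes of \<open>T\<close> modulo \<open>E'\<close>.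
\<close>

definition rel_on :: "'a set \<Rightarrow> ('a \<Rightarrow> 'a \<Rightarrow> bool) \<Rightarrow> ('a \<times> 'a) set" where
  "rel_on S E = {(x, y). x \<in> S \<and> y \<in> S \<and> E x y}"

definition one_to_one_correspondence ::
  "'a set \<Rightarrow> ('a \<Rightarrow> 'a \<Rightarrow> bool) \<Rightarrow> 'b set \<Rightarrow> ('b \<Rightarrow> 'b \<Rightarrow> bool) \<Rightarrow> ('a \<Rightarrow> 'b \<Rightarrow> bool) \<Rightarrow> bool" where
  "one_to_one_correspondence S E T E' C \<longleftrightarrow>
     equiv S (rel_on S E) \<and> equiv T (rel_on T E') \<and>
     (\<exists>\<Phi>. bij_betw \<Phi> (S // rel_on S E) (T // rel_on T E') \<and>
        (\<forall>x \<in> S. \<forall>y \<in> T. C x y \<longleftrightarrow> \<Phi> (rel_on S E `` {x}) = rel_on T E' `` {y}))"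

end

theory Submission
  imports Defs "Jordan_Normal_Form.Determinant"
begin


text \<open>
  Let \<open>R\<close> be the multigraded polynomial ring and \<open>m\<close> the ideal generated by the variables. The proof
  rests on minimal covers: surjections \<open>P \<rightarrow> M\<close> from a free graded module whose kernel lies in \<open>mP\<close>
  (\<open>minimal_cover\<close>). Finitely generated modules have minimal covers, given by a smallest set of
  homogeneous generators (\<open>minimal_cover_exists\<close>). They are unique: a lift between two covers of the
  same module is surjective by Nakayama's lemma, it splits because its target is free, and a split
  surjection whose kernel lies in \<open>mP\<close> is injective, again by Nakayama (\<open>minimal_cover_unique\<close>). As
  components of free modules vanish in low total degree, Nakayama's lemma is an induction on the
  total degree. The same argument shows that summands of free modules are free
  (\<open>free_graded_summand\<close>).

  A presentation map \<open>f: F1 \<rightarrow> F0\<close> of \<open>H\<close> is minimal iff \<open>F0 \<rightarrow> H\<close> and \<open>F1 \<rightarrow> im f\<close> are minimal covers.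
  So a minimal presentation is determined by \<open>H\<close> up to isomorphism (\<open>minimal_presentation_unique\<close>),
  and conversely \<open>H\<close> is the cokernel of \<open>f\<close>. Minimality passes to the summands of \<open>f\<close>
  (\<open>minimal_summands\<close>), which excludes nontrivial summands that present the zero module, such as
  identities. It remains to see that decompositions correspond. If \<open>f\<close> decomposes,
  then \<open>H\<close> is the direct sum of the images of the targets of the summands. If \<open>H\<close> decomposes, minimal
  covers of its summands add up to a minimal cover of \<open>H\<close>, hence to \<open>F0\<close>; their kernels add up to
  \<open>im f\<close>, hence are finitely generated, and their minimal covers add up to \<open>F1\<close>.

  For the matrices, a matrix of \<open>f\<close> is the same as an isomorphism from a map of standard free modules
  to \<open>f\<close> (\<open>matrix_of_iff\<close>), and equivalence of matrices is isomorphism of these maps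
  (\<open>equivalent_gmatrices_iff\<close>). A block diagonal matrix is the direct sum of its blocks
  (\<open>block_diagonal_morphism\<close>), and all lists of matrices arise as the blocks of one
  (\<open>block_diagonal_exists\<close>), so diagonalizations of the matrix are decompositions of \<open>f\<close> into maps of
  standard free modules.
\<close>


abbreviation lookup where "lookup \<equiv> Poly_Mapping.lookup"

section \<open>Homogeneous parts of polynomials\<close>

lemma poly_ring_simps [simp]:
  "carrier poly_ring = UNIV" "\<zero>\<^bsub>poly_ring\<^esub> = 0" "\<one>\<^bsub>poly_ring\<^esub> = 1"
  "a \<oplus>\<^bsub>poly_ring\<^esub> b = a + b" "a \<otimes>\<^bsub>poly_ring\<^esub> b = a * b"
  by (simp_all add: ring_of_type_algebra_def)

abbreviation mgrade :: "('d::finite \<Rightarrow>\<^sub>0 nat) \<Rightarrow> 'd grade" where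
  "mgrade \<equiv> Poly_Mapping.map int"

lemma lookup_mgrade [simp]: "lookup (mgrade m) i = int (lookup m i)"
  by (simp add: Poly_Mapping.map.rep_eq when_def)

lemma mgrade_simps [simp]:
  "mgrade 0 = 0" "mgrade (m + n) = mgrade m + mgrade n" "mgrade (Poly_Mapping.single i 1) = unit_grade i"
  "mgrade m = mgrade n \<longleftrightarrow> m = n"
  by (auto intro!: poly_mapping_eqI simp: lookup_add unit_grade_def lookup_single when_def
      dest: arg_cong[where f=lookup] fun_cong simp: poly_mapping_eq_iff fun_eq_iff)

definition hpart :: "'d::finite grade \<Rightarrow> ('d, 'k::field) mpoly \<Rightarrow> ('d, 'k) mpoly" where
  "hpart w p = (\<Sum>m \<in> {m \<in> Poly_Mapping.keys p. mgrade m = w}. Poly_Mapping.single m (lookup p m))"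

lemma lookup_hpart: "lookup (hpart w p) m = (if mgrade m = w then lookup p m else 0)"
proof -
  have "lookup (hpart w p) m = (\<Sum>n \<in> {n \<in> Poly_Mapping.keys p. mgrade n = w}. if n = m then lookup p m else 0)"
    unfolding hpart_def lookup_sum by (rule sum.cong) (auto simp: lookup_single when_def)
  then show ?thesis by (auto simp: in_keys_iff)
qed

lemma homogeneous_iff: "p \<in> homogeneous w \<longleftrightarrow> (\<forall>m. lookup p m \<noteq> 0 \<longrightarrow> mgrade m = w)"
  by (auto simp: homogeneous_def in_keys_iff)

lemma hpart_homogeneous [simp]: "hpart w p \<in> homogeneous w"
  by (auto simp: homogeneous_iff lookup_hpart)

lemma hpart_same: "p \<in> homogeneous w \<Longrightarrow> hpart w p = p"
  by (intro poly_mapping_eqI) (auto simp: homogeneous_iff lookup_hpart)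

lemma hpart_other: "p \<in> homogeneous w \<Longrightarrow> v \<noteq> w \<Longrightarrow> hpart v p = 0"
  by (intro poly_mapping_eqI) (auto simp: homogeneous_iff lookup_hpart)

lemma hpart_add: "hpart w (p + q) = hpart w p + hpart w q"
  by (intro poly_mapping_eqI) (auto simp: lookup_hpart lookup_add)

lemma hpart_support: "{w. hpart w p \<noteq> 0} \<subseteq> mgrade ` Poly_Mapping.keys p"
proof
  fix w assume "w \<in> {w. hpart w p \<noteq> 0}"
  then obtain m where "lookup (hpart w p) m \<noteq> 0" by (auto simp: poly_mapping_eq_iff fun_eq_iff)
  then show "w \<in> mgrade ` Poly_Mapping.keys p" by (auto simp: lookup_hpart in_keys_iff split: if_splits)
qed

lemma sum_hpart: "finite W \<Longrightarrow> {w. hpart w p \<noteq> 0} \<subseteq> W \<Longrightarrow> (\<Sum>w\<in>W. hpart w p) = p"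
proof (intro poly_mapping_eqI)
  fix m assume W: "finite W" "{w. hpart w p \<noteq> 0} \<subseteq> W"
  have "lookup (\<Sum>w\<in>W. hpart w p) m = (\<Sum>w\<in>W. if w = mgrade m then lookup p m else 0)"
    unfolding lookup_sum by (rule sum.cong) (auto simp: lookup_hpart)
  also have "\<dots> = lookup p m"
  proof (cases "mgrade m \<in> W")
    case False
    then have "hpart (mgrade m) p = 0" using W by auto
    then have "lookup p m = 0" by (metis lookup_hpart lookup_zero)
    then show ?thesis by (simp add: W)
  qed (simp add: W)
  finally show "lookup (\<Sum>w\<in>W. hpart w p) m = lookup p m" .
qed

lemma homogeneous_zero [simp]: "0 \<in> homogeneous w"
  and homogeneous_add: "p \<in> homogeneous w \<Longrightarrow> q \<in> homogeneous w \<Longrightarrow> p + q \<in> homogeneous w"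
  and homogeneous_uminus: "p \<in> homogeneous w \<Longrightarrow> - p \<in> homogeneous w"
  and homogeneous_one: "1 \<in> homogeneous 0"
  and homogeneous_const: "const c \<in> homogeneous 0"
  and homogeneous_indet: "indet i \<in> homogeneous (unit_grade i)"
  by (auto simp: homogeneous_iff lookup_add lookup_one const_def indet_def lookup_single when_def
      split: if_splits simp flip: mgrade_simps(3)) (metis add_0)

lemma homogeneous_single: "Poly_Mapping.single m c \<in> homogeneous (mgrade m)"
  by (auto simp: homogeneous_iff lookup_single when_def)

lemma homogeneous_sum: "(\<And>i. i \<in> I \<Longrightarrow> g i \<in> homogeneous w) \<Longrightarrow> sum g I \<in> homogeneous w"
  by (induction I rule: infinite_finite_induct) (auto intro: homogeneous_add)

text \<open>Distinct monomials have distinct grades, so a homogeneous component is at most one-dimensional.\<close>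

lemma homogeneous_cases:
  assumes "p \<in> homogeneous w"
  obtains "p = 0" | m c where "mgrade m = w" "p = Poly_Mapping.single m c" "c \<noteq> 0"
proof (cases "p = 0")
  case False
  then obtain m where m: "lookup p m \<noteq> 0" by (auto simp: poly_mapping_eq_iff fun_eq_iff)
  then have w: "mgrade m = w" using assms by (auto simp: homogeneous_iff)
  have "p = Poly_Mapping.single m (lookup p m)"
  proof (rule poly_mapping_eqI)
    fix n show "lookup p n = lookup (Poly_Mapping.single m (lookup p m)) n"
      using assms w by (cases "n = m") (auto simp: homogeneous_iff lookup_single)
  qed
  then show ?thesis using that(2) w m by blast
qed (use that in blast)

lemma homogeneous_mult:
  assumes "p \<in> homogeneous v" "q \<in> homogeneous w" shows "p * q \<in> homogeneous (v + w)"
  using assms(1)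
proof (cases rule: homogeneous_cases)
  case p: (2 m a)
  from assms(2) show ?thesis
  proof (cases rule: homogeneous_cases)
    case (2 n b)
    show ?thesis using homogeneous_single[of "m + n" "a * b"] by (simp add: p(2) 2(2) mult_single flip: p(1) 2(1))
  qed simp
qed simp

text \<open>
  Graded modules are only required to be compatible with constants and indeterminates; this induction
  extends the compatibility to monomials, hence to all homogeneous polynomials.
\<close>

lemma monomial_induct [case_names const indet]:
  assumes "\<And>c. P 0 (const c)"
    and "\<And>m c i. P m (Poly_Mapping.single m c) \<Longrightarrow>
      P (m + Poly_Mapping.single i 1) (indet i * Poly_Mapping.single m c)"
  shows "P (m :: 'd::finite \<Rightarrow>\<^sub>0 nat) (Poly_Mapping.single m c)"
proof (induction "\<Sum>i\<in>UNIV. lookup m i" arbitrary: m)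
  case 0
  then have "m = 0" by (intro poly_mapping_eqI) simp
  then show ?case using assms(1) by (simp add: const_def)
next
  case (Suc n)
  then obtain i where i: "lookup m i \<noteq> 0" by (metis nat.distinct(1) sum.neutral)
  define m' where "m' = m - Poly_Mapping.single i 1"
  have m: "m = m' + Poly_Mapping.single i 1"
    using i by (intro poly_mapping_eqI) (auto simp: m'_def lookup_add lookup_minus lookup_single when_def)
  have "(\<Sum>j\<in>UNIV. lookup m j) = (\<Sum>j\<in>UNIV. lookup m' j) + 1"
    unfolding m lookup_add sum.distrib by (simp add: lookup_single when_def)
  then have "P m' (Poly_Mapping.single m' c)" using Suc by auto
  from assms(2)[OF this, of i] show ?case
    unfolding m by (simp add: indet_def mult_single add.commute)
qed

text \<open>
  A monomial of nonzero grade is divisible by some variable. Such polynomials are the homogeneous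
  coefficients that may occur in the kernel of a minimal cover.
\<close>

lemma homogeneous_nonconstant:
  assumes "p \<in> homogeneous w" "w \<noteq> 0"
  obtains i q where "p = indet i * q"
  using assms(1)
proof (cases rule: homogeneous_cases)
  case (2 m c)
  have "m = 0 \<or> (\<exists>i q. Poly_Mapping.single m c = indet i * q)"
    by (rule monomial_induct) auto
  then show ?thesis using 2 assms(2) that by auto
qed (use that[of _ 0] in simp)

lemma homogeneous_constant:
  assumes "p \<in> homogeneous 0" obtains c where "p = const c"
  using assms
proof (cases rule: homogeneous_cases)
  case (2 m c)
  then have "m = 0" using mgrade_simps(4)[of m 0] by simp
  then show ?thesis using that 2 by (simp add: const_def)
qed (use that[of 0] in \<open>simp add: const_def\<close>)

lemma const_simps: "const 0 = 0" "const 1 = 1" "const a * const b = const (a * b)"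
  by (simp_all add: const_def mult_single)

definition total :: "'d::finite grade \<Rightarrow> int" where "total w = (\<Sum>i\<in>UNIV. lookup w i)"

lemma total_simps [simp]: "total (v + w) = total v + total w" "total (v - w) = total v - total w"
   "total (unit_grade i) = 1" "total 0 = 0"
  by (simp_all add: total_def lookup_add lookup_minus sum.distrib sum_subtractf unit_grade_def lookup_single when_def)

lemma homogeneous_negative: "p \<in> homogeneous w \<Longrightarrow> total w < 0 \<Longrightarrow> p = 0"
proof (erule homogeneous_cases)
  fix m c assume "total w < 0" "mgrade m = w"
  moreover have "total (mgrade m) \<ge> 0" by (simp add: total_def sum_nonneg)
  ultimately show ?thesis by simp
qed simp

section \<open>Graded modules and their homogeneous parts\<close>

definition part :: "('d::finite, 'k::field, 'm) pmodule \<Rightarrow> 'd grade \<Rightarrow> 'm \<Rightarrow> 'm" where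
  "part M u x = (THE xs. (\<forall>u. xs u \<in> component M u) \<and> finite {u. xs u \<noteq> \<zero>\<^bsub>M\<^esub>} \<and>
        x = (\<Oplus>\<^bsub>M\<^esub>u \<in> {u. xs u \<noteq> \<zero>\<^bsub>M\<^esub>}. xs u)) u"

locale graded_mod =
  fixes M :: "('d::finite, 'k::field, 'm) pmodule" (structure)
  assumes graded: "is_graded_module M"
begin

lemma is_module: "Module.module poly_ring M"
  using graded by (simp add: is_graded_module_def)

end

sublocale graded_mod \<subseteq> abelian_group M
  using is_module by (simp add: Module.module_def)

context graded_mod
begin

lemma smult_closed [simp, intro]: "x \<in> carrier M \<Longrightarrow> p \<odot> x \<in> carrier M"
  and smult_add_left: "x \<in> carrier M \<Longrightarrow> (p + q) \<odot> x = p \<odot> x \<oplus> q \<odot> x"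
  and smult_add_right: "x \<in> carrier M \<Longrightarrow> y \<in> carrier M \<Longrightarrow> p \<odot> (x \<oplus> y) = p \<odot> x \<oplus> p \<odot> y"
  and smult_smult: "x \<in> carrier M \<Longrightarrow> (p * q) \<odot> x = p \<odot> (q \<odot> x)"
  and smult_one [simp]: "x \<in> carrier M \<Longrightarrow> 1 \<odot> x = x"
  and smult_zero_left [simp]: "x \<in> carrier M \<Longrightarrow> 0 \<odot> x = \<zero>"
  and smult_zero_right [simp]: "p \<odot> \<zero> = \<zero>"
  and smult_finsum: "finite A \<Longrightarrow> g \<in> A \<rightarrow> carrier M \<Longrightarrow> p \<odot> (\<Oplus>i\<in>A. g i) = (\<Oplus>i\<in>A. p \<odot> g i)"
  using module.smult_closed[OF is_module] module.smult_l_distr[OF is_module]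
    module.smult_r_distr[OF is_module] module.smult_assoc1[OF is_module]
    module.smult_one[OF is_module] module.smult_l_null[OF is_module]
    module.smult_r_null[OF is_module] module.finsum_smult_ldistr[OF is_module]
  by auto

lemma diff_closed [simp, intro]: "x \<in> carrier M \<Longrightarrow> y \<in> carrier M \<Longrightarrow> x \<ominus> y \<in> carrier M"
  by (simp add: minus_eq)

lemma add_diff: "x \<in> carrier M \<Longrightarrow> y \<in> carrier M \<Longrightarrow> y \<oplus> (x \<ominus> y) = x"
  by (metis a_comm a_inv_closed a_lcomm minus_eq r_neg r_zero)

lemma diff_self [simp]: "x \<in> carrier M \<Longrightarrow> x \<ominus> x = \<zero>"
  by (simp add: minus_eq r_neg)

lemma diff_eq_zero: "x \<in> carrier M \<Longrightarrow> y \<in> carrier M \<Longrightarrow> x \<ominus> y = \<zero> \<longleftrightarrow> x = y"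
  using add_diff[of x y] by auto

lemma smult_minus_left: "x \<in> carrier M \<Longrightarrow> (- p) \<odot> x = \<ominus> (p \<odot> x)"
  using smult_add_left[of x "-p" p] by (metis add.left_inverse minus_equality smult_closed smult_zero_left)

lemma subgroup_component: "subgroup (component M u) (add_monoid M)"
  using graded by (simp add: is_graded_module_def)

lemma component_closed [intro]: "x \<in> component M u \<Longrightarrow> x \<in> carrier M"
  using subgroup.subset[OF subgroup_component] by auto

lemma component_zero [simp, intro]: "\<zero> \<in> component M u"
  using subgroup.one_closed[OF subgroup_component] by simp

lemma component_add [intro]: "x \<in> component M u \<Longrightarrow> y \<in> component M u \<Longrightarrow> x \<oplus> y \<in> component M u"
  using subgroup.m_closed[OF subgroup_component] by simp

lemma component_minus [intro]: "x \<in> component M u \<Longrightarrow> \<ominus> x \<in> component M u"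
  using subgroup.m_inv_closed[OF subgroup_component] by (simp add: a_inv_def)

lemma component_diff: "x \<in> component M u \<Longrightarrow> y \<in> component M u \<Longrightarrow> x \<ominus> y \<in> component M u"
  by (simp add: minus_eq component_add component_minus)

lemma component_finsum: "(\<And>i. i \<in> A \<Longrightarrow> g i \<in> component M u) \<Longrightarrow> (\<Oplus>i\<in>A. g i) \<in> component M u"
proof (induction A rule: infinite_finite_induct)
  case (insert x F)
  then have "g \<in> F \<rightarrow> carrier M" "g x \<in> carrier M" by auto
  with insert show ?case by (simp add: finsum_insert component_add)
qed auto

lemma const_component: "x \<in> component M u \<Longrightarrow> const c \<odot> x \<in> component M u"
  using graded by (auto simp: is_graded_module_def)

lemma indet_component: "x \<in> component M u \<Longrightarrow> indet i \<odot> x \<in> component M (u + unit_grade i)"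
  using graded by (auto simp: is_graded_module_def)

lemma smult_component:
  assumes "p \<in> homogeneous w" "x \<in> component M u" shows "p \<odot> x \<in> component M (w + u)"
  using assms(1)
proof (cases rule: homogeneous_cases)
  case (2 m c)
  have "Poly_Mapping.single m c \<odot> x \<in> component M (mgrade m + u)"
  proof (rule monomial_induct)
    fix m i and c :: 'k assume "Poly_Mapping.single m c \<odot> x \<in> component M (mgrade m + u)"
    from indet_component[OF this, of i]
    show "(indet i * Poly_Mapping.single m c) \<odot> x \<in> component M (mgrade (m + Poly_Mapping.single i 1) + u)"
      using assms(2) smult_smult[of x] component_closed by (simp add: ac_simps unit_grade_def)
  qed (use assms const_component in auto)
  then show ?thesis using 2 by simp
qed (use component_closed[OF assms(2)] in simp)

lemma finsum_support:
  assumes "finite U" "{u. xs u \<noteq> \<zero>} \<subseteq> U" "\<And>u. xs u \<in> carrier M"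
  shows "(\<Oplus>u\<in>{u. xs u \<noteq> \<zero>}. xs u) = (\<Oplus>u\<in>U. xs u)"
  by (rule add.finprod_mono_neutral_cong_left) (use assms in auto)

lemma ex1_parts:
  assumes "x \<in> carrier M"
  shows "\<exists>!xs. (\<forall>u. xs u \<in> component M u) \<and> finite {u. xs u \<noteq> \<zero>} \<and> x = (\<Oplus>u \<in> {u. xs u \<noteq> \<zero>}. xs u)"
  using graded unfolding is_graded_module_def by (elim conjE) (erule bspec[OF _ assms])

lemma part_props:
  assumes "x \<in> carrier M"
  shows part_component: "part M u x \<in> component M u" and finite_part: "finite {u. part M u x \<noteq> \<zero>}"
    and finsum_part': "(\<Oplus>u\<in>{u. part M u x \<noteq> \<zero>}. part M u x) = x"
proof -
  define xs where "xs = (THE xs. (\<forall>u. xs u \<in> component M u) \<and> finite {u. xs u \<noteq> \<zero>} \<and> x = (\<Oplus>u \<in> {u. xs u \<noteq> \<zero>}. xs u))"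
  have "(\<forall>u. xs u \<in> component M u) \<and> finite {u. xs u \<noteq> \<zero>} \<and> x = (\<Oplus>u \<in> {u. xs u \<noteq> \<zero>}. xs u)"
    unfolding xs_def by (rule theI'[OF ex1_parts[OF assms]])
  moreover have "part M u x = xs u" for u by (simp add: part_def xs_def)
  ultimately show "part M u x \<in> component M u" "finite {u. part M u x \<noteq> \<zero>}"
    "(\<Oplus>u\<in>{u. part M u x \<noteq> \<zero>}. part M u x) = x" by auto
qed

lemma part_closed [simp, intro]: "x \<in> carrier M \<Longrightarrow> part M u x \<in> carrier M"
  using part_component by blast

lemma finsum_part:
  "x \<in> carrier M \<Longrightarrow> finite U \<Longrightarrow> {u. part M u x \<noteq> \<zero>} \<subseteq> U \<Longrightarrow> (\<Oplus>u\<in>U. part M u x) = x"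
  using finsum_support[of U "\<lambda>u. part M u x", OF _ _ part_closed] finsum_part' by simp

lemma part_unique:
  assumes "\<And>u. xs u \<in> component M u" "finite U" "\<And>u. u \<notin> U \<Longrightarrow> xs u = \<zero>" "x = (\<Oplus>u\<in>U. xs u)"
  shows "part M u x = xs u"
proof -
  have sub: "{u. xs u \<noteq> \<zero>} \<subseteq> U" using assms(3) by auto
  have x: "x \<in> carrier M" using assms(1) by (auto simp: assms(4) intro!: finsum_closed)
  have "x = (\<Oplus>u \<in> {u. xs u \<noteq> \<zero>}. xs u)"
    using finsum_support[OF assms(2) sub component_closed[OF assms(1)]] assms(4) by simp
  moreover have "finite {u. xs u \<noteq> \<zero>}" using sub assms(2) finite_subset by blast
  ultimately show ?thesis
    using the1_equality[OF ex1_parts[OF x], of xs] assms(1) by (simp add: part_def)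
qed

lemma part_add:
  assumes "x \<in> carrier M" "y \<in> carrier M"
  shows "part M u (x \<oplus> y) = part M u x \<oplus> part M u y"
proof (rule part_unique[where U="{u. part M u x \<noteq> \<zero>} \<union> {u. part M u y \<noteq> \<zero>}"])
  let ?U = "{u. part M u x \<noteq> \<zero>} \<union> {u. part M u y \<noteq> \<zero>}"
  have "(\<Oplus>u\<in>?U. part M u x \<oplus> part M u y) = (\<Oplus>u\<in>?U. part M u x) \<oplus> (\<Oplus>u\<in>?U. part M u y)"
    using assms by (intro finsum_addf) auto
  then show "x \<oplus> y = (\<Oplus>u\<in>?U. part M u x \<oplus> part M u y)"
    using assms by (simp add: finsum_part finite_part)
qed (use assms part_component component_add in \<open>auto simp: finite_part\<close>)

lemma part_same: "x \<in> component M u \<Longrightarrow> part M u x = x"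
  and part_other: "x \<in> component M u \<Longrightarrow> v \<noteq> u \<Longrightarrow> part M v x = \<zero>"
proof -
  assume x: "x \<in> component M u"
  have "part M v x = (if v = u then x else \<zero>)" for v
    by (rule part_unique[where U="{u}"]) (use x component_closed[OF x] in \<open>auto simp: finsum_insert\<close>)
  then show "part M u x = x" "v \<noteq> u \<Longrightarrow> part M v x = \<zero>" by auto
qed

lemma part_zero [simp]: "part M u \<zero> = \<zero>"
  using part_same[of \<zero> u] by simp

lemma zero_if_parts_zero: "x \<in> carrier M \<Longrightarrow> (\<And>u. part M u x = \<zero>) \<Longrightarrow> x = \<zero>"
  using finsum_part[of x "{}"] by simp

text \<open>Every element is a finite sum of homogeneous ones, so additive properties can be checked on these.\<close>

lemma homogeneous_induct [consumes 1, case_names component add]: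
  assumes "x \<in> carrier M" and "\<And>u x. x \<in> component M u \<Longrightarrow> P x"
    and "\<And>x y. x \<in> carrier M \<Longrightarrow> y \<in> carrier M \<Longrightarrow> P x \<Longrightarrow> P y \<Longrightarrow> P (x \<oplus> y)"
  shows "P x"
proof -
  have "(\<Oplus>u\<in>U. part M u x) \<in> carrier M \<and> P (\<Oplus>u\<in>U. part M u x)" if "finite U" for U
    using that
  proof (induction U)
    case empty
    then show ?case using assms(2)[of \<zero>] by auto
  next
    case (insert u U)
    have "(\<lambda>u. part M u x) \<in> U \<rightarrow> carrier M" using assms(1) by simp
    then have "(\<Oplus>u\<in>insert u U. part M u x) = part M u x \<oplus> (\<Oplus>u\<in>U. part M u x)"
      using assms(1) insert(1,2) by (simp add: finsum_insert)
    then show ?case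
      using insert(3) assms(3)[OF _ _ assms(2)[OF part_component[OF assms(1), of u]]] assms(1) by simp
  qed
  from this[OF finite_part[OF assms(1)]] show ?thesis by (simp add: finsum_part'[OF assms(1)])
qed

end

text \<open>
  In concrete modules the projections \<open>\<pi>\<close> to the components are explicit. Applied to a decomposition,
  they return its members because they are additive, so decompositions are unique.
\<close>

lemma is_graded_moduleI:
  fixes M :: "('d::finite, 'k::field, 'm) pmodule" (structure)
  assumes mod: "Module.module poly_ring M"
    and sub: "\<And>u. subgroup (component M u) (add_monoid M)"
    and const: "\<And>u c x. x \<in> component M u \<Longrightarrow> const c \<odot> x \<in> component M u"
    and indet: "\<And>i u x. x \<in> component M u \<Longrightarrow> indet i \<odot> x \<in> component M (u + unit_grade i)"
    and closed: "\<And>u x. x \<in> carrier M \<Longrightarrow> \<pi> u x \<in> component M u"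
    and same: "\<And>u x. x \<in> component M u \<Longrightarrow> \<pi> u x = x"
    and other: "\<And>u v x. x \<in> component M u \<Longrightarrow> v \<noteq> u \<Longrightarrow> \<pi> v x = \<zero>"
    and add: "\<And>u x y. x \<in> carrier M \<Longrightarrow> y \<in> carrier M \<Longrightarrow> \<pi> u (x \<oplus> y) = \<pi> u x \<oplus> \<pi> u y"
    and sum: "\<And>x. x \<in> carrier M \<Longrightarrow> \<exists>U. finite U \<and> (\<forall>u. u \<notin> U \<longrightarrow> \<pi> u x = \<zero>) \<and> x = (\<Oplus>u\<in>U. \<pi> u x)"
  shows "is_graded_module M"
proof -
  interpret abelian_group M using mod by (simp add: Module.module_def)
  have cc: "x \<in> carrier M" if "x \<in> component M u" for x u using subgroup.subset[OF sub[of u]] that by auto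
  have zero: "\<zero> \<in> component M u" for u using subgroup.one_closed[OF sub[of u]] by simp
  have support: "(\<Oplus>u\<in>{u. xs u \<noteq> \<zero>}. xs u) = (\<Oplus>u\<in>U. xs u)"
    if "finite U" "{u. xs u \<noteq> \<zero>} \<subseteq> U" "\<And>u. xs u \<in> component M u" for xs and U :: "'d grade set"
    by (rule add.finprod_mono_neutral_cong_left) (use that(1,2) cc[OF that(3)] in auto)
  have unique: "\<pi> v (\<Oplus>u\<in>U. xs u) = (if v \<in> U then xs v else \<zero>)"
    if "finite U" "\<And>u. xs u \<in> component M u" for xs U v
    using that(1)
  proof (induction U)
    case empty
    then show ?case using same[OF zero] by simp
  next
    case (insert u U)
    have *: "xs \<in> U \<rightarrow> carrier M" "xs u \<in> carrier M" using cc[OF that(2)] by auto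
    have "\<pi> v (\<Oplus>u\<in>insert u U. xs u) = \<pi> v (xs u) \<oplus> \<pi> v (\<Oplus>u\<in>U. xs u)"
      using * insert by (simp add: finsum_insert add finsum_closed)
    moreover have "xs v \<in> carrier M" using cc that(2) by blast
    moreover have "v \<noteq> u \<Longrightarrow> \<pi> v (xs u) = \<zero>" "v = u \<Longrightarrow> \<pi> v (xs u) = xs u"
      using other[OF that(2), of v u] same[OF that(2), of u] by simp_all
    ultimately show ?case using insert(2,3) by (cases "v = u") auto
  qed
  have "\<exists>!xs. (\<forall>u. xs u \<in> component M u) \<and> finite {u. xs u \<noteq> \<zero>} \<and> x = (\<Oplus>u \<in> {u. xs u \<noteq> \<zero>}. xs u)"
    if x: "x \<in> carrier M" for x
  proof (rule ex1I)
    from sum[OF x] obtain U where U: "finite U" "\<forall>u. u \<notin> U \<longrightarrow> \<pi> u x = \<zero>" "x = (\<Oplus>u\<in>U. \<pi> u x)"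
      by blast
    then have sub: "{u. \<pi> u x \<noteq> \<zero>} \<subseteq> U" by auto
    show "(\<forall>u. \<pi> u x \<in> component M u) \<and> finite {u. \<pi> u x \<noteq> \<zero>} \<and>
      x = (\<Oplus>u \<in> {u. \<pi> u x \<noteq> \<zero>}. \<pi> u x)"
      using closed[OF x] support[OF U(1) sub closed[OF x]] U(3) finite_subset[OF sub U(1)] by simp
  next
    fix xs assume *: "(\<forall>u. xs u \<in> component M u) \<and> finite {u. xs u \<noteq> \<zero>} \<and> x = (\<Oplus>u \<in> {u. xs u \<noteq> \<zero>}. xs u)"
    show "xs = (\<lambda>u. \<pi> u x)"
    proof
      fix v
      have "\<pi> v x = \<pi> v (\<Oplus>u \<in> {u. xs u \<noteq> \<zero>}. xs u)" using * by simp
      also have "\<dots> = xs v" using unique[of "{u. xs u \<noteq> \<zero>}" xs v] * by simp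
      finally show "xs v = \<pi> v x" ..
    qed
  qed
  then show ?thesis using mod sub const indet by (simp add: is_graded_module_def)
qed


section \<open>Graded homomorphisms\<close>

locale graded_homo = M: graded_mod M + N: graded_mod N
  for M :: "('d::finite, 'k::field, 'm) pmodule" and N :: "('d, 'k, 'n) pmodule" and \<phi> +
  assumes homo: "graded_hom M N \<phi>"
begin

lemma closed [simp, intro]: "x \<in> carrier M \<Longrightarrow> \<phi> x \<in> carrier N"
  and add: "x \<in> carrier M \<Longrightarrow> y \<in> carrier M \<Longrightarrow> \<phi> (x \<oplus>\<^bsub>M\<^esub> y) = \<phi> x \<oplus>\<^bsub>N\<^esub> \<phi> y"
  and smult: "x \<in> carrier M \<Longrightarrow> \<phi> (p \<odot>\<^bsub>M\<^esub> x) = p \<odot>\<^bsub>N\<^esub> \<phi> x"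
  and component: "x \<in> component M u \<Longrightarrow> \<phi> x \<in> component N u"
  using homo by (auto simp: graded_hom_def hom_def image_subset_iff)

lemma zero [simp]: "\<phi> \<zero>\<^bsub>M\<^esub> = \<zero>\<^bsub>N\<^esub>"
  using smult[of "\<zero>\<^bsub>M\<^esub>" 0] by simp

lemma minus: "x \<in> carrier M \<Longrightarrow> \<phi> (\<ominus>\<^bsub>M\<^esub> x) = \<ominus>\<^bsub>N\<^esub> \<phi> x"
  using smult[of x "- 1"] by (simp add: M.smult_minus_left N.smult_minus_left)

lemma diff: "x \<in> carrier M \<Longrightarrow> y \<in> carrier M \<Longrightarrow> \<phi> (x \<ominus>\<^bsub>M\<^esub> y) = \<phi> x \<ominus>\<^bsub>N\<^esub> \<phi> y"
  by (simp add: M.minus_eq N.minus_eq add minus)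

lemma finsum: "(\<And>i. i \<in> A \<Longrightarrow> g i \<in> carrier M) \<Longrightarrow> \<phi> (\<Oplus>\<^bsub>M\<^esub>i\<in>A. g i) = (\<Oplus>\<^bsub>N\<^esub>i\<in>A. \<phi> (g i))"
proof (induction A rule: infinite_finite_induct)
  case (insert x F)
  then have "g \<in> F \<rightarrow> carrier M" "(\<lambda>i. \<phi> (g i)) \<in> F \<rightarrow> carrier N" "g x \<in> carrier M" by auto
  with insert show ?case by (simp add: M.finsum_insert N.finsum_insert add M.finsum_closed)
qed auto

lemma part: assumes "x \<in> carrier M" shows "part N u (\<phi> x) = \<phi> (part M u x)"
proof (rule N.part_unique)
  show "\<phi> x = (\<Oplus>\<^bsub>N\<^esub>u\<in>{u. part M u x \<noteq> \<zero>\<^bsub>M\<^esub>}. \<phi> (part M u x))"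
    using assms by (subst finsum[symmetric]) (auto simp: M.finsum_part')
qed (use assms M.part_component component M.finite_part in auto)

lemma kernel_closed: "x \<in> mor_kernel M N \<phi> \<Longrightarrow> x \<in> carrier M"
  by (simp add: mor_kernel_def)

lemma inj_on_if_kernel: "mor_kernel M N \<phi> \<subseteq> {\<zero>\<^bsub>M\<^esub>} \<Longrightarrow> inj_on \<phi> (carrier M)"
proof (rule inj_onI)
  fix x y assume *: "mor_kernel M N \<phi> \<subseteq> {\<zero>\<^bsub>M\<^esub>}" "x \<in> carrier M" "y \<in> carrier M" "\<phi> x = \<phi> y"
  then have "x \<ominus>\<^bsub>M\<^esub> y \<in> mor_kernel M N \<phi>" by (simp add: mor_kernel_def diff N.diff_eq_zero)
  then show "x = y" using * by (auto simp: M.diff_eq_zero)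
qed

text \<open>
  As homomorphisms commute with homogeneous parts, a preimage of a homogeneous element may be replaced
  by one of its homogeneous parts.
\<close>

lemma component_preimage:
  assumes "x \<in> carrier M" "\<phi> x \<in> component N u"
  shows "part M u x \<in> component M u \<and> \<phi> (part M u x) = \<phi> x"
  using M.part_component[OF assms(1)] part[OF assms(1), of u] N.part_same[OF assms(2)] by simp

end

lemma graded_homoI:
  "is_graded_module M \<Longrightarrow> is_graded_module N \<Longrightarrow> graded_hom M N \<phi> \<Longrightarrow> graded_homo M N \<phi>"
  by (simp add: graded_homo_def graded_homo_axioms_def graded_mod_def)

lemma graded_homI:
  assumes "\<And>x. x \<in> carrier M \<Longrightarrow> \<phi> x \<in> carrier N"
    and "\<And>x y. x \<in> carrier M \<Longrightarrow> y \<in> carrier M \<Longrightarrow> \<phi> (x \<oplus>\<^bsub>M\<^esub> y) = \<phi> x \<oplus>\<^bsub>N\<^esub> \<phi> y"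
    and "\<And>p x. x \<in> carrier M \<Longrightarrow> \<phi> (p \<odot>\<^bsub>M\<^esub> x) = p \<odot>\<^bsub>N\<^esub> \<phi> x"
    and "\<And>u x. x \<in> component M u \<Longrightarrow> \<phi> x \<in> component N u"
  shows "graded_hom M N \<phi>"
  using assms by (auto simp: graded_hom_def hom_def)

lemma graded_hom_comp: "graded_hom M N \<phi> \<Longrightarrow> graded_hom N L \<psi> \<Longrightarrow> graded_hom M L (\<lambda>x. \<psi> (\<phi> x))"
  unfolding graded_hom_def hom_def by (auto simp: image_subset_iff Pi_iff)

lemma graded_hom_id: "graded_hom M M (\<lambda>x. x)"
  by (simp add: graded_hom_def hom_def)

lemma graded_iso_id: "graded_iso M M (\<lambda>x. x)"
  by (simp add: graded_iso_def graded_hom_id bij_betw_def)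

lemma graded_iso_comp: "graded_iso M N \<phi> \<Longrightarrow> graded_iso N L \<psi> \<Longrightarrow> graded_iso M L (\<lambda>x. \<psi> (\<phi> x))"
  using bij_betw_trans[of \<phi> "carrier M" "carrier N" \<psi> "carrier L"]
  by (auto simp: graded_iso_def o_def intro: graded_hom_comp)

lemma graded_iso_closed: "graded_iso M N \<phi> \<Longrightarrow> x \<in> carrier M \<Longrightarrow> \<phi> x \<in> carrier N"
  by (auto simp: graded_iso_def bij_betw_def)

text \<open>
  The preimage of a homogeneous element equals one of its homogeneous parts by injectivity; therefore
  the inverse preserves grades.
\<close>

lemma graded_iso_inverse:
  assumes M: "is_graded_module M" and N: "is_graded_module N" and \<phi>: "graded_iso M N \<phi>"
  obtains \<psi> where "graded_iso N M \<psi>" "\<forall>x\<in>carrier M. \<psi> (\<phi> x) = x" "\<forall>y\<in>carrier N. \<phi> (\<psi> y) = y"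
proof -
  interpret graded_homo M N \<phi> using assms by (simp add: graded_homoI graded_iso_def)
  define \<psi> where "\<psi> = inv_into (carrier M) \<phi>"
  have bij: "bij_betw \<phi> (carrier M) (carrier N)" using \<phi> by (simp add: graded_iso_def)
  have 1: "x \<in> carrier M \<Longrightarrow> \<psi> (\<phi> x) = x" for x using bij by (simp add: \<psi>_def bij_betw_inv_into_left)
  have 2: "y \<in> carrier N \<Longrightarrow> \<phi> (\<psi> y) = y" for y using bij by (simp add: \<psi>_def bij_betw_inv_into_right)
  have bij': "bij_betw \<psi> (carrier N) (carrier M)" using bij by (simp add: \<psi>_def bij_betw_inv_into)
  then have c: "y \<in> carrier N \<Longrightarrow> \<psi> y \<in> carrier M" for y by (rule bij_betwE[rule_format])
  have "graded_hom N M \<psi>"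
  proof (rule graded_homI)
    fix x y assume "x \<in> carrier N" "y \<in> carrier N"
    then show "\<psi> (x \<oplus>\<^bsub>N\<^esub> y) = \<psi> x \<oplus>\<^bsub>M\<^esub> \<psi> y" using 1[of "\<psi> x \<oplus>\<^bsub>M\<^esub> \<psi> y"] by (simp add: add c 2)
  next
    fix x p assume "x \<in> carrier N"
    then show "\<psi> (p \<odot>\<^bsub>N\<^esub> x) = p \<odot>\<^bsub>M\<^esub> \<psi> x" using 1[of "p \<odot>\<^bsub>M\<^esub> \<psi> x"] by (simp add: smult c 2)
  next
    fix x u assume x: "x \<in> component N u"
    then have "\<psi> x \<in> carrier M" "\<phi> (\<psi> x) = x" using c 2 N.component_closed by blast+
    then show "\<psi> x \<in> component M u" using component_preimage[of "\<psi> x" u] x 1 M.part_closed by metis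
  qed (rule c)
  then show ?thesis using that 1 2 bij' by (simp add: graded_iso_def)
qed

lemma isomorphic_modules_refl: "isomorphic_modules M M"
  using graded_iso_id by (auto simp: isomorphic_modules_def)

lemma isomorphic_modules_trans:
  "isomorphic_modules M N \<Longrightarrow> isomorphic_modules N L \<Longrightarrow> isomorphic_modules M L"
  unfolding isomorphic_modules_def by (elim exE, rule exI, erule (1) graded_iso_comp)

lemma isomorphic_modules_sym:
  "is_graded_module M \<Longrightarrow> is_graded_module N \<Longrightarrow> isomorphic_modules M N \<Longrightarrow> isomorphic_modules N M"
  unfolding isomorphic_modules_def by (elim exE, rule graded_iso_inverse) blast+

section \<open>Multiples of the maximal graded ideal\<close>

context graded_mod
begin

lemma part_finsum: "(\<And>i. i \<in> A \<Longrightarrow> g i \<in> carrier M) \<Longrightarrow> part M u (\<Oplus>i\<in>A. g i) = (\<Oplus>i\<in>A. part M u (g i))"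
proof (induction A rule: infinite_finite_induct)
  case (insert x F)
  then have "g \<in> F \<rightarrow> carrier M" "(\<lambda>i. part M u (g i)) \<in> F \<rightarrow> carrier M" "g x \<in> carrier M" by auto
  with insert show ?case by (simp add: finsum_insert part_add finsum_closed)
qed auto

lemma part_indet:
  assumes "x \<in> carrier M" shows "part M u (indet i \<odot> x) = indet i \<odot> part M (u - unit_grade i) x"
  using assms
proof (induction rule: homogeneous_induct)
  case (component v x)
  then have *: "indet i \<odot> x \<in> component M (v + unit_grade i)" by (rule indet_component)
  show ?case
  proof (cases "u = v + unit_grade i")
    case True
    then show ?thesis using part_same[OF *] part_same[OF component] by simp
  next
    case False
    then have "u - unit_grade i \<noteq> v" by auto
    then show ?thesis using part_other[OF * False] part_other[OF component] by simp
  qed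
next
  case (add x y)
  then show ?case by (simp add: smult_add_right part_add)
qed

lemma max_ideal_timesI: "(\<And>i. x i \<in> carrier M) \<Longrightarrow> y = (\<Oplus>i\<in>UNIV. indet i \<odot> x i) \<Longrightarrow> y \<in> max_ideal_times M"
  by (auto simp: max_ideal_times_def)

lemma max_ideal_timesE:
  assumes "y \<in> max_ideal_times M"
  obtains x where "\<And>i. x i \<in> carrier M" "y = (\<Oplus>i\<in>UNIV. indet i \<odot> x i)"
  using assms by (auto simp: max_ideal_times_def)

lemma max_ideal_times_closed: "y \<in> max_ideal_times M \<Longrightarrow> y \<in> carrier M"
  by (elim max_ideal_timesE) (simp add: finsum_closed)

lemma max_ideal_times_indet: assumes "x \<in> carrier M" shows "indet i \<odot> x \<in> max_ideal_times M"
proof (rule max_ideal_timesI)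
  have "(\<Oplus>j\<in>UNIV. indet j \<odot> (if j = i then x else \<zero>)) = (\<Oplus>j\<in>UNIV. if i = j then indet j \<odot> x else \<zero>)"
    by (rule finsum_cong') (use assms in auto)
  also have "\<dots> = indet i \<odot> x" using assms by (intro finsum_singleton) auto
  finally show "indet i \<odot> x = (\<Oplus>j\<in>UNIV. indet j \<odot> (if j = i then x else \<zero>))" ..
qed (use assms in auto)

lemma max_ideal_times_zero [simp]: "\<zero> \<in> max_ideal_times M"
  using max_ideal_times_indet[of \<zero>] by simp

lemma max_ideal_times_add:
  assumes "x \<in> max_ideal_times M" "y \<in> max_ideal_times M" shows "x \<oplus> y \<in> max_ideal_times M"
proof -
  obtain a b where "\<And>i. a i \<in> carrier M" "x = (\<Oplus>i\<in>UNIV. indet i \<odot> a i)"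
      "\<And>i. b i \<in> carrier M" "y = (\<Oplus>i\<in>UNIV. indet i \<odot> b i)"
    using assms by (elim max_ideal_timesE) blast
  then show ?thesis
    by (intro max_ideal_timesI[of "\<lambda>i. a i \<oplus> b i"]) (auto simp: smult_add_right finsum_addf)
qed

lemma max_ideal_times_finsum:
  "(\<And>i. i \<in> A \<Longrightarrow> g i \<in> max_ideal_times M) \<Longrightarrow> (\<Oplus>i\<in>A. g i) \<in> max_ideal_times M"
proof (induction A rule: infinite_finite_induct)
  case (insert x F)
  then have "g \<in> F \<rightarrow> carrier M" "g x \<in> carrier M" using max_ideal_times_closed by auto
  with insert show ?case by (simp add: finsum_insert max_ideal_times_add)
qed auto

text \<open>
  The coefficients of a homogeneous multiple can be taken homogeneous of smaller total degree, which is
  what makes inductions on the total degree work.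
\<close>

lemma max_ideal_times_homogeneous:
  assumes "y \<in> max_ideal_times M" "y \<in> component M u"
  obtains x where "\<forall>i. x i \<in> component M (u - unit_grade i)" "y = (\<Oplus>i\<in>UNIV. indet i \<odot> x i)"
proof -
  obtain x where x: "\<And>i. x i \<in> carrier M" "y = (\<Oplus>i\<in>UNIV. indet i \<odot> x i)"
    using assms by (elim max_ideal_timesE) blast
  have "y = part M u y" using part_same[OF assms(2)] by simp
  also have "\<dots> = (\<Oplus>i\<in>UNIV. indet i \<odot> part M (u - unit_grade i) (x i))"
    unfolding x(2) using x(1) by (subst part_finsum) (auto simp: part_indet)
  finally show ?thesis using that[of "\<lambda>i. part M (u - unit_grade i) (x i)"] part_component x(1) by blast
qed

lemma in_max_ideal_times_if_parts:
  assumes "y \<in> carrier M" "\<And>u. part M u y \<in> max_ideal_times M" shows "y \<in> max_ideal_times M"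
  using max_ideal_times_finsum[of "{u. part M u y \<noteq> \<zero>}" "\<lambda>u. part M u y"] finsum_part'[OF assms(1)] assms(2)
  by simp

end

lemma (in graded_homo) max_ideal_times: "x \<in> max_ideal_times M \<Longrightarrow> \<phi> x \<in> max_ideal_times N"
  by (elim M.max_ideal_timesE, rule N.max_ideal_timesI[of "\<lambda>i. \<phi> (_ i)"])
    (auto simp: finsum smult)

text \<open>
  Graded modules whose components vanish in low total degree are those for which Nakayama's lemma
  is an induction on the degree.
\<close>

definition bounded_below :: "('d::finite, 'k::field, 'm) pmodule \<Rightarrow> bool" where
  "bounded_below M \<longleftrightarrow> (\<exists>b. \<forall>u x. total u < b \<longrightarrow> x \<in> component M u \<longrightarrow> x = \<zero>\<^bsub>M\<^esub>)"

lemma bounded_below_induct [consumes 2, case_names low step]: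
  assumes "bounded_below M" "x \<in> component M u"
    and "\<And>u. P u \<zero>\<^bsub>M\<^esub>"
    and "\<And>u x. x \<in> component M u \<Longrightarrow> (\<And>i y. y \<in> component M (u - unit_grade i) \<Longrightarrow> P (u - unit_grade i) y) \<Longrightarrow> P u x"
  shows "P u x"
proof -
  obtain b where b: "\<And>u x. total u < b \<Longrightarrow> x \<in> component M u \<Longrightarrow> x = \<zero>\<^bsub>M\<^esub>"
    using assms(1) by (auto simp: bounded_below_def)
  show ?thesis using assms(2)
  proof (induction "nat (total u - b + 1)" arbitrary: u x)
    case 0
    then have "x = \<zero>\<^bsub>M\<^esub>" by (intro b[of u]) auto
    then show ?case using assms(3) by simp
  next
    case (Suc n)
    show ?case
    proof (rule assms(4)[OF Suc(3)])
      fix i y assume "y \<in> component M (u - unit_grade i)"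
      then show "P (u - unit_grade i) y" using Suc(2) by (intro Suc(1)) auto
    qed
  qed
qed


section \<open>Kernels and images\<close>

definition graded_submodule :: "('d::finite, 'k::field, 'm) pmodule \<Rightarrow> 'm set \<Rightarrow> bool" where
  "graded_submodule M S \<longleftrightarrow> submodule S poly_ring M \<and> (\<forall>x \<in> S. \<forall>u. part M u x \<in> S)"

definition restr :: "('d::finite, 'k::field, 'm) pmodule \<Rightarrow> 'm set \<Rightarrow> ('d, 'k, 'm) pmodule" where
  "restr M S = M\<lparr>carrier := S, component := \<lambda>u. component M u \<inter> S\<rparr>"

lemma restr_simps [simp]:
  "carrier (restr M S) = S" "\<zero>\<^bsub>restr M S\<^esub> = \<zero>\<^bsub>M\<^esub>" "x \<oplus>\<^bsub>restr M S\<^esub> y = x \<oplus>\<^bsub>M\<^esub> y"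
  "p \<odot>\<^bsub>restr M S\<^esub> x = p \<odot>\<^bsub>M\<^esub> x" "component (restr M S) u = component M u \<inter> S"
  by (simp_all add: restr_def)

lemma poly_ring_cring: "cring poly_ring"
  by (rule cring_from_type_algebra)

context graded_mod
begin

lemma submoduleD:
  assumes "submodule S poly_ring M"
  shows "S \<subseteq> carrier M" "\<zero> \<in> S" "x \<in> S \<Longrightarrow> y \<in> S \<Longrightarrow> x \<oplus> y \<in> S" "x \<in> S \<Longrightarrow> p \<odot> x \<in> S"
    "x \<in> S \<Longrightarrow> \<ominus> x \<in> S"
  using module.submoduleE[OF is_module assms] subgroup.one_closed[OF submodule.axioms(1)[OF assms]]
  by auto

lemma submoduleI':
  assumes "S \<subseteq> carrier M" "\<zero> \<in> S" "\<And>x y. x \<in> S \<Longrightarrow> y \<in> S \<Longrightarrow> x \<oplus> y \<in> S"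
    "\<And>p x. x \<in> S \<Longrightarrow> p \<odot> x \<in> S"
  shows "submodule S poly_ring M"
proof (rule module.submoduleI[OF is_module])
  fix x assume "x \<in> S"
  then have "\<ominus> x = (- 1) \<odot> x" using smult_minus_left[of x 1] assms(1) by auto
  then show "\<ominus> x \<in> S" using assms(4) \<open>x \<in> S\<close> by simp
qed (use assms in auto)

lemma restr_abelian_group:
  assumes "submodule S poly_ring M" shows "abelian_group (restr M S)"
proof (rule abelian_groupI)
  fix x assume "x \<in> carrier (restr M S)"
  then show "\<exists>y\<in>carrier (restr M S). y \<oplus>\<^bsub>restr M S\<^esub> x = \<zero>\<^bsub>restr M S\<^esub>"
    using submoduleD[OF assms] by (auto intro!: bexI[of _ "\<ominus> x"] simp: l_neg)
qed (use submoduleD[OF assms] in \<open>auto simp: a_ac subset_iff\<close>)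

lemma finsum_restr:
  assumes "submodule S poly_ring M" "\<And>i. i \<in> A \<Longrightarrow> g i \<in> S"
  shows "finsum (restr M S) g A = finsum M g A"
proof -
  interpret R: abelian_group "restr M S" by (rule restr_abelian_group[OF assms(1)])
  show ?thesis using assms(2)
  proof (induction A rule: infinite_finite_induct)
    case (insert x F)
    then have "g \<in> F \<rightarrow> carrier M" "g x \<in> carrier M" using submoduleD[OF assms(1)] by auto
    with insert show ?case by (simp add: finsum_insert R.finsum_insert)
  qed auto
qed

lemma restr_graded:
  assumes "graded_submodule M S" shows "is_graded_module (restr M S)"
proof -
  have sub: "submodule S poly_ring M" and parts: "\<And>x u. x \<in> S \<Longrightarrow> part M u x \<in> S"
    using assms by (auto simp: graded_submodule_def)
  note S = submoduleD[OF sub]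
  show ?thesis
  proof (rule is_graded_moduleI[where \<pi>="part M"])
    show "Module.module poly_ring (restr M S)"
      by (rule moduleI[OF poly_ring_cring restr_abelian_group[OF sub]])
        (use S in \<open>auto simp: subset_iff smult_add_left smult_add_right smult_smult\<close>)
    have minus: "\<ominus>\<^bsub>restr M S\<^esub> x = \<ominus> x" if "x \<in> S" for x
      by (rule abelian_group.minus_equality[OF restr_abelian_group[OF sub]])
        (use that S in \<open>auto simp: l_neg subset_iff\<close>)
    show "subgroup (component (restr M S) u) (add_monoid (restr M S))" for u
    proof (rule subgroup.intro)
      fix x assume "x \<in> component (restr M S) u"
      then show "inv\<^bsub>add_monoid (restr M S)\<^esub> x \<in> component (restr M S) u"
        using minus[of x] S component_minus by (auto simp: a_inv_def)
    qed (use S component_add in auto)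
  next
    fix x assume x: "x \<in> carrier (restr M S)"
    then have "x \<in> carrier M" using S by auto
    then show "\<exists>U. finite U \<and> (\<forall>u. u \<notin> U \<longrightarrow> part M u x = \<zero>\<^bsub>restr M S\<^esub>) \<and>
        x = finsum (restr M S) (\<lambda>u. part M u x) U"
      using x finsum_part'[of x] finite_part[of x] parts
      by (intro exI[of _ "{u. part M u x \<noteq> \<zero>}"]) (auto simp: finsum_restr[OF sub])
  next
    fix x y u assume "x \<in> carrier (restr M S)" "y \<in> carrier (restr M S)"
    then show "part M u (x \<oplus>\<^bsub>restr M S\<^esub> y) = part M u x \<oplus>\<^bsub>restr M S\<^esub> part M u y"
      using part_add[of x y u] S(1) by auto
  next
    fix x u assume "x \<in> carrier (restr M S)"
    then show "part M u x \<in> component (restr M S) u" using S(1) part_component parts by auto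
  qed (use S parts const_component indet_component part_same part_other in auto)
qed

lemma restr_incl:
  assumes "graded_submodule M S" shows "graded_hom (restr M S) M (\<lambda>x. x)"
  using submoduleD(1) assms by (intro graded_homI) (auto simp: graded_submodule_def)

end

context graded_homo
begin

lemma kernel_submodule: "graded_submodule M (mor_kernel M N \<phi>)"
proof -
  have "submodule (mor_kernel M N \<phi>) poly_ring M"
    by (rule M.submoduleI') (auto simp: mor_kernel_def add smult)
  then show ?thesis by (auto simp: graded_submodule_def mor_kernel_def simp flip: part)
qed

lemma image_submodule: "graded_submodule N (\<phi> ` carrier M)"
proof -
  have "submodule (\<phi> ` carrier M) poly_ring N"
  proof (rule N.submoduleI')
    show "\<zero>\<^bsub>N\<^esub> \<in> \<phi> ` carrier M" using zero by (metis M.zero_closed image_eqI)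
  next
    fix x y assume "x \<in> \<phi> ` carrier M" "y \<in> \<phi> ` carrier M"
    then show "x \<oplus>\<^bsub>N\<^esub> y \<in> \<phi> ` carrier M" by (auto simp flip: add)
  next
    fix x p assume "x \<in> \<phi> ` carrier M"
    then show "p \<odot>\<^bsub>N\<^esub> x \<in> \<phi> ` carrier M" by (auto simp flip: smult)
  qed auto
  then show ?thesis by (auto simp: graded_submodule_def part)
qed

lemma image_hom: "graded_hom M (restr N (\<phi> ` carrier M)) \<phi>"
  by (rule graded_homI) (auto simp: add smult component M.component_closed)

lemma finitely_generated_image:
  assumes "finitely_generated M" "\<phi> ` carrier M = carrier N" shows "finitely_generated N"
proof -
  obtain S where S: "finite S" "S \<subseteq> carrier M" "\<And>L. submodule L poly_ring M \<Longrightarrow> S \<subseteq> L \<Longrightarrow> L = carrier M"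
    using assms(1) unfolding finitely_generated_def by blast
  show ?thesis unfolding finitely_generated_def
  proof (intro exI[of _ "\<phi> ` S"] conjI allI impI)
    fix L assume L: "submodule L poly_ring N \<and> \<phi> ` S \<subseteq> L"
    note LD = N.submoduleD[OF conjunct1[OF L]]
    have "submodule {x \<in> carrier M. \<phi> x \<in> L} poly_ring M"
      by (rule M.submoduleI') (use LD in \<open>auto simp: add smult\<close>)
    then have "{x \<in> carrier M. \<phi> x \<in> L} = carrier M" by (rule S(3)) (use S(2) L in auto)
    show "L = carrier N"
    proof
      show "carrier N \<subseteq> L"
        using \<open>{x \<in> carrier M. \<phi> x \<in> L} = carrier M\<close> unfolding assms(2)[symmetric] by blast
    qed (rule LD(1))
  qed (use S in auto)
qed

end

lemma finitely_generated_iso: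
  "is_graded_module M \<Longrightarrow> is_graded_module N \<Longrightarrow> isomorphic_modules M N \<Longrightarrow>
    finitely_generated M \<Longrightarrow> finitely_generated N"
  unfolding isomorphic_modules_def graded_iso_def bij_betw_def
  using graded_homo.finitely_generated_image graded_homoI by blast

section \<open>Direct sums\<close>

lemma component_subgroupI:
  assumes "abelian_group M" "S \<subseteq> carrier M" "\<zero>\<^bsub>M\<^esub> \<in> S"
    "\<And>x y. x \<in> S \<Longrightarrow> y \<in> S \<Longrightarrow> x \<oplus>\<^bsub>M\<^esub> y \<in> S" "\<And>x. x \<in> S \<Longrightarrow> \<ominus>\<^bsub>M\<^esub> x \<in> S"
  shows "subgroup S (add_monoid M)"
  by (rule subgroup.intro) (use assms in \<open>simp_all add: a_inv_def\<close>)

lemma direct_sum_simps [simp]: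
  "carrier (direct_sum Ms) = (\<Pi>\<^sub>E i \<in> {..<length Ms}. carrier (Ms ! i))"
  "\<zero>\<^bsub>direct_sum Ms\<^esub> = (\<lambda>i \<in> {..<length Ms}. \<zero>\<^bsub>Ms ! i\<^esub>)"
  "x \<oplus>\<^bsub>direct_sum Ms\<^esub> y = (\<lambda>i \<in> {..<length Ms}. x i \<oplus>\<^bsub>Ms ! i\<^esub> y i)"
  "p \<odot>\<^bsub>direct_sum Ms\<^esub> x = (\<lambda>i \<in> {..<length Ms}. p \<odot>\<^bsub>Ms ! i\<^esub> x i)"
  "component (direct_sum Ms) u = (\<Pi>\<^sub>E i \<in> {..<length Ms}. component (Ms ! i) u)"
  by (simp_all add: direct_sum_def)

locale graded_mods =
  fixes Ms :: "('d::finite, 'k::field, 'm) pmodule list"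
  assumes all_graded: "\<forall>M \<in> set Ms. is_graded_module M"
begin

lemma summand: "i < length Ms \<Longrightarrow> graded_mod (Ms ! i)"
  using all_graded by (auto simp: graded_mod_def)

lemma summand_group: "i < length Ms \<Longrightarrow> abelian_group (Ms ! i)"
  using module.axioms(2)[OF graded_mod.is_module[OF summand]] .

lemma summand_monoid: "i < length Ms \<Longrightarrow> abelian_monoid (Ms ! i)"
  using abelian_group.axioms(1)[OF summand_group] .

lemma sum_abelian_group: "abelian_group (direct_sum Ms)"
proof (rule abelian_groupI)
  fix x assume "x \<in> carrier (direct_sum Ms)"
  then have x: "x \<in> extensional {..<length Ms}" "\<And>i. i < length Ms \<Longrightarrow> x i \<in> carrier (Ms ! i)"
    by (auto simp: PiE_iff)
  have "(\<lambda>i \<in> {..<length Ms}. \<ominus>\<^bsub>Ms ! i\<^esub> x i) \<in> carrier (direct_sum Ms)"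
    by (simp add: x(2) abelian_group.a_inv_closed[OF summand_group])
  moreover have "(\<lambda>i \<in> {..<length Ms}. \<ominus>\<^bsub>Ms ! i\<^esub> x i) \<oplus>\<^bsub>direct_sum Ms\<^esub> x = \<zero>\<^bsub>direct_sum Ms\<^esub>"
    by (simp add: x(2) abelian_group.l_neg[OF summand_group] cong: restrict_cong)
  ultimately show "\<exists>y\<in>carrier (direct_sum Ms). y \<oplus>\<^bsub>direct_sum Ms\<^esub> x = \<zero>\<^bsub>direct_sum Ms\<^esub>"
    by (intro bexI[of _ "\<lambda>i \<in> {..<length Ms}. \<ominus>\<^bsub>Ms ! i\<^esub> x i"])
  show "\<zero>\<^bsub>direct_sum Ms\<^esub> \<oplus>\<^bsub>direct_sum Ms\<^esub> x = x"
    by (rule extensionalityI[OF _ x(1)]) (simp_all add: x(2) abelian_monoid.l_zero[OF summand_monoid])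
  fix y assume "y \<in> carrier (direct_sum Ms)"
  then have y: "\<And>i. i < length Ms \<Longrightarrow> y i \<in> carrier (Ms ! i)" by (auto simp: PiE_iff)
  show "x \<oplus>\<^bsub>direct_sum Ms\<^esub> y \<in> carrier (direct_sum Ms)"
    by (simp add: x(2) y abelian_monoid.a_closed[OF summand_monoid])
  show "x \<oplus>\<^bsub>direct_sum Ms\<^esub> y = y \<oplus>\<^bsub>direct_sum Ms\<^esub> x"
    by (simp, rule restrict_ext) (simp add: x(2) y abelian_monoid.a_comm[OF summand_monoid])
  fix z assume "z \<in> carrier (direct_sum Ms)"
  then have z: "\<And>i. i < length Ms \<Longrightarrow> z i \<in> carrier (Ms ! i)" by (auto simp: PiE_iff)
  show "x \<oplus>\<^bsub>direct_sum Ms\<^esub> y \<oplus>\<^bsub>direct_sum Ms\<^esub> z = x \<oplus>\<^bsub>direct_sum Ms\<^esub> (y \<oplus>\<^bsub>direct_sum Ms\<^esub> z)"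
    by (simp, rule restrict_ext) (simp add: x(2) y z abelian_monoid.a_assoc[OF summand_monoid])
qed (simp add: abelian_monoid.zero_closed[OF summand_monoid])

lemma sum_module: "Module.module poly_ring (direct_sum Ms)"
  by (rule moduleI[OF poly_ring_cring sum_abelian_group])
    (auto simp: PiE_iff graded_mod.smult_closed[OF summand] graded_mod.smult_add_left[OF summand]
      graded_mod.smult_add_right[OF summand] graded_mod.smult_smult[OF summand]
      graded_mod.smult_one[OF summand] extensional_def intro!: restrict_ext)

lemma sum_finsum:
  assumes g: "\<And>a. a \<in> A \<Longrightarrow> g a \<in> carrier (direct_sum Ms)" and i: "i < length Ms"
  shows "finsum (direct_sum Ms) g A i = (\<Oplus>\<^bsub>Ms ! i\<^esub>a\<in>A. g a i)"
proof -
  interpret S: abelian_group "direct_sum Ms" by (rule sum_abelian_group)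
  interpret C: graded_mod "Ms ! i" by (rule summand[OF i])
  have C: "x i \<in> carrier (Ms ! i)" if "x \<in> carrier (direct_sum Ms)" for x
    using that i by (auto simp: PiE_iff)
  show ?thesis using g
  proof (induction A rule: infinite_finite_induct)
    case (infinite F)
    then show ?case using i by simp
  next
    case empty
    then show ?case using i by simp
  next
    case (insert a F)
    have g: "g \<in> F \<rightarrow> carrier (direct_sum Ms)" "g a \<in> carrier (direct_sum Ms)"
      using insert(4) by blast+
    have gi: "(\<lambda>a. g a i) \<in> F \<rightarrow> carrier (Ms ! i)"
      by (rule Pi_I) (rule C[OF insert(4)[OF insertI2]])
    have "finsum (direct_sum Ms) g F i = (\<Oplus>\<^bsub>Ms ! i\<^esub>a\<in>F. g a i)"
      by (rule insert(3)) (rule insert(4)[OF insertI2])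
    then show ?case
      unfolding S.finsum_insert[OF insert(1,2) g] C.finsum_insert[OF insert(1,2) gi C[OF g(2)]]
      using i by simp
  qed
qed

lemma sum_minus:
  assumes "x \<in> carrier (direct_sum Ms)" shows "\<ominus>\<^bsub>direct_sum Ms\<^esub> x = (\<lambda>i \<in> {..<length Ms}. \<ominus>\<^bsub>Ms ! i\<^esub> x i)"
proof (rule abelian_group.minus_equality[OF sum_abelian_group])
  show "(\<lambda>i \<in> {..<length Ms}. \<ominus>\<^bsub>Ms ! i\<^esub> x i) \<oplus>\<^bsub>direct_sum Ms\<^esub> x = \<zero>\<^bsub>direct_sum Ms\<^esub>"
    "(\<lambda>i \<in> {..<length Ms}. \<ominus>\<^bsub>Ms ! i\<^esub> x i) \<in> carrier (direct_sum Ms)"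
    using assms
    by (auto simp: PiE_iff abelian_group.a_inv_closed[OF summand_group] abelian_group.l_neg[OF summand_group]
      intro!: restrict_ext)
qed (rule assms)

lemma direct_sum_graded: "is_graded_module (direct_sum Ms)"
proof (rule is_graded_moduleI[OF sum_module])
  let ?\<pi> = "\<lambda>u x. \<lambda>i \<in> {..<length Ms}. part (Ms ! i) u (x i)"
  have closed: "x \<in> carrier (Ms ! i)" if "i < length Ms" "x \<in> component (Ms ! i) u" for i x u
    by (rule graded_mod.component_closed[OF summand[OF that(1)] that(2)])
  {
    fix u
    show "subgroup (component (direct_sum Ms) u) (add_monoid (direct_sum Ms))"
    proof (rule component_subgroupI[OF sum_abelian_group])
      show sub: "component (direct_sum Ms) u \<subseteq> carrier (direct_sum Ms)"
        unfolding direct_sum_simps by (intro PiE_mono subsetI closed[where u=u]) auto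
      fix x assume x: "x \<in> component (direct_sum Ms) u"
      with sub have "x \<in> carrier (direct_sum Ms)" by blast
      from sum_minus[OF this] x
      show "\<ominus>\<^bsub>direct_sum Ms\<^esub> x \<in> component (direct_sum Ms) u"
        by (simp add: PiE_iff graded_mod.component_minus[OF summand])
    qed (auto simp: PiE_iff graded_mod.component_add[OF summand] graded_mod.component_zero[OF summand])
  next
    fix u c x assume "x \<in> component (direct_sum Ms) u"
    then show "const c \<odot>\<^bsub>direct_sum Ms\<^esub> x \<in> component (direct_sum Ms) u"
      by (auto simp: PiE_iff graded_mod.const_component[OF summand])
  next
    fix i u x assume "x \<in> component (direct_sum Ms) u"
    then show "indet i \<odot>\<^bsub>direct_sum Ms\<^esub> x \<in> component (direct_sum Ms) (u + unit_grade i)"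
      by (auto simp: PiE_iff graded_mod.indet_component[OF summand])
  next
    fix u x assume "x \<in> carrier (direct_sum Ms)"
    then show "?\<pi> u x \<in> component (direct_sum Ms) u"
      by (auto simp: PiE_iff graded_mod.part_component[OF summand])
  next
    fix u x assume "x \<in> component (direct_sum Ms) u"
    then show "?\<pi> u x = x"
      by (auto simp: PiE_iff graded_mod.part_same[OF summand] extensional_def)
  next
    fix u v x assume "x \<in> component (direct_sum Ms) u" "v \<noteq> u"
    then show "?\<pi> v x = \<zero>\<^bsub>direct_sum Ms\<^esub>"
      by (auto simp: PiE_iff intro!: restrict_ext graded_mod.part_other[OF summand, where u=u])
  next
    fix u x y assume "x \<in> carrier (direct_sum Ms)" "y \<in> carrier (direct_sum Ms)"
    then show "?\<pi> u (x \<oplus>\<^bsub>direct_sum Ms\<^esub> y) = ?\<pi> u x \<oplus>\<^bsub>direct_sum Ms\<^esub> ?\<pi> u y"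
      by (auto simp: PiE_iff graded_mod.part_add[OF summand] intro!: restrict_ext)
  next
    fix x assume x: "x \<in> carrier (direct_sum Ms)"
    then have xi: "x i \<in> carrier (Ms ! i)" if "i < length Ms" for i using that by (auto simp: PiE_iff)
    define U where "U = (\<Union>i<length Ms. {u. part (Ms ! i) u (x i) \<noteq> \<zero>\<^bsub>Ms ! i\<^esub>})"
    have U: "finite U"
      using graded_mod.finite_part[OF summand xi] by (auto simp: U_def)
    interpret S: abelian_group "direct_sum Ms" by (rule sum_abelian_group)
    have cl: "?\<pi> u x \<in> carrier (direct_sum Ms)" for u
      using xi by (auto simp: PiE_iff graded_mod.part_closed[OF summand])
    have "x = (\<Oplus>\<^bsub>direct_sum Ms\<^esub>u\<in>U. ?\<pi> u x)"
    proof (rule PiE_ext)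
      show "x \<in> (\<Pi>\<^sub>E i \<in> {..<length Ms}. carrier (Ms ! i))" using x by simp
      show "(\<Oplus>\<^bsub>direct_sum Ms\<^esub>u\<in>U. ?\<pi> u x) \<in> (\<Pi>\<^sub>E i \<in> {..<length Ms}. carrier (Ms ! i))"
        using S.finsum_closed[of "\<lambda>u. ?\<pi> u x" U] cl by simp
      fix i assume "i \<in> {..<length Ms}"
      then have i: "i < length Ms" by simp
      have "(\<Oplus>\<^bsub>direct_sum Ms\<^esub>u\<in>U. ?\<pi> u x) i = (\<Oplus>\<^bsub>Ms ! i\<^esub>u\<in>U. part (Ms ! i) u (x i))"
        using sum_finsum[OF cl i] i by simp
      also have "\<dots> = x i"
        by (rule graded_mod.finsum_part[OF summand[OF i] xi[OF i] U]) (use i in \<open>auto simp: U_def\<close>)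
      finally show "x i = (\<Oplus>\<^bsub>direct_sum Ms\<^esub>u\<in>U. ?\<pi> u x) i" ..
    qed
    moreover have "?\<pi> u x = \<zero>\<^bsub>direct_sum Ms\<^esub>" if "u \<notin> U" for u
      using that by (auto simp: U_def intro!: restrict_ext)
    ultimately show "\<exists>U. finite U \<and> (\<forall>u. u \<notin> U \<longrightarrow> ?\<pi> u x = \<zero>\<^bsub>direct_sum Ms\<^esub>) \<and>
        x = (\<Oplus>\<^bsub>direct_sum Ms\<^esub>u\<in>U. ?\<pi> u x)" using U by blast
  }
qed

lemma proj_hom: "i < length Ms \<Longrightarrow> graded_hom (direct_sum Ms) (Ms ! i) (\<lambda>x. x i)"
  by (rule graded_homI) (auto simp: PiE_iff)

lemma max_ideal_times_sum:
  assumes "x \<in> carrier (direct_sum Ms)" "\<And>i. i < length Ms \<Longrightarrow> x i \<in> max_ideal_times (Ms ! i)"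
  shows "x \<in> max_ideal_times (direct_sum Ms)"
proof -
  have "\<exists>y. (\<forall>j. y j \<in> carrier (Ms ! i)) \<and> x i = (\<Oplus>\<^bsub>Ms ! i\<^esub>j\<in>UNIV. indet j \<odot>\<^bsub>Ms ! i\<^esub> y j)"
    if "i < length Ms" for i
    using assms(2)[OF that] by (auto simp: max_ideal_times_def)
  then have "\<forall>i. \<exists>y. i < length Ms \<longrightarrow>
      (\<forall>j. y j \<in> carrier (Ms ! i)) \<and> x i = (\<Oplus>\<^bsub>Ms ! i\<^esub>j\<in>UNIV. indet j \<odot>\<^bsub>Ms ! i\<^esub> y j)" by blast
  from choice[OF this] obtain y where y: "\<And>i j. i < length Ms \<Longrightarrow> y i j \<in> carrier (Ms ! i)"
    "\<And>i. i < length Ms \<Longrightarrow> x i = (\<Oplus>\<^bsub>Ms ! i\<^esub>j\<in>UNIV. indet j \<odot>\<^bsub>Ms ! i\<^esub> y i j)" by blast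
  interpret S: graded_mod "direct_sum Ms" by (simp add: graded_mod_def direct_sum_graded)
  define z where "z j = (\<lambda>i \<in> {..<length Ms}. y i j)" for j
  have z: "z j \<in> carrier (direct_sum Ms)" for j by (simp add: z_def y(1))
  then have tz: "indet j \<odot>\<^bsub>direct_sum Ms\<^esub> z j \<in> carrier (direct_sum Ms)" for j by (rule S.smult_closed)
  show ?thesis
  proof (rule S.max_ideal_timesI[OF z], rule PiE_ext)
    show "x \<in> (\<Pi>\<^sub>E i \<in> {..<length Ms}. carrier (Ms ! i))" using assms by simp
    show "(\<Oplus>\<^bsub>direct_sum Ms\<^esub>j\<in>UNIV. indet j \<odot>\<^bsub>direct_sum Ms\<^esub> z j) \<in> (\<Pi>\<^sub>E i \<in> {..<length Ms}. carrier (Ms ! i))"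
      using S.finsum_closed[of "\<lambda>j. indet j \<odot>\<^bsub>direct_sum Ms\<^esub> z j" UNIV] tz by simp
    fix i assume "i \<in> {..<length Ms}"
    then show "x i = (\<Oplus>\<^bsub>direct_sum Ms\<^esub>j\<in>UNIV. indet j \<odot>\<^bsub>direct_sum Ms\<^esub> z j) i"
      using sum_finsum[of UNIV "\<lambda>j. indet j \<odot>\<^bsub>direct_sum Ms\<^esub> z j" i] tz y(2)[of i] by (simp add: z_def)
  qed
qed

lemma max_ideal_times_sumD:
  assumes "x \<in> max_ideal_times (direct_sum Ms)" "i < length Ms"
  shows "x i \<in> max_ideal_times (Ms ! i)"
  using graded_homo.max_ideal_times[OF graded_homoI[OF direct_sum_graded _ proj_hom]] assms all_graded
  by simp

definition inj :: "nat \<Rightarrow> 'm \<Rightarrow> nat \<Rightarrow> 'm" where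
  "inj i x = (\<lambda>j \<in> {..<length Ms}. if j = i then x else \<zero>\<^bsub>Ms ! j\<^esub>)"

lemma inj_hom: "i < length Ms \<Longrightarrow> graded_hom (Ms ! i) (direct_sum Ms) (inj i)"
proof (rule graded_homI)
  assume i: "i < length Ms"
  have 0: "\<zero>\<^bsub>Ms ! j\<^esub> \<in> carrier (Ms ! j)" "\<zero>\<^bsub>Ms ! j\<^esub> \<in> component (Ms ! j) u"
    "\<zero>\<^bsub>Ms ! j\<^esub> \<oplus>\<^bsub>Ms ! j\<^esub> \<zero>\<^bsub>Ms ! j\<^esub> = \<zero>\<^bsub>Ms ! j\<^esub>" "p \<odot>\<^bsub>Ms ! j\<^esub> \<zero>\<^bsub>Ms ! j\<^esub> = \<zero>\<^bsub>Ms ! j\<^esub>"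
    if "j < length Ms" for j u p
  proof -
    interpret C: graded_mod "Ms ! j" by (rule summand[OF that])
    show "\<zero>\<^bsub>Ms ! j\<^esub> \<in> carrier (Ms ! j)" "\<zero>\<^bsub>Ms ! j\<^esub> \<in> component (Ms ! j) u"
      "\<zero>\<^bsub>Ms ! j\<^esub> \<oplus>\<^bsub>Ms ! j\<^esub> \<zero>\<^bsub>Ms ! j\<^esub> = \<zero>\<^bsub>Ms ! j\<^esub>" "p \<odot>\<^bsub>Ms ! j\<^esub> \<zero>\<^bsub>Ms ! j\<^esub> = \<zero>\<^bsub>Ms ! j\<^esub>" by simp_all
  qed
  {
    fix x assume "x \<in> carrier (Ms ! i)"
    then show "inj i x \<in> carrier (direct_sum Ms)" using 0 by (auto simp: inj_def)
  next
    fix x u assume "x \<in> component (Ms ! i) u"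
    then show "inj i x \<in> component (direct_sum Ms) u" using 0 by (auto simp: inj_def)
  next
    fix x y show "inj i (x \<oplus>\<^bsub>Ms ! i\<^esub> y) = inj i x \<oplus>\<^bsub>direct_sum Ms\<^esub> inj i y"
      using 0 by (auto simp: inj_def intro!: restrict_ext)
  next
    fix x p show "inj i (p \<odot>\<^bsub>Ms ! i\<^esub> x) = p \<odot>\<^bsub>direct_sum Ms\<^esub> inj i x"
      using 0 by (auto simp: inj_def intro!: restrict_ext)
  }
qed

lemma inj_proj [simp]: "i < length Ms \<Longrightarrow> inj i x i = x"
  by (simp add: inj_def)

end

definition sum_map :: "nat \<Rightarrow> (nat \<Rightarrow> 'm \<Rightarrow> 'n) \<Rightarrow> (nat \<Rightarrow> 'm) \<Rightarrow> nat \<Rightarrow> 'n" where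
  "sum_map n \<phi> x = (\<lambda>i \<in> {..<n}. \<phi> i (x i))"

lemma sum_map_hom:
  assumes "length Ms = n" "length Ns = n" "\<And>i. i < n \<Longrightarrow> graded_hom (Ms ! i) (Ns ! i) (\<phi> i)"
  shows "graded_hom (direct_sum Ms) (direct_sum Ns) (sum_map n \<phi>)"
proof (rule graded_homI)
  have h: "\<phi> i \<in> carrier (Ms ! i) \<rightarrow> carrier (Ns ! i)"
    "\<And>x y. x \<in> carrier (Ms ! i) \<Longrightarrow> y \<in> carrier (Ms ! i) \<Longrightarrow> \<phi> i (x \<oplus>\<^bsub>Ms ! i\<^esub> y) = \<phi> i x \<oplus>\<^bsub>Ns ! i\<^esub> \<phi> i y"
    "\<And>x p. x \<in> carrier (Ms ! i) \<Longrightarrow> \<phi> i (p \<odot>\<^bsub>Ms ! i\<^esub> x) = p \<odot>\<^bsub>Ns ! i\<^esub> \<phi> i x"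
    "\<And>x u. x \<in> component (Ms ! i) u \<Longrightarrow> \<phi> i x \<in> component (Ns ! i) u" if "i < n" for i
    using assms(3)[OF that] by (auto simp: graded_hom_def hom_def image_subset_iff)
  {
    fix x assume "x \<in> carrier (direct_sum Ms)"
    then show "sum_map n \<phi> x \<in> carrier (direct_sum Ns)" using h(1) assms by (auto simp: sum_map_def PiE_iff Pi_iff)
  next
    fix x y assume "x \<in> carrier (direct_sum Ms)" "y \<in> carrier (direct_sum Ms)"
    then show "sum_map n \<phi> (x \<oplus>\<^bsub>direct_sum Ms\<^esub> y) = sum_map n \<phi> x \<oplus>\<^bsub>direct_sum Ns\<^esub> sum_map n \<phi> y"
      using h(2) assms by (auto simp: sum_map_def PiE_iff Pi_iff intro!: restrict_ext)
  next
    fix x p assume "x \<in> carrier (direct_sum Ms)"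
    then show "sum_map n \<phi> (p \<odot>\<^bsub>direct_sum Ms\<^esub> x) = p \<odot>\<^bsub>direct_sum Ns\<^esub> sum_map n \<phi> x"
      using h(3) assms by (auto simp: sum_map_def PiE_iff Pi_iff intro!: restrict_ext)
  next
    fix x u assume "x \<in> component (direct_sum Ms) u"
    then show "sum_map n \<phi> x \<in> component (direct_sum Ns) u" using h(4) assms by (auto simp: sum_map_def PiE_iff Pi_iff)
  }
qed

lemma sum_map_image:
  assumes "length Ms = n" "length Ns = n" "\<And>i. i < n \<Longrightarrow> \<phi> i ` carrier (Ms ! i) = S i"
  shows "sum_map n \<phi> ` carrier (direct_sum Ms) = (\<Pi>\<^sub>E i \<in> {..<n}. S i)"
proof
  show "sum_map n \<phi> ` carrier (direct_sum Ms) \<subseteq> (\<Pi>\<^sub>E i \<in> {..<n}. S i)"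
  proof (rule image_subsetI)
    fix x assume "x \<in> carrier (direct_sum Ms)"
    then have "\<phi> i (x i) \<in> S i" if "i < n" for i
      unfolding assms(3)[OF that, symmetric] using that assms(1) by (auto simp: PiE_iff)
    then show "sum_map n \<phi> x \<in> (\<Pi>\<^sub>E i \<in> {..<n}. S i)" by (auto simp: sum_map_def)
  qed
  show "(\<Pi>\<^sub>E i \<in> {..<n}. S i) \<subseteq> sum_map n \<phi> ` carrier (direct_sum Ms)"
  proof
    fix y assume y: "y \<in> (\<Pi>\<^sub>E i \<in> {..<n}. S i)"
    have "\<exists>x. x \<in> carrier (Ms ! i) \<and> \<phi> i x = y i" if "i \<in> {..<n}" for i
    proof -
      have "y i \<in> \<phi> i ` carrier (Ms ! i)" using PiE_mem[OF y that] assms(3)[of i] that by simp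
      then show ?thesis by auto
    qed
    then obtain x where x: "\<forall>i\<in>{..<n}. x i \<in> carrier (Ms ! i) \<and> \<phi> i (x i) = y i" by metis
    have "y = sum_map n \<phi> (\<lambda>i \<in> {..<n}. x i)"
      by (rule PiE_ext[OF y]) (use x y in \<open>auto simp: sum_map_def PiE_iff\<close>)
    then show "y \<in> sum_map n \<phi> ` carrier (direct_sum Ms)"
      using x assms(1) by (intro image_eqI[of _ _ "\<lambda>i \<in> {..<n}. x i"]) auto
  qed
qed

lemma sum_map_kernel:
  assumes "length Ms = n" "length Ns = n"
  shows "mor_kernel (direct_sum Ms) (direct_sum Ns) (sum_map n \<phi>) = (\<Pi>\<^sub>E i \<in> {..<n}. mor_kernel (Ms ! i) (Ns ! i) (\<phi> i))"
proof -
  have "sum_map n \<phi> x = \<zero>\<^bsub>direct_sum Ns\<^esub> \<longleftrightarrow> (\<forall>i<n. \<phi> i (x i) = \<zero>\<^bsub>Ns ! i\<^esub>)" for x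
    by (simp add: sum_map_def assms restrict_def fun_eq_iff)
  then show ?thesis unfolding mor_kernel_def using assms
    by (auto simp: PiE_iff extensional_def simp del: direct_sum_simps(2))
qed

lemma sum_map_iso:
  assumes "length Ms = n" "length Ns = n" "\<And>i. i < n \<Longrightarrow> graded_iso (Ms ! i) (Ns ! i) (\<phi> i)"
  shows "graded_iso (direct_sum Ms) (direct_sum Ns) (sum_map n \<phi>)"
proof -
  have "inj_on (sum_map n \<phi>) (carrier (direct_sum Ms))"
  proof (rule inj_onI)
    fix x y assume *: "x \<in> carrier (direct_sum Ms)" "y \<in> carrier (direct_sum Ms)" "sum_map n \<phi> x = sum_map n \<phi> y"
    show "x = y"
    proof (rule PiE_ext)
      fix i assume i: "i \<in> {..<n}"
      then have "\<phi> i (x i) = \<phi> i (y i)" using fun_cong[OF *(3), of i] by (simp add: sum_map_def)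
      moreover have "inj_on (\<phi> i) (carrier (Ms ! i))" "x i \<in> carrier (Ms ! i)" "y i \<in> carrier (Ms ! i)"
        using assms * i by (auto simp: graded_iso_def bij_betw_def PiE_iff)
      ultimately show "x i = y i" by (auto dest: inj_onD)
    qed (use * assms in auto)
  qed
  moreover have "sum_map n \<phi> ` carrier (direct_sum Ms) = carrier (direct_sum Ns)"
    using sum_map_image[OF assms(1,2), of \<phi> "\<lambda>i. carrier (Ns ! i)"] assms(3)
    by (simp add: assms(2) graded_iso_def bij_betw_def)
  ultimately show ?thesis
    using sum_map_hom[OF assms(1,2)] assms(3) by (simp add: graded_iso_def bij_betw_def)
qed

lemma isomorphic_direct_sum:
  assumes "list_all2 isomorphic_modules Ms Ns" shows "isomorphic_modules (direct_sum Ms) (direct_sum Ns)"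
proof -
  from assms have "\<forall>i. \<exists>\<phi>. i < length Ms \<longrightarrow> graded_iso (Ms ! i) (Ns ! i) \<phi>"
    by (auto simp: list_all2_conv_all_nth isomorphic_modules_def)
  then obtain \<phi> where "\<And>i. i < length Ms \<Longrightarrow> graded_iso (Ms ! i) (Ns ! i) (\<phi> i)" by metis
  then have "graded_iso (direct_sum Ms) (direct_sum Ns) (sum_map (length Ms) \<phi>)"
    using list_all2_lengthD[OF assms] by (intro sum_map_iso) simp_all
  then show ?thesis unfolding isomorphic_modules_def by blast
qed


section \<open>Shifts of the polynomial ring\<close>

lemma shifted_ring_simps [simp]:
  "carrier (shifted_ring u) = UNIV" "\<zero>\<^bsub>shifted_ring u\<^esub> = 0" "x \<oplus>\<^bsub>shifted_ring u\<^esub> y = x + y"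
  "p \<odot>\<^bsub>shifted_ring u\<^esub> x = p * x" "component (shifted_ring u) v = homogeneous (v - u)"
  by (simp_all add: shifted_ring_def)

lemma shifted_ring_abelian_group: "abelian_group (shifted_ring u)"
proof (rule abelian_groupI)
  fix x :: "('a, 'b) mpoly"
  show "\<exists>y\<in>carrier (shifted_ring u). y \<oplus>\<^bsub>shifted_ring u\<^esub> x = \<zero>\<^bsub>shifted_ring u\<^esub>"
    by (rule bexI[of _ "- x"]) auto
qed (auto simp: ac_simps)

lemma shifted_ring_finsum: "finsum (shifted_ring u) g A = sum g A"
proof -
  interpret abelian_group "shifted_ring u" by (rule shifted_ring_abelian_group)
  show ?thesis by (induction A rule: infinite_finite_induct) (simp_all add: finsum_insert)
qed

lemma shifted_ring_graded: "is_graded_module (shifted_ring u)"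
proof (rule is_graded_moduleI[where \<pi>="\<lambda>v. hpart (v - u)"])
  interpret abelian_group "shifted_ring u" by (rule shifted_ring_abelian_group)
  show "Module.module poly_ring (shifted_ring u)"
    by (rule moduleI[OF poly_ring_cring shifted_ring_abelian_group]) (auto simp: algebra_simps)
  have minus: "\<ominus>\<^bsub>shifted_ring u\<^esub> p = - p" for p by (rule minus_equality) auto
  show "subgroup (component (shifted_ring u) v) (add_monoid (shifted_ring u))" for v
    by (rule component_subgroupI[OF shifted_ring_abelian_group])
      (simp_all add: homogeneous_add minus homogeneous_uminus)
  fix x :: "('a, 'b) mpoly" assume "x \<in> carrier (shifted_ring u)"
  define U where "U = (\<lambda>w. w + u) ` {w. hpart w x \<noteq> 0}"
  have fin: "finite {w. hpart w x \<noteq> 0}"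
    using finite_subset[OF hpart_support] by simp
  have "(\<Sum>v\<in>U. hpart (v - u) x) = (\<Sum>w\<in>{w. hpart w x \<noteq> 0}. hpart w x)"
    unfolding U_def by (subst sum.reindex) (auto simp: inj_on_def)
  also have "\<dots> = x" using fin by (intro sum_hpart) auto
  finally have "x = (\<Sum>v\<in>U. hpart (v - u) x)" by simp
  moreover have "hpart (v - u) x = 0" if "v \<notin> U" for v
    using that by (auto simp: U_def image_iff dest: spec[of _ "v - u"])
  ultimately show "\<exists>U. finite U \<and> (\<forall>v. v \<notin> U \<longrightarrow> hpart (v - u) x = \<zero>\<^bsub>shifted_ring u\<^esub>) \<and>
        x = (\<Oplus>\<^bsub>shifted_ring u\<^esub>v\<in>U. hpart (v - u) x)"
    using fin by (intro exI[of _ U]) (auto simp: shifted_ring_finsum U_def)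
next
  fix c v x assume "x \<in> component (shifted_ring u) v"
  then show "const c \<odot>\<^bsub>shifted_ring u\<^esub> x \<in> component (shifted_ring u) v"
    using homogeneous_mult[OF homogeneous_const] by force
next
  fix i v x assume "x \<in> component (shifted_ring u) v"
  then show "indet i \<odot>\<^bsub>shifted_ring u\<^esub> x \<in> component (shifted_ring u) (v + unit_grade i)"
    using homogeneous_mult[OF homogeneous_indet[of i], of x "v - u"] by (simp add: algebra_simps)
qed (auto simp: hpart_same hpart_other hpart_add)

section \<open>Free modules\<close>

abbreviation free :: "'d::finite grade list \<Rightarrow> ('d, 'k::field, nat \<Rightarrow> ('d, 'k) mpoly) pmodule" where
  "free us \<equiv> direct_sum (map shifted_ring us)"

definition lin :: "('d::finite, 'k::field, 'm) pmodule \<Rightarrow> nat \<Rightarrow> (nat \<Rightarrow> 'm) \<Rightarrow> (nat \<Rightarrow> ('d, 'k) mpoly) \<Rightarrow> 'm" where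
  "lin M n g x = (\<Oplus>\<^bsub>M\<^esub>i\<in>{..<n}. x i \<odot>\<^bsub>M\<^esub> g i)"

definition unit_vector :: "nat \<Rightarrow> nat \<Rightarrow> nat \<Rightarrow> ('d::finite, 'k::field) mpoly" where
  "unit_vector n i = (\<lambda>j \<in> {..<n}. if j = i then 1 else 0)"

lemma free_simps:
  "x \<in> carrier (free us) \<longleftrightarrow> x \<in> extensional {..<length us}"
  "x \<in> component (free us) u \<longleftrightarrow> x \<in> extensional {..<length us} \<and> (\<forall>i<length us. x i \<in> homogeneous (u - us ! i))"
  "\<zero>\<^bsub>free us\<^esub> = (\<lambda>i \<in> {..<length us}. 0)"
  "x \<oplus>\<^bsub>free us\<^esub> y = (\<lambda>i \<in> {..<length us}. x i + y i)"
  "p \<odot>\<^bsub>free us\<^esub> x = (\<lambda>i \<in> {..<length us}. p * x i)"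
  by (auto simp: PiE_iff intro!: restrict_ext)

lemma free_mods: "graded_mods (map shifted_ring us)"
  by (simp add: graded_mods_def shifted_ring_graded)

lemma free_is_graded: "is_graded_module (free us)"
  by (rule graded_mods.direct_sum_graded[OF free_mods])

lemma free_graded_mod: "graded_mod (free us)"
  by (simp add: graded_mod_def free_is_graded)

lemma free_is_free: "free_graded (free us)"
  using free_is_graded isomorphic_modules_refl by (auto simp: free_graded_def)

lemma free_finsum:
  assumes "\<And>a. a \<in> A \<Longrightarrow> g a \<in> carrier (free us)" "i < length us"
  shows "finsum (free us) g A i = (\<Sum>a\<in>A. g a i)"
  using graded_mods.sum_finsum[OF free_mods assms(1), of A] assms(2) by (simp add: shifted_ring_finsum)

lemma unit_vector_component: "i < length us \<Longrightarrow> unit_vector (length us) i \<in> component (free us) (us ! i)"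
  by (auto simp: free_simps unit_vector_def homogeneous_one)

lemma unit_vector_carrier: "unit_vector (length us) i \<in> carrier (free us)"
  by (simp only: free_simps unit_vector_def restrict_extensional)

lemma free_expand:
  assumes "x \<in> carrier (free us)"
  shows "x = (\<Oplus>\<^bsub>free us\<^esub>i\<in>{..<length us}. x i \<odot>\<^bsub>free us\<^esub> unit_vector (length us) i)"
proof (rule extensionalityI)
  interpret F: graded_mod "free us" by (rule free_graded_mod)
  have c: "x i \<odot>\<^bsub>free us\<^esub> unit_vector (length us) i \<in> carrier (free us)" for i
    by (rule F.smult_closed[OF unit_vector_carrier])
  show "x \<in> extensional {..<length us}" using assms by (simp only: free_simps)
  show "(\<Oplus>\<^bsub>free us\<^esub>i\<in>{..<length us}. x i \<odot>\<^bsub>free us\<^esub> unit_vector (length us) i) \<in> extensional {..<length us}"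
    using F.finsum_closed[of "\<lambda>i. x i \<odot>\<^bsub>free us\<^esub> unit_vector (length us) i"] c by (simp only: free_simps Pi_I)
  fix j assume j: "j \<in> {..<length us}"
  have "(\<Oplus>\<^bsub>free us\<^esub>i\<in>{..<length us}. x i \<odot>\<^bsub>free us\<^esub> unit_vector (length us) i) j =
      (\<Sum>i\<in>{..<length us}. if i = j then x j else 0)"
    unfolding free_finsum[OF c j[unfolded lessThan_iff]]
    by (rule sum.cong) (use j in \<open>auto simp: free_simps(5) unit_vector_def\<close>)
  then show "x j = (\<Oplus>\<^bsub>free us\<^esub>i\<in>{..<length us}. x i \<odot>\<^bsub>free us\<^esub> unit_vector (length us) i) j"
    using j by simp
qed

context graded_mod
begin

lemma lin_hom:
  assumes g: "\<And>i. i < length us \<Longrightarrow> g i \<in> component M (us ! i)"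
  shows "graded_hom (free us) M (lin M (length us) g)"
proof (rule graded_homI)
  have gc: "g i \<in> carrier M" if "i < length us" for i using g[OF that] by (rule component_closed)
  {
    fix x :: "nat \<Rightarrow> ('d, 'k) mpoly" assume "x \<in> carrier (free us)"
    show "lin M (length us) g x \<in> carrier M" unfolding lin_def by (rule finsum_closed) (simp add: gc)
  next
    fix x y :: "nat \<Rightarrow> ('d, 'k) mpoly" assume "x \<in> carrier (free us)" "y \<in> carrier (free us)"
    have "lin M (length us) g (x \<oplus>\<^bsub>free us\<^esub> y) = (\<Oplus>i\<in>{..<length us}. x i \<odot> g i \<oplus> y i \<odot> g i)"
      unfolding lin_def by (rule finsum_cong') (auto simp: free_simps(4) gc smult_add_left)
    also have "\<dots> = lin M (length us) g x \<oplus> lin M (length us) g y"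
      unfolding lin_def by (rule finsum_addf) (simp_all add: gc)
    finally show "lin M (length us) g (x \<oplus>\<^bsub>free us\<^esub> y) = lin M (length us) g x \<oplus> lin M (length us) g y" .
  next
    fix x :: "nat \<Rightarrow> ('d, 'k) mpoly" and p assume "x \<in> carrier (free us)"
    have "lin M (length us) g (p \<odot>\<^bsub>free us\<^esub> x) = (\<Oplus>i\<in>{..<length us}. p \<odot> (x i \<odot> g i))"
      unfolding lin_def by (rule finsum_cong') (auto simp: free_simps(5) gc smult_smult)
    also have "\<dots> = p \<odot> lin M (length us) g x"
      unfolding lin_def by (rule smult_finsum[symmetric]) (simp_all add: gc)
    finally show "lin M (length us) g (p \<odot>\<^bsub>free us\<^esub> x) = p \<odot> lin M (length us) g x" .
  next
    fix x :: "nat \<Rightarrow> ('d, 'k) mpoly" and u assume x: "x \<in> component (free us) u"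
    show "lin M (length us) g x \<in> component M u" unfolding lin_def
    proof (rule component_finsum)
      fix i assume "i \<in> {..<length us}"
      then show "x i \<odot> g i \<in> component M u"
        using smult_component[of "x i" "u - us ! i" "g i" "us ! i"] x g[of i]
        unfolding free_simps(2) by simp
    qed
  }
qed

lemma lin_unit_vector:
  assumes "\<And>i. i < n \<Longrightarrow> g i \<in> carrier M" "j < n" shows "lin M n g (unit_vector n j) = g j"
proof -
  have "lin M n g (unit_vector n j) = (\<Oplus>i\<in>{..<n}. if j = i then g i else \<zero>)"
    unfolding lin_def by (rule finsum_cong') (use assms in \<open>auto simp: unit_vector_def\<close>)
  also have "\<dots> = g j" by (rule finsum_singleton) (use assms in auto)
  finally show ?thesis .
qed

lemma submodule_finsum:
  assumes "submodule S poly_ring M" "\<And>i. i \<in> A \<Longrightarrow> g i \<in> S" shows "(\<Oplus>i\<in>A. g i) \<in> S"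
  using assms(2)
proof (induction A rule: infinite_finite_induct)
  case (insert x F)
  have "g \<in> F \<rightarrow> carrier M" "g x \<in> carrier M" using insert(4) submoduleD(1)[OF assms(1)] by auto
  from finsum_insert[OF insert(1,2) this] insert(3,4) show ?case
    using submoduleD(3)[OF assms(1)] by simp
qed (simp_all add: submoduleD(2)[OF assms(1)])

end

lemma hom_from_free:
  assumes "is_graded_module M" "graded_hom (free us) M \<phi>" "x \<in> carrier (free us)"
  shows "\<phi> x = lin M (length us) (\<lambda>i. \<phi> (unit_vector (length us) i)) x"
proof -
  interpret graded_homo "free us" M \<phi> by (rule graded_homoI[OF free_is_graded assms(1,2)])
  have c: "x i \<odot>\<^bsub>free us\<^esub> unit_vector (length us) i \<in> carrier (free us)" for i
    by (rule M.smult_closed[OF unit_vector_carrier])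
  have "\<phi> x = \<phi> (\<Oplus>\<^bsub>free us\<^esub>i\<in>{..<length us}. x i \<odot>\<^bsub>free us\<^esub> unit_vector (length us) i)"
    using free_expand[OF assms(3)] by simp
  also have "\<dots> = (\<Oplus>\<^bsub>M\<^esub>i\<in>{..<length us}. \<phi> (x i \<odot>\<^bsub>free us\<^esub> unit_vector (length us) i))"
    by (rule finsum[OF c])
  finally show ?thesis by (simp only: lin_def smult[OF unit_vector_carrier])
qed

text \<open>Free modules are projective: a basis can be lifted along a surjection.\<close>

lemma free_lift:
  fixes M :: "('d::finite, 'k::field, 'm) pmodule"
  assumes "graded_homo M N p" "p ` carrier M = carrier N" "graded_hom (free us) N \<phi>"
  obtains \<psi> where "graded_hom (free us) M \<psi>" "\<forall>x\<in>carrier (free us). p (\<psi> x) = \<phi> x"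
proof -
  interpret p: graded_homo M N p by (rule assms)
  interpret \<phi>: graded_homo "free us" N \<phi> by (rule graded_homoI[OF free_is_graded p.N.graded assms(3)])
  have "\<exists>y. y \<in> component M (us ! i) \<and> p y = \<phi> (unit_vector (length us) i)" if "i < length us" for i
  proof -
    have c: "\<phi> (unit_vector (length us) i) \<in> component N (us ! i)"
      by (rule \<phi>.component[OF unit_vector_component[OF that]])
    then have "\<phi> (unit_vector (length us) i) \<in> p ` carrier M"
      unfolding assms(2) by (rule p.N.component_closed)
    then obtain y where "y \<in> carrier M" "p y = \<phi> (unit_vector (length us) i)" by auto
    with p.component_preimage[of y "us ! i"] c show ?thesis by auto
  qed
  then obtain g where g: "\<And>i. i < length us \<Longrightarrow> g i \<in> component M (us ! i)"
    "\<And>i. i < length us \<Longrightarrow> p (g i) = \<phi> (unit_vector (length us) i)" by metis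
  have gc: "g i \<in> carrier M" if "i < length us" for i using g(1)[OF that] by (rule p.M.component_closed)
  show ?thesis
  proof (rule that)
    show "graded_hom (free us) M (lin M (length us) g)" by (rule p.M.lin_hom[OF g(1)])
    show "\<forall>x\<in>carrier (free us). p (lin M (length us) g x) = \<phi> x"
    proof
      fix x :: "nat \<Rightarrow> ('d, 'k) mpoly" assume x: "x \<in> carrier (free us)"
      have "p (lin M (length us) g x) = (\<Oplus>\<^bsub>N\<^esub>i\<in>{..<length us}. p (x i \<odot>\<^bsub>M\<^esub> g i))"
        unfolding lin_def by (rule p.finsum) (simp add: gc)
      also have "\<dots> = lin N (length us) (\<lambda>i. \<phi> (unit_vector (length us) i)) x"
        unfolding lin_def
      proof (rule p.N.finsum_cong')
        show "(\<lambda>i. x i \<odot>\<^bsub>N\<^esub> \<phi> (unit_vector (length us) i)) \<in> {..<length us} \<rightarrow> carrier N"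
          using \<phi>.closed[OF unit_vector_carrier] by simp
      qed (simp_all add: p.smult gc g)
      also have "\<dots> = \<phi> x" using hom_from_free[OF p.N.graded assms(3) x] by simp
      finally show "p (lin M (length us) g x) = \<phi> x" .
    qed
  qed
qed

lemma free_bounded_below: "bounded_below (free us)"
proof -
  define b where "b = Min (insert 0 (total ` set us))"
  have "x = \<zero>\<^bsub>free us\<^esub>" if "total u < b" "x \<in> component (free us) u" for u x
  proof -
    have "x i = 0" if i: "i < length us" for i
    proof (rule homogeneous_negative)
      show "x i \<in> homogeneous (u - us ! i)" using \<open>x \<in> component (free us) u\<close> i unfolding free_simps by simp
      have "b \<le> total (us ! i)" using i by (simp add: b_def)
      then show "total (u - us ! i) < 0" using \<open>total u < b\<close> by simp
    qed
    then show ?thesis using that(2) unfolding free_simps by (auto simp: extensional_def)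
  qed
  then show ?thesis unfolding bounded_below_def by blast
qed

lemma free_finitely_generated: "finitely_generated (free us)"
  unfolding finitely_generated_def
proof (intro exI conjI allI impI)
  interpret F: graded_mod "free us" by (rule free_graded_mod)
  show "finite (unit_vector (length us) ` {..<length us})" by simp
  show "unit_vector (length us) ` {..<length us} \<subseteq> carrier (free us)"
    using unit_vector_carrier by blast
  fix N assume N: "submodule N poly_ring (free us) \<and> unit_vector (length us) ` {..<length us} \<subseteq> N"
  note D = F.submoduleD[OF conjunct1[OF N]]
  have "x \<in> N" if "x \<in> carrier (free us)" for x
  proof (subst free_expand[OF that], rule F.submodule_finsum[OF conjunct1[OF N]])
    fix i assume "i \<in> {..<length us}"
    then have "unit_vector (length us) i \<in> N" using N by blast
    then show "x i \<odot>\<^bsub>free us\<^esub> unit_vector (length us) i \<in> N" by (rule D(4))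
  qed
  then show "N = carrier (free us)" using D(1) by blast
qed

text \<open>
  Coefficients at basis elements of other grades than \<open>u\<close> have nonzero grade, hence are divisible by a
  variable.
\<close>

lemma free_max_ideal_times:
  assumes x: "x \<in> component (free us) u" and 0: "\<And>i. i < length us \<Longrightarrow> us ! i = u \<Longrightarrow> x i = 0"
  shows "x \<in> max_ideal_times (free us)"
proof (rule graded_mods.max_ideal_times_sum[OF free_mods])
  show "x \<in> carrier (free us)" using graded_mod.component_closed[OF free_graded_mod x] .
  fix i assume "i < length (map shifted_ring us)"
  then have i: "i < length us" by simp
  interpret S: graded_mod "shifted_ring (us ! i)" by (simp add: graded_mod_def shifted_ring_graded)
  have h: "x i \<in> homogeneous (u - us ! i)" using x i unfolding free_simps by simp
  have "x i \<in> max_ideal_times (shifted_ring (us ! i))"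
  proof (cases "us ! i = u")
    case True
    then show ?thesis using 0[OF i] S.max_ideal_times_zero by simp
  next
    case False
    then have "u - us ! i \<noteq> 0" by simp
    from homogeneous_nonconstant[OF h this] obtain j q where "x i = indet j * q" .
    then show ?thesis using S.max_ideal_times_indet[of q j] by simp
  qed
  then show "x i \<in> max_ideal_times (map shifted_ring us ! i)" using i by simp
qed


section \<open>Minimal covers\<close>

text \<open>
  A graded analogue of projective covers: by Nakayama's lemma, a surjection from a free module is
  as small as possible iff its kernel consists of multiples of the maximal graded ideal.
\<close>

definition minimal_cover ::
  "('d::finite, 'k::field, 'm) pmodule \<Rightarrow> ('d, 'k, 'n) pmodule \<Rightarrow> ('m \<Rightarrow> 'n) \<Rightarrow> bool" where
  "minimal_cover P M p \<longleftrightarrow> graded_hom P M p \<and> p ` carrier P = carrier M \<and> mor_kernel P M p \<subseteq> max_ideal_times P"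

text \<open>
  The generators are chosen homogeneous and as few as possible. A relation between them outside of the
  multiples of the maximal ideal has a nonzero constant coefficient and makes a generator redundant.
\<close>

theorem minimal_cover_exists:
  fixes M :: "('d::finite, 'k::field, 'm) pmodule"
  assumes "is_graded_module M" "finitely_generated M"
  obtains us p where "minimal_cover (free us) M p"
proof -
  interpret graded_mod M using assms by (simp add: graded_mod_def)
  define gen where "gen T \<longleftrightarrow> finite T \<and> (\<forall>q\<in>T. snd q \<in> component M (fst q)) \<and>
    (\<forall>N. submodule N poly_ring M \<longrightarrow> snd ` T \<subseteq> N \<longrightarrow> N = carrier M)" for T :: "('d grade \<times> 'm) set"
  have "\<exists>T. gen T"
  proof -
    from assms(2) obtain S where S: "finite S" "S \<subseteq> carrier M"
      "\<And>N. submodule N poly_ring M \<Longrightarrow> S \<subseteq> N \<Longrightarrow> N = carrier M"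
      unfolding finitely_generated_def by blast
    define T where "T = (\<Union>s\<in>S. (\<lambda>u. (u, part M u s)) ` {u. part M u s \<noteq> \<zero>\<^bsub>M\<^esub>})"
    have "finite T" unfolding T_def using S finite_part by blast
    moreover have "snd q \<in> component M (fst q)" if "q \<in> T" for q
      using that S(2) part_component by (auto simp: T_def)
    moreover have "N = carrier M" if N: "submodule N poly_ring M" "snd ` T \<subseteq> N" for N
    proof (rule S(3)[OF N(1)], rule subsetI)
      fix s assume s: "s \<in> S"
      then have "(\<Oplus>\<^bsub>M\<^esub>u\<in>{u. part M u s \<noteq> \<zero>\<^bsub>M\<^esub>}. part M u s) \<in> N"
        using N(2) by (intro submodule_finsum[OF N(1)]) (force simp: T_def)
      then show "s \<in> N" using finsum_part'[of s] s S(2) by auto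
    qed
    ultimately show ?thesis unfolding gen_def by blast
  qed
  then obtain T where T: "gen T" and least: "\<And>T'. gen T' \<Longrightarrow> card T \<le> card T'"
    using ex_has_least_nat[of gen _ card] by blast
  then obtain ps where ps: "set ps = T" "distinct ps" using finite_distinct_list[of T] unfolding gen_def by blast
  define us g where "us = map fst ps" and "g i = snd (ps ! i)" for i
  have g: "g i \<in> component M (us ! i)" if "i < length us" for i
    using that T ps by (auto simp: us_def g_def gen_def)
  then have gc: "g i \<in> carrier M" if "i < length us" for i using that component_closed by blast
  define p where "p = lin M (length us) g"
  have hom: "graded_hom (free us) M p" unfolding p_def by (rule lin_hom[OF g])
  interpret p: graded_homo "free us" M p by (rule graded_homoI[OF free_is_graded graded hom])
  have surj: "p ` carrier (free us) = carrier M"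
  proof -
    have "snd ` T \<subseteq> p ` carrier (free us)"
    proof clarify
      fix a b assume "(a, b) \<in> T"
      then obtain i where i: "i < length us" "ps ! i = (a, b)" using ps by (metis in_set_conv_nth length_map us_def)
      then have "b = p (unit_vector (length us) i)"
        using lin_unit_vector[of "length us" g i, OF gc i(1)] by (simp add: p_def g_def)
      then show "snd (a, b) \<in> p ` carrier (free us)" using unit_vector_carrier by auto
    qed
    then show ?thesis using T p.image_submodule unfolding gen_def graded_submodule_def by blast
  qed
  have "x \<in> max_ideal_times (free us)" if x: "x \<in> mor_kernel (free us) M p" "x \<in> component (free us) u" for x u
  proof (rule free_max_ideal_times[OF x(2)])
    fix i assume i: "i < length us" "us ! i = u"
    have "x i \<in> homogeneous 0" using x(2) i unfolding free_simps by auto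
    then obtain c where c: "x i = const c" by (rule homogeneous_constant)
    show "x i = 0"
    proof (rule ccontr)
      assume "x i \<noteq> 0"
      then have "c \<noteq> 0" using c by (auto simp: const_simps)
      \<comment> \<open>A constant coefficient expresses one generator by the others, so it could be dropped.\<close>
      have "gen (T - {ps ! i})"
        unfolding gen_def
      proof (intro conjI allI impI)
        fix N assume N: "submodule N poly_ring M" "snd ` (T - {ps ! i}) \<subseteq> N"
        note D = submoduleD[OF N(1)]
        define r where "r = (\<Oplus>\<^bsub>M\<^esub>j\<in>{..<length us} - {i}. x j \<odot>\<^bsub>M\<^esub> g j)"
        have r: "r \<in> N" unfolding r_def
        proof (rule submodule_finsum[OF N(1)])
          fix j assume j: "j \<in> {..<length us} - {i}"
          then have "ps ! j \<in> T - {ps ! i}"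
            using ps i by (auto simp: us_def nth_eq_iff_index_eq)
          then show "x j \<odot>\<^bsub>M\<^esub> g j \<in> N" using N(2) D(4) by (auto simp: g_def)
        qed
        have rc: "r \<in> carrier M" using r D(1) by auto
        have "p x = \<zero>\<^bsub>M\<^esub>" using x(1) by (simp add: mor_kernel_def)
        moreover have "p x = x i \<odot>\<^bsub>M\<^esub> g i \<oplus>\<^bsub>M\<^esub> r"
        proof -
          have "{..<length us} = insert i ({..<length us} - {i})" using i by auto
          then have "p x = (\<Oplus>\<^bsub>M\<^esub>j\<in>insert i ({..<length us} - {i}). x j \<odot>\<^bsub>M\<^esub> g j)"
            by (simp add: p_def lin_def)
          also have "\<dots> = x i \<odot>\<^bsub>M\<^esub> g i \<oplus>\<^bsub>M\<^esub> r"
            unfolding r_def by (rule finsum_insert) (use gc i in auto)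
          finally show ?thesis .
        qed
        ultimately have "x i \<odot>\<^bsub>M\<^esub> g i = \<ominus>\<^bsub>M\<^esub> r"
          using minus_equality[of "x i \<odot>\<^bsub>M\<^esub> g i" r] rc gc[OF i(1)] by simp
        then have "x i \<odot>\<^bsub>M\<^esub> g i \<in> N" using D(5)[OF r] by simp
        then have "const (inverse c) \<odot>\<^bsub>M\<^esub> (x i \<odot>\<^bsub>M\<^esub> g i) \<in> N" by (rule D(4))
        then have "g i \<in> N"
          using gc[OF i(1)] \<open>c \<noteq> 0\<close> by (simp add: c const_simps flip: smult_smult)
        then have "snd ` T \<subseteq> N" using N(2) by (fastforce simp: g_def)
        then show "N = carrier M" using T N(1) unfolding gen_def by blast
      qed (use T in \<open>auto simp: gen_def\<close>)
      moreover have "ps ! i \<in> T" "finite T" using i ps T by (auto simp: us_def gen_def)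
      then have "card (T - {ps ! i}) < card T" by (rule card_Diff1_less[rotated])
      ultimately show False using least by (meson not_less)
    qed
  qed
  note hom_ker = this
  have "mor_kernel (free us) M p \<subseteq> max_ideal_times (free us)"
  proof
    fix x assume x: "x \<in> mor_kernel (free us) M p"
    note xc = p.kernel_closed[OF x]
    show "x \<in> max_ideal_times (free us)"
    proof (rule p.M.in_max_ideal_times_if_parts[OF xc])
      fix u
      have "part (free us) u x \<in> mor_kernel (free us) M p"
        using p.kernel_submodule x by (simp only: graded_submodule_def)
      then show "part (free us) u x \<in> max_ideal_times (free us)"
        by (rule hom_ker[OF _ p.M.part_component[OF xc]])
    qed
  qed
  then show ?thesis using that hom surj unfolding minimal_cover_def by blast
qed

text \<open>
  Nakayama's lemma for surjectivity: modulo the kernel of \<open>q\<close>, every element of \<open>Q\<close> is an image under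
  \<open>\<phi>\<close>, and the error in the kernel has coefficients of smaller degree, which are images by induction.
\<close>

lemma surj_if_cover_surj:
  assumes "graded_homo P Q \<phi>" "graded_homo Q M q" "bounded_below Q"
    and surj: "\<And>y. y \<in> carrier Q \<Longrightarrow> \<exists>x \<in> carrier P. q (\<phi> x) = q y"
    and ker: "mor_kernel Q M q \<subseteq> max_ideal_times Q"
  shows "\<phi> ` carrier P = carrier Q"
proof -
  interpret \<phi>: graded_homo P Q \<phi> by fact
  interpret q: graded_homo Q M q by fact
  interpret c: graded_homo P M "\<lambda>x. q (\<phi> x)"
    by (rule graded_homoI[OF \<phi>.M.graded q.N.graded graded_hom_comp[OF \<phi>.homo q.homo]])
  have *: "x \<in> \<phi> ` carrier P" if "x \<in> component Q u" for u x
    using assms(3) that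
  proof (induction rule: bounded_below_induct)
    case (low u)
    then show ?case using \<phi>.zero \<phi>.M.zero_closed by (metis imageI)
  next
    case (step u x)
    have xc: "x \<in> carrier Q" using step(1) by (rule \<phi>.N.component_closed)
    then obtain y0 where y0: "y0 \<in> carrier P" "q (\<phi> y0) = q x" using surj by blast
    moreover have "q x \<in> component M u" using step(1) by (rule q.component)
    ultimately obtain y where y: "y \<in> component P u" "q (\<phi> y) = q x"
      using c.component_preimage[of y0 u] by auto
    then have yc: "y \<in> carrier P" by blast
    have "x \<ominus>\<^bsub>Q\<^esub> \<phi> y \<in> mor_kernel Q M q"
      using xc yc y(2) by (simp add: mor_kernel_def q.diff)
    then have "x \<ominus>\<^bsub>Q\<^esub> \<phi> y \<in> max_ideal_times Q" using ker by blast
    moreover have "x \<ominus>\<^bsub>Q\<^esub> \<phi> y \<in> component Q u" using step(1) \<phi>.component[OF y(1)] by (rule \<phi>.N.component_diff)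
    ultimately obtain z where z: "\<forall>i. z i \<in> component Q (u - unit_grade i)"
      "x \<ominus>\<^bsub>Q\<^esub> \<phi> y = (\<Oplus>\<^bsub>Q\<^esub>i\<in>UNIV. indet i \<odot>\<^bsub>Q\<^esub> z i)"
      by (rule \<phi>.N.max_ideal_times_homogeneous)
    have "\<forall>i. \<exists>w. w \<in> carrier P \<and> \<phi> w = z i" using step(2)[OF z(1)[rule_format]] by (metis imageE)
    from choice[OF this] obtain w where w: "\<And>i. w i \<in> carrier P" "\<And>i. \<phi> (w i) = z i" by blast
    define v where "v = (\<Oplus>\<^bsub>P\<^esub>i\<in>UNIV. indet i \<odot>\<^bsub>P\<^esub> w i)"
    have v: "v \<in> carrier P" unfolding v_def by (rule \<phi>.M.finsum_closed) (simp add: w)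
    have "\<phi> v = (\<Oplus>\<^bsub>Q\<^esub>i\<in>UNIV. \<phi> (indet i \<odot>\<^bsub>P\<^esub> w i))"
      unfolding v_def by (rule \<phi>.finsum) (simp add: w)
    also have "\<dots> = x \<ominus>\<^bsub>Q\<^esub> \<phi> y" by (simp add: z(2) \<phi>.smult w)
    finally have "\<phi> (y \<oplus>\<^bsub>P\<^esub> v) = x"
      using xc yc v by (simp add: \<phi>.add \<phi>.N.add_diff)
    then show ?case using yc v by (metis \<phi>.M.a_closed imageI)
  qed
  have "x \<in> \<phi> ` carrier P" if "x \<in> carrier Q" for x
    using that
  proof (induction rule: \<phi>.N.homogeneous_induct)
    case (add x y)
    then show ?case by (auto simp flip: \<phi>.add)
  qed (rule *)
  then show ?thesis by auto
qed

text \<open>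
  Nakayama's lemma for injectivity: if the section \<open>s\<close> exists, the kernel \<open>K\<close> of \<open>q\<close> is a summand of \<open>Q\<close>,
  so that its elements, being multiples of the maximal ideal in \<open>Q\<close>, are such multiples in \<open>K\<close>.
\<close>

lemma iso_if_split_cover:
  assumes "graded_homo Q M q" "graded_hom M Q s" "\<And>y. y \<in> carrier M \<Longrightarrow> q (s y) = y"
    and "bounded_below Q" and ker: "mor_kernel Q M q \<subseteq> max_ideal_times Q"
  shows "graded_iso Q M q"
proof -
  interpret q: graded_homo Q M q by fact
  interpret s: graded_homo M Q s by (rule graded_homoI[OF q.N.graded q.M.graded assms(2)])
  have *: "q x = \<zero>\<^bsub>M\<^esub> \<longrightarrow> x = \<zero>\<^bsub>Q\<^esub>" if "x \<in> component Q u" for u x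
    using assms(4) that
  proof (induction rule: bounded_below_induct)
    case (step u x)
    show ?case
    proof
      assume qx: "q x = \<zero>\<^bsub>M\<^esub>"
      have xc: "x \<in> carrier Q" using step(1) by (rule q.M.component_closed)
      then have "x \<in> max_ideal_times Q" using qx ker by (auto simp: mor_kernel_def)
      then obtain z
        where z: "\<forall>i. z i \<in> component Q (u - unit_grade i)" "x = (\<Oplus>\<^bsub>Q\<^esub>i\<in>UNIV. indet i \<odot>\<^bsub>Q\<^esub> z i)"
        by (rule q.M.max_ideal_times_homogeneous[OF _ step(1)])
      have zc: "z i \<in> carrier Q" for i using z(1)[rule_format] by (rule q.M.component_closed)
      \<comment> \<open>The map sending x to x - s (q x) fixes the kernel and has values in it.\<close>
      define e where "e i = z i \<ominus>\<^bsub>Q\<^esub> s (q (z i))" for i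
      have sz: "s (q (z i)) \<in> component Q (u - unit_grade i)" for i
        by (rule s.component[OF q.component[OF z(1)[rule_format]]])
      have e: "e i \<in> component Q (u - unit_grade i)" for i
        unfolding e_def by (rule q.M.component_diff[OF z(1)[rule_format] sz])
      have "q (e i) = \<zero>\<^bsub>M\<^esub>" for i using zc by (simp add: e_def q.diff assms(3))
      then have e0: "z i = s (q (z i))" for i
        using step(2)[OF e] zc by (simp add: e_def q.M.diff_eq_zero)
      have "\<zero>\<^bsub>Q\<^esub> = s (q x)" by (simp add: qx)
      also have "\<dots> = (\<Oplus>\<^bsub>Q\<^esub>i\<in>UNIV. indet i \<odot>\<^bsub>Q\<^esub> s (q (z i)))"
        unfolding z(2) using zc by (simp add: q.finsum s.finsum q.smult s.smult)
      also have "\<dots> = x" unfolding e0[symmetric] by (rule z(2)[symmetric])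
      finally show "x = \<zero>\<^bsub>Q\<^esub>" ..
    qed
  qed simp
  have "x = \<zero>\<^bsub>Q\<^esub>" if "x \<in> carrier Q" "q x = \<zero>\<^bsub>M\<^esub>" for x
  proof (rule q.M.zero_if_parts_zero[OF that(1)])
    fix u
    have "q (part Q u x) = \<zero>\<^bsub>M\<^esub>" using q.part[OF that(1), of u] that(2) by simp
    then show "part Q u x = \<zero>\<^bsub>Q\<^esub>" using *[OF q.M.part_component[OF that(1)]] by blast
  qed
  then have "inj_on q (carrier Q)" by (intro q.inj_on_if_kernel) (auto simp: mor_kernel_def)
  moreover have "q ` carrier Q = carrier M"
    using assms(3) s.closed by (metis image_eqI q.closed subsetI subset_antisym image_subsetI)
  ultimately show ?thesis using q.homo by (simp add: graded_iso_def bij_betw_def)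
qed

lemma free_graded_is_graded: "free_graded P \<Longrightarrow> is_graded_module P"
  by (simp add: free_graded_def)

lemma free_gradedE:
  assumes "free_graded P" obtains us \<phi> \<psi> where "graded_iso P (free us) \<phi>" "graded_iso (free us) P \<psi>"
    "\<forall>x\<in>carrier P. \<psi> (\<phi> x) = x" "\<forall>y\<in>carrier (free us). \<phi> (\<psi> y) = y"
proof -
  from assms obtain us \<phi> where \<phi>: "graded_iso P (free us) \<phi>"
    unfolding free_graded_def isomorphic_modules_def by blast
  obtain \<psi> where "graded_iso (free us) P \<psi>" "\<forall>x\<in>carrier P. \<psi> (\<phi> x) = x"
      "\<forall>y\<in>carrier (free us). \<phi> (\<psi> y) = y"
    by (rule graded_iso_inverse[OF free_graded_is_graded[OF assms] free_is_graded \<phi>])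
  then show ?thesis by (rule that[OF \<phi>])
qed

lemma free_graded_lift:
  assumes "free_graded P" "graded_homo M N p" "p ` carrier M = carrier N" "graded_hom P N \<phi>"
  obtains \<psi> where "graded_hom P M \<psi>" "\<forall>x\<in>carrier P. p (\<psi> x) = \<phi> x"
proof -
  obtain us \<alpha> \<beta> where iso: "graded_iso P (free us) \<alpha>" "graded_iso (free us) P \<beta>"
    "\<forall>x\<in>carrier P. \<beta> (\<alpha> x) = x" "\<forall>y\<in>carrier (free us). \<alpha> (\<beta> y) = y"
    by (rule free_gradedE[OF assms(1)])
  have "graded_hom (free us) N (\<lambda>x. \<phi> (\<beta> x))"
    by (rule graded_hom_comp[OF _ assms(4)]) (use iso(2) in \<open>simp only: graded_iso_def\<close>)
  then obtain \<psi> where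
    \<psi>: "graded_hom (free us) M \<psi>" "\<forall>x\<in>carrier (free us). p (\<psi> x) = \<phi> (\<beta> x)"
    by (rule free_lift[OF assms(2,3)])
  show ?thesis
  proof (rule that)
    show "graded_hom P M (\<lambda>x. \<psi> (\<alpha> x))"
      by (rule graded_hom_comp[OF _ \<psi>(1)]) (use iso(1) in \<open>simp only: graded_iso_def\<close>)
    show "\<forall>x\<in>carrier P. p (\<psi> (\<alpha> x)) = \<phi> x"
    proof
      fix x assume x: "x \<in> carrier P"
      show "p (\<psi> (\<alpha> x)) = \<phi> x"
        using \<psi>(2)[rule_format, OF graded_iso_closed[OF iso(1) x]] iso(3)[rule_format, OF x] by simp
    qed
  qed
qed

lemma free_graded_bounded_below:
  fixes P :: "('d::finite, 'k::field, 'm) pmodule"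
  assumes "free_graded P" shows "bounded_below P"
proof -
  obtain us \<alpha> \<beta> where iso: "graded_iso P (free us) \<alpha>" "graded_iso (free us) P \<beta>"
    "\<forall>x\<in>carrier P. \<beta> (\<alpha> x) = x" "\<forall>y\<in>carrier (free us). \<alpha> (\<beta> y) = y"
    by (rule free_gradedE[OF assms])
  interpret \<alpha>: graded_homo P "free us" \<alpha>
    using iso(1) by (intro graded_homoI free_graded_is_graded[OF assms] free_is_graded) (simp add: graded_iso_def)
  obtain b where b: "\<And>u (x :: nat \<Rightarrow> (_, 'k) mpoly). total u < b \<Longrightarrow> x \<in> component (free us) u \<Longrightarrow> x = \<zero>\<^bsub>free us\<^esub>"
    using free_bounded_below[of us] unfolding bounded_below_def by blast
  have "x = \<zero>\<^bsub>P\<^esub>" if "total u < b" "x \<in> component P u" for u x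
  proof -
    have "\<alpha> x = \<alpha> \<zero>\<^bsub>P\<^esub>" using b[OF that(1) \<alpha>.component[OF that(2)]] by (simp only: \<alpha>.zero)
    then show ?thesis using iso(3)[rule_format, OF \<alpha>.M.component_closed[OF that(2)]] iso(3)[rule_format, OF \<alpha>.M.zero_closed] by simp
  qed
  then show ?thesis unfolding bounded_below_def by blast
qed

lemma free_graded_finitely_generated: assumes "free_graded P" shows "finitely_generated P"
proof -
  obtain us \<alpha> \<beta> where "graded_iso P (free us) \<alpha>" "graded_iso (free us) P \<beta>"
    "\<forall>x\<in>carrier P. \<beta> (\<alpha> x) = x" "\<forall>y\<in>carrier (free us). \<alpha> (\<beta> y) = y"
    by (rule free_gradedE[OF assms])
  then show ?thesis
    using finitely_generated_iso[OF free_is_graded free_graded_is_graded[OF assms] _ free_finitely_generated]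
    by (auto simp: isomorphic_modules_def)
qed

text \<open>
  A lift of \<open>p\<close> along \<open>q\<close> is surjective by Nakayama's lemma, it splits because \<open>Q\<close> is free, and its
  kernel lies in the kernel of \<open>p\<close>.
\<close>

theorem minimal_cover_unique:
  assumes P: "free_graded P" and Q: "free_graded Q" and M: "is_graded_module M"
    and p: "minimal_cover P M p" and q: "minimal_cover Q M q"
  obtains \<phi> where "graded_iso P Q \<phi>" "\<forall>x\<in>carrier P. q (\<phi> x) = p x"
proof -
  note gP = free_graded_is_graded[OF P] and gQ = free_graded_is_graded[OF Q]
  interpret p: graded_homo P M p using p by (intro graded_homoI gP M) (simp add: minimal_cover_def)
  interpret q: graded_homo Q M q using q by (intro graded_homoI gQ M) (simp add: minimal_cover_def)
  have q_surj: "q ` carrier Q = carrier M" and p_surj: "p ` carrier P = carrier M"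
    using p q by (simp_all add: minimal_cover_def)
  obtain \<phi> where \<phi>: "graded_hom P Q \<phi>" "\<forall>x\<in>carrier P. q (\<phi> x) = p x"
    by (rule free_graded_lift[OF P q.graded_homo_axioms q_surj p.homo])
  interpret \<phi>: graded_homo P Q \<phi> by (rule graded_homoI[OF gP gQ \<phi>(1)])
  have "\<phi> ` carrier P = carrier Q"
  proof (rule surj_if_cover_surj[OF \<phi>.graded_homo_axioms q.graded_homo_axioms free_graded_bounded_below[OF Q]])
    show "mor_kernel Q M q \<subseteq> max_ideal_times Q" using q by (simp add: minimal_cover_def)
    fix y assume "y \<in> carrier Q"
    then have "q y \<in> p ` carrier P" unfolding p_surj by (rule q.closed)
    then show "\<exists>x\<in>carrier P. q (\<phi> x) = q y" using \<phi>(2) by auto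
  qed
  then obtain s where s: "graded_hom Q P s" "\<forall>y\<in>carrier Q. \<phi> (s y) = y"
    using free_graded_lift[OF Q \<phi>.graded_homo_axioms _ graded_hom_id] by blast
  have "graded_iso P Q \<phi>"
  proof (rule iso_if_split_cover[OF \<phi>.graded_homo_axioms s(1) s(2)[rule_format] free_graded_bounded_below[OF P]])
    have "mor_kernel P Q \<phi> \<subseteq> mor_kernel P M p"
    proof
      fix x assume "x \<in> mor_kernel P Q \<phi>"
      then show "x \<in> mor_kernel P M p" using \<phi>(2)[rule_format, of x] by (auto simp: mor_kernel_def)
    qed
    then show "mor_kernel P Q \<phi> \<subseteq> max_ideal_times P" using p by (auto simp: minimal_cover_def)
  qed
  then show ?thesis using that \<phi>(2) by blast
qed

text \<open>A minimal cover of a summand of a free module splits, hence is an isomorphism.\<close>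

theorem free_graded_summand:
  assumes F: "free_graded F" and M: "is_graded_module M"
    and \<iota>: "graded_hom M F \<iota>" and \<pi>: "graded_hom F M \<pi>" "\<And>x. x \<in> carrier M \<Longrightarrow> \<pi> (\<iota> x) = x"
  shows "free_graded M"
proof -
  note gF = free_graded_is_graded[OF F]
  interpret \<iota>: graded_homo M F \<iota> by (rule graded_homoI[OF M gF \<iota>])
  interpret \<pi>: graded_homo F M \<pi> by (rule graded_homoI[OF gF M \<pi>(1)])
  have "\<pi> ` carrier F = carrier M"
    using \<pi>(2) by (metis \<iota>.closed \<pi>.closed image_eqI image_subsetI subsetI subset_antisym)
  then have "finitely_generated M"
    by (rule \<pi>.finitely_generated_image[OF free_graded_finitely_generated[OF F]])
  from minimal_cover_exists[OF M this] obtain us p where p: "minimal_cover (free us) M p" .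
  interpret p: graded_homo "free us" M p
    using p by (intro graded_homoI free_is_graded M) (simp add: minimal_cover_def)
  have p_surj: "p ` carrier (free us) = carrier M" using p by (simp add: minimal_cover_def)
  obtain \<psi> where \<psi>: "graded_hom F (free us) \<psi>" "\<forall>x\<in>carrier F. p (\<psi> x) = \<pi> x"
    by (rule free_graded_lift[OF F p.graded_homo_axioms p_surj \<pi>(1)])
  have "graded_iso (free us) M p"
  proof (rule iso_if_split_cover[OF p.graded_homo_axioms graded_hom_comp[OF \<iota> \<psi>(1)]])
    show "p (\<psi> (\<iota> y)) = y" if "y \<in> carrier M" for y using that by (simp add: \<psi>(2) \<pi>(2))
    show "mor_kernel (free us) M p \<subseteq> max_ideal_times (free us)" using p by (simp add: minimal_cover_def)
  qed (rule free_bounded_below)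
  then have "isomorphic_modules (free us) M" unfolding isomorphic_modules_def by blast
  then show ?thesis
    using isomorphic_modules_sym[OF free_is_graded M] M unfolding free_graded_def by blast
qed

section \<open>Matrices as morphisms of free modules\<close>

lemma is_gmatrixD:
  assumes "is_gmatrix A"
  shows "entries A \<in> carrier_mat (length (row_grades A)) (length (col_grades A))"
    "dim_row (entries A) = length (row_grades A)" "dim_col (entries A) = length (col_grades A)"
    "i < length (row_grades A) \<Longrightarrow> j < length (col_grades A) \<Longrightarrow>
      entries A $$ (i, j) \<in> homogeneous (col_grades A ! j - row_grades A ! i)"
  using assms by (auto simp: is_gmatrix_def)

definition mat_map :: "('d::finite, 'k::field) mpoly mat \<Rightarrow> (nat \<Rightarrow> ('d, 'k) mpoly) \<Rightarrow> nat \<Rightarrow> ('d, 'k) mpoly" where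
  "mat_map A x = (\<lambda>i \<in> {..<dim_row A}. \<Sum>j<dim_col A. A $$ (i, j) * x j)"

definition matrix_mor ::
  "('d::finite, 'k::field) gmatrix \<Rightarrow> ('d, 'k, nat \<Rightarrow> ('d, 'k) mpoly, nat \<Rightarrow> ('d, 'k) mpoly) gmorphism" where
  "matrix_mor A = \<lparr>src = free (col_grades A), tgt = free (row_grades A), app = mat_map (entries A)\<rparr>"

lemma matrix_mor_simps [simp]:
  "src (matrix_mor A) = free (col_grades A)" "tgt (matrix_mor A) = free (row_grades A)"
  "app (matrix_mor A) = mat_map (entries A)"
  by (simp_all add: matrix_mor_def)

lemma mat_map_hom:
  fixes A :: "('d::finite, 'k::field) gmatrix"
  assumes "is_gmatrix A"
  shows "graded_hom (free (col_grades A)) (free (row_grades A)) (mat_map (entries A))"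
proof (rule graded_homI)
  note D = is_gmatrixD[OF assms]
  {
    fix x :: "nat \<Rightarrow> ('d, 'k) mpoly"
    show "mat_map (entries A) x \<in> carrier (free (row_grades A))"
      unfolding free_simps mat_map_def D(2) by simp
  next
    fix x y :: "nat \<Rightarrow> ('d, 'k) mpoly"
    show "mat_map (entries A) (x \<oplus>\<^bsub>free (col_grades A)\<^esub> y) =
        mat_map (entries A) x \<oplus>\<^bsub>free (row_grades A)\<^esub> mat_map (entries A) y"
      unfolding free_simps mat_map_def D(2,3)
      by (rule restrict_ext) (simp add: distrib_left sum.distrib)
  next
    fix x :: "nat \<Rightarrow> ('d, 'k) mpoly" and p
    show "mat_map (entries A) (p \<odot>\<^bsub>free (col_grades A)\<^esub> x) =
        p \<odot>\<^bsub>free (row_grades A)\<^esub> mat_map (entries A) x"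
      unfolding free_simps mat_map_def D(2,3)
      by (rule restrict_ext) (simp add: sum_distrib_left mult.left_commute)
  next
    fix x :: "nat \<Rightarrow> ('d, 'k) mpoly" and u assume x: "x \<in> component (free (col_grades A)) u"
    show "mat_map (entries A) x \<in> component (free (row_grades A)) u"
      unfolding free_simps mat_map_def D(2,3)
    proof (intro conjI allI impI)
      fix i assume i: "i < length (row_grades A)"
      have "(\<Sum>j<length (col_grades A). entries A $$ (i, j) * x j) \<in> homogeneous (u - row_grades A ! i)"
      proof (rule homogeneous_sum)
        fix j assume "j \<in> {..<length (col_grades A)}"
        then show "entries A $$ (i, j) * x j \<in> homogeneous (u - row_grades A ! i)"
          using homogeneous_mult[OF D(4)[OF i, of j], of "x j" "u - col_grades A ! j"] x
          unfolding free_simps by simp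
      qed
      then show "(\<lambda>i\<in>{..<length (row_grades A)}. \<Sum>j<length (col_grades A). entries A $$ (i, j) * x j) i
          \<in> homogeneous (u - row_grades A ! i)" using i by simp
    qed simp
  }
qed

lemma mat_map_unit_vector:
  "i < dim_row A \<Longrightarrow> j < dim_col A \<Longrightarrow> mat_map A (unit_vector (dim_col A) j) i = A $$ (i, j)"
proof -
  assume ij: "i < dim_row A" "j < dim_col A"
  have "(\<Sum>k<dim_col A. A $$ (i, k) * unit_vector (dim_col A) j k) = (\<Sum>k<dim_col A. if k = j then A $$ (i, j) else 0)"
    by (rule sum.cong) (auto simp: unit_vector_def)
  then show ?thesis using ij by (simp add: mat_map_def)
qed

lemma mat_map_eq_iff:
  assumes "A \<in> carrier_mat n m" "B \<in> carrier_mat n m"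
    "\<And>x. x \<in> extensional {..<m} \<Longrightarrow> mat_map A x = mat_map B x"
  shows "A = B"
proof (rule eq_matI)
  fix i j assume ij: "i < dim_row B" "j < dim_col B"
  have "unit_vector m j \<in> extensional {..<m}" for j by (simp add: unit_vector_def)
  from assms(3)[OF this, of j] show "A $$ (i, j) = B $$ (i, j)"
    using mat_map_unit_vector[of i A j] mat_map_unit_vector[of i B j] ij assms(1,2) by simp
qed (use assms in auto)

lemma mat_map_mult:
  assumes "dim_col A = dim_row B" shows "mat_map (A * B) x = mat_map A (mat_map B x)"
proof -
  have "(\<Sum>j<dim_col B. (A * B) $$ (i, j) * x j) = (\<Sum>k<dim_col A. A $$ (i, k) * (\<Sum>j<dim_col B. B $$ (k, j) * x j))"
    if i: "i < dim_row A" for i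
  proof -
    have "(\<Sum>j<dim_col B. (A * B) $$ (i, j) * x j) = (\<Sum>j<dim_col B. \<Sum>k<dim_col A. A $$ (i, k) * B $$ (k, j) * x j)"
      using i assms by (intro sum.cong) (auto simp: scalar_prod_def sum_distrib_right lessThan_atLeast0)
    also have "\<dots> = (\<Sum>k<dim_col A. \<Sum>j<dim_col B. A $$ (i, k) * B $$ (k, j) * x j)" by (rule sum.swap)
    finally show ?thesis by (simp add: sum_distrib_left mult.assoc)
  qed
  then show ?thesis using assms by (auto simp: mat_map_def intro!: restrict_ext)
qed

lemma mat_map_one: assumes "x \<in> extensional {..<n}" shows "mat_map (1\<^sub>m n) x = x"
proof (rule extensionalityI[OF _ assms])
  fix i assume i: "i \<in> {..<n}"
  have "(\<Sum>j<n. 1\<^sub>m n $$ (i, j) * x j) = (\<Sum>j<n. if j = i then x i else 0)"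
    by (rule sum.cong) (use i in auto)
  then show "mat_map (1\<^sub>m n) x i = x i" using i by (simp add: mat_map_def)
qed (simp add: mat_map_def)

lemma hom_matrix:
  fixes \<phi> :: "(nat \<Rightarrow> ('d::finite, 'k::field) mpoly) \<Rightarrow> nat \<Rightarrow> ('d, 'k) mpoly"
  assumes "graded_hom (free vs) (free us) \<phi>"
  obtains Q where "is_gmatrix \<lparr>row_grades = us, col_grades = vs, entries = Q\<rparr>"
    "\<forall>x\<in>carrier (free vs). \<phi> x = mat_map Q x"
proof -
  interpret \<phi>: graded_homo "free vs" "free us" \<phi> by (rule graded_homoI[OF free_is_graded free_is_graded assms])
  define Q where "Q = mat (length us) (length vs) (\<lambda>(i, j). \<phi> (unit_vector (length vs) j) i)"
  have "is_gmatrix \<lparr>row_grades = us, col_grades = vs, entries = Q\<rparr>"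
    unfolding is_gmatrix_def gmatrix.simps
  proof (intro conjI allI impI)
    fix i j assume ij: "i < length us" "j < length vs"
    show "Q $$ (i, j) \<in> homogeneous (vs ! j - us ! i)"
      using \<phi>.component[OF unit_vector_component[OF ij(2)]] ij unfolding free_simps by (simp add: Q_def)
  qed (simp add: Q_def)
  moreover have "\<phi> x = mat_map Q x" if x: "x \<in> carrier (free vs)" for x
  proof (rule extensionalityI)
    show "\<phi> x \<in> extensional {..<length us}" using \<phi>.closed[OF x] unfolding free_simps .
    show "mat_map Q x \<in> extensional {..<length us}" by (simp add: mat_map_def Q_def)
    fix i assume i: "i \<in> {..<length us}"
    have c: "x j \<odot>\<^bsub>free us\<^esub> \<phi> (unit_vector (length vs) j) \<in> carrier (free us)" for j
      by (rule \<phi>.N.smult_closed[OF \<phi>.closed[OF unit_vector_carrier]])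
    have "\<phi> x i = lin (free us) (length vs) (\<lambda>j. \<phi> (unit_vector (length vs) j)) x i"
      using hom_from_free[OF free_is_graded assms x] by simp
    also have "\<dots> = (\<Sum>j<length vs. (x j \<odot>\<^bsub>free us\<^esub> \<phi> (unit_vector (length vs) j)) i)"
      unfolding lin_def using i by (intro free_finsum[OF c]) simp
    also have "\<dots> = (\<Sum>j<length vs. Q $$ (i, j) * x j)"
      by (rule sum.cong) (use i in \<open>auto simp: free_simps Q_def mult.commute\<close>)
    finally show "\<phi> x i = mat_map Q x i" using i by (simp add: mat_map_def Q_def)
  qed
  ultimately show ?thesis using that by blast
qed

text \<open>
  Otherwise padding with zeros would give an invertible square matrix with a zero row. This makes the
  rank of a free module an invariant.
\<close>

lemma left_inverse_dim_le:
  fixes P Q :: "'a::comm_ring_1 mat"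
  assumes P: "P \<in> carrier_mat m n" and Q: "Q \<in> carrier_mat n m" and PQ: "P * Q = 1\<^sub>m m"
  shows "m \<le> n"
proof (rule ccontr)
  assume "\<not> m \<le> n"
  then have nm: "n < m" by simp
  define P' where "P' = mat m m (\<lambda>(i, j). if j < n then P $$ (i, j) else 0)"
  define Q' where "Q' = mat m m (\<lambda>(i, j). if i < n then Q $$ (i, j) else 0)"
  have c: "P' \<in> carrier_mat m m" "Q' \<in> carrier_mat m m" by (simp_all add: P'_def Q'_def)
  have "P' * Q' = P * Q"
  proof (rule eq_matI)
    fix i j assume "i < dim_row (P * Q)" "j < dim_col (P * Q)"
    then have ij: "i < m" "j < m" using P Q by auto
    have "(P' * Q') $$ (i, j) = (\<Sum>k\<in>{0..<m}. if k < n then P $$ (i, k) * Q $$ (k, j) else 0)"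
      using ij by (auto simp: P'_def Q'_def scalar_prod_def intro!: sum.cong)
    also have "\<dots> = (\<Sum>k\<in>{0..<n}. P $$ (i, k) * Q $$ (k, j))"
      by (rule sum.mono_neutral_cong_right) (use nm in auto)
    also have "\<dots> = (P * Q) $$ (i, j)" using ij P Q by (auto simp: scalar_prod_def)
    finally show "(P' * Q') $$ (i, j) = (P * Q) $$ (i, j)" .
  qed (use P Q in \<open>auto simp: P'_def Q'_def\<close>)
  then have "det P' * det Q' = 1" using det_mult[OF c] PQ by simp
  moreover have "multrow n 0 Q' = Q'"
    by (rule eq_matI) (auto simp: Q'_def)
  then have "det Q' = 0" using det_multrow[OF nm c(2), of 0] by simp
  ultimately show False by simp
qed

lemma base_change_iso:
  assumes "base_change us vs Q" shows "graded_iso (free vs) (free us) (mat_map Q)"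
proof -
  have gm: "is_gmatrix \<lparr>row_grades = us, col_grades = vs, entries = Q\<rparr>" and inv: "invertible_mat Q"
    using assms by (auto simp: base_change_def)
  note D = is_gmatrixD[OF gm, unfolded gmatrix.simps]
  obtain B where B: "Q * B = 1\<^sub>m (dim_row Q)" "B * Q = 1\<^sub>m (dim_row B)"
    using inv by (auto simp: invertible_mat_def inverts_mat_def)
  have dB: "dim_col B = dim_row Q" "dim_row B = dim_col Q"
    using arg_cong[OF B(1), of dim_col] arg_cong[OF B(2), of dim_col] by simp_all
  have 1: "mat_map B (mat_map Q x) = x" if "x \<in> extensional {..<length vs}" for x
    using mat_map_one[of x "dim_row B"] that dB D(3) B(2) by (simp flip: mat_map_mult)
  have 2: "mat_map Q (mat_map B y) = y" if "y \<in> extensional {..<length us}" for y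
    using mat_map_one[of y "dim_row Q"] that dB D(2) B(1) by (simp flip: mat_map_mult)
  have "bij_betw (mat_map Q) (carrier (free vs)) (carrier (free us))"
  proof (rule bij_betw_byWitness[where f'="mat_map B"])
    show "\<forall>a\<in>carrier (free vs). mat_map B (mat_map Q a) = a"
      by (intro ballI 1) (simp only: free_simps)
    show "\<forall>a'\<in>carrier (free us). mat_map Q (mat_map B a') = a'"
      by (intro ballI 2) (simp only: free_simps)
    show "mat_map Q ` carrier (free vs) \<subseteq> carrier (free us)"
    proof (rule image_subsetI)
      fix x show "mat_map Q x \<in> carrier (free us)" unfolding free_simps mat_map_def D(2) by simp
    qed
    show "mat_map B ` carrier (free us) \<subseteq> carrier (free vs)"
    proof (rule image_subsetI)
      fix x show "mat_map B x \<in> carrier (free vs)" unfolding free_simps mat_map_def dB D(3) by simp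
    qed
  qed
  then show ?thesis using mat_map_hom[OF gm] by (simp only: graded_iso_def gmatrix.simps)
qed

lemma iso_base_change:
  fixes \<phi> :: "(nat \<Rightarrow> ('d::finite, 'k::field) mpoly) \<Rightarrow> nat \<Rightarrow> ('d, 'k) mpoly"
  assumes "graded_iso (free vs) (free us) \<phi>"
  obtains Q where "base_change us vs Q" "\<forall>x\<in>carrier (free vs). \<phi> x = mat_map Q x"
proof -
  obtain \<psi> where \<psi>: "graded_iso (free us) (free vs) \<psi>" "\<forall>x\<in>carrier (free vs). \<psi> (\<phi> x) = x"
      "\<forall>y\<in>carrier (free us). \<phi> (\<psi> y) = y"
    by (rule graded_iso_inverse[OF free_is_graded free_is_graded assms])
  have hom: "graded_hom (free vs) (free us) \<phi>" "graded_hom (free us) (free vs) \<psi>"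
    using assms \<psi>(1) by (simp_all only: graded_iso_def)
  obtain Q where Q: "is_gmatrix \<lparr>row_grades = us, col_grades = vs, entries = Q\<rparr>"
    "\<forall>x\<in>carrier (free vs). \<phi> x = mat_map Q x" by (rule hom_matrix[OF hom(1)])
  obtain P where P: "is_gmatrix \<lparr>row_grades = vs, col_grades = us, entries = P\<rparr>"
    "\<forall>x\<in>carrier (free us). \<psi> x = mat_map P x" by (rule hom_matrix[OF hom(2)])
  note DQ = is_gmatrixD[OF Q(1), unfolded gmatrix.simps] and DP = is_gmatrixD[OF P(1), unfolded gmatrix.simps]
  have PQ: "P * Q = 1\<^sub>m (length vs)"
  proof (rule mat_map_eq_iff)
    fix x :: "nat \<Rightarrow> ('d, 'k) mpoly" assume x: "x \<in> extensional {..<length vs}"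
    then have xc: "x \<in> carrier (free vs)" unfolding free_simps .
    have "mat_map (P * Q) x = mat_map P (mat_map Q x)" using DP DQ by (simp add: mat_map_mult)
    also have "\<dots> = \<psi> (\<phi> x)" using P(2) Q(2) xc graded_iso_closed[OF assms xc] by metis
    also have "\<dots> = x" using \<psi>(2) xc by blast
    finally show "mat_map (P * Q) x = mat_map (1\<^sub>m (length vs)) x" by (simp add: mat_map_one[OF x])
  qed (use DP DQ in auto)
  have QP: "Q * P = 1\<^sub>m (length us)"
  proof (rule mat_map_eq_iff)
    fix x :: "nat \<Rightarrow> ('d, 'k) mpoly" assume x: "x \<in> extensional {..<length us}"
    then have xc: "x \<in> carrier (free us)" unfolding free_simps .
    have "mat_map (Q * P) x = mat_map Q (mat_map P x)" using DP DQ by (simp add: mat_map_mult)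
    also have "\<dots> = \<phi> (\<psi> x)" using P(2) Q(2) xc graded_iso_closed[OF \<psi>(1) xc] by metis
    also have "\<dots> = x" using \<psi>(3) xc by blast
    finally show "mat_map (Q * P) x = mat_map (1\<^sub>m (length us)) x" by (simp add: mat_map_one[OF x])
  qed (use DP DQ in auto)
  have "length us = length vs"
    using left_inverse_dim_le[OF DP(1) DQ(1) PQ] left_inverse_dim_le[OF DQ(1) DP(1) QP] by simp
  then have "invertible_mat Q"
    unfolding invertible_mat_def inverts_mat_def square_mat.simps using DQ DP PQ QP by auto
  then show ?thesis using that Q by (auto simp: base_change_def)
qed

lemma isomorphic_morphismsI:
  "graded_iso (src f) (src f') g \<Longrightarrow> graded_iso (tgt f) (tgt f') h \<Longrightarrow>
    (\<And>x. x \<in> carrier (src f) \<Longrightarrow> h (app f x) = app f' (g x)) \<Longrightarrow> isomorphic_morphisms f f'"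
  unfolding isomorphic_morphisms_def by blast

lemma isomorphic_morphismsE:
  assumes "isomorphic_morphisms f f'"
  obtains g h where "graded_iso (src f) (src f') g" "graded_iso (tgt f) (tgt f') h"
    "\<forall>x\<in>carrier (src f). h (app f x) = app f' (g x)"
  using assms unfolding isomorphic_morphisms_def by blast

lemma isomorphic_morphisms_refl: "isomorphic_morphisms f f"
  by (rule isomorphic_morphismsI[OF graded_iso_id graded_iso_id]) simp

lemma isomorphic_morphisms_trans:
  assumes "isomorphic_morphisms f1 f2" "isomorphic_morphisms f2 f3" shows "isomorphic_morphisms f1 f3"
proof -
  obtain g h where 1: "graded_iso (src f1) (src f2) g" "graded_iso (tgt f1) (tgt f2) h"
    "\<forall>x\<in>carrier (src f1). h (app f1 x) = app f2 (g x)" by (rule isomorphic_morphismsE[OF assms(1)])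
  obtain g' h' where 2: "graded_iso (src f2) (src f3) g'" "graded_iso (tgt f2) (tgt f3) h'"
    "\<forall>x\<in>carrier (src f2). h' (app f2 x) = app f3 (g' x)" by (rule isomorphic_morphismsE[OF assms(2)])
  show ?thesis
    by (rule isomorphic_morphismsI[OF graded_iso_comp[OF 1(1) 2(1)] graded_iso_comp[OF 1(2) 2(2)]])
      (simp add: 1(3) 2(3) graded_iso_closed[OF 1(1)])
qed

lemma isomorphic_morphisms_sym:
  assumes "is_graded_module (src f)" "is_graded_module (tgt f)" "is_graded_module (src f')" "is_graded_module (tgt f')"
    "graded_hom (src f) (tgt f) (app f)" "isomorphic_morphisms f f'"
  shows "isomorphic_morphisms f' f"
proof -
  obtain g h where 1: "graded_iso (src f) (src f') g" "graded_iso (tgt f) (tgt f') h"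
    "\<forall>x\<in>carrier (src f). h (app f x) = app f' (g x)" by (rule isomorphic_morphismsE[OF assms(6)])
  obtain g' where g': "graded_iso (src f') (src f) g'" "\<forall>x\<in>carrier (src f). g' (g x) = x"
      "\<forall>y\<in>carrier (src f'). g (g' y) = y"
    by (rule graded_iso_inverse[OF assms(1,3) 1(1)])
  obtain h' where h': "graded_iso (tgt f') (tgt f) h'" "\<forall>x\<in>carrier (tgt f). h' (h x) = x"
      "\<forall>y\<in>carrier (tgt f'). h (h' y) = y"
    by (rule graded_iso_inverse[OF assms(2,4) 1(2)])
  have fc: "app f x \<in> carrier (tgt f)" if "x \<in> carrier (src f)" for x
    using assms(5) that by (auto simp: graded_hom_def hom_def)
  show ?thesis
  proof (rule isomorphic_morphismsI[OF g'(1) h'(1)])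
    fix x assume x: "x \<in> carrier (src f')"
    note g'x = graded_iso_closed[OF g'(1) x]
    have "app f' x = h (app f (g' x))" using 1(3) g'(3) g'x x by simp
    then show "h' (app f' x) = app f (g' x)" using h'(2) fc[OF g'x] by simp
  qed
qed

text \<open>
  Coefficient lists are the elements of the standard free module; that each element has exactly one of
  them says that forming linear combinations is bijective.
\<close>

lemma homogeneous_basis_iff:
  fixes M :: "('d::finite, 'k::field, 'm) pmodule"
  assumes M: "is_graded_module M"
  shows "homogeneous_basis M us bs \<longleftrightarrow> length bs = length us \<and> (\<forall>i<length us. bs ! i \<in> component M (us ! i)) \<and>
    graded_iso (free us) M (lin M (length us) (\<lambda>i. bs ! i))"
proof -
  interpret graded_mod M using M by (simp add: graded_mod_def)
  let ?l = "lin M (length us) (\<lambda>i. bs ! i)"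
  have "(\<forall>x\<in>carrier M. \<exists>!cs. length cs = length bs \<and> x = (\<Oplus>\<^bsub>M\<^esub>i\<in>{..<length bs}. cs ! i \<odot>\<^bsub>M\<^esub> bs ! i)) \<longleftrightarrow>
      graded_iso (free us) M ?l"
    if len: "length bs = length us" and c: "\<forall>i<length us. bs ! i \<in> component M (us ! i)"
  proof -
    have bc: "bs ! i \<in> carrier M" if "i < length us" for i using c that by blast
    interpret l: graded_homo "free us" M ?l
      by (rule graded_homoI[OF free_is_graded M lin_hom]) (use c in blast)
    let ?r = "\<lambda>cs :: ('d, 'k) mpoly list. \<lambda>i\<in>{..<length us}. cs ! i"
    have r_lin: "(\<Oplus>\<^bsub>M\<^esub>i\<in>{..<length bs}. cs ! i \<odot>\<^bsub>M\<^esub> bs ! i) = ?l (?r cs)" for cs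
      unfolding lin_def len by (rule finsum_cong') (auto simp: bc)
    have r_c: "?r cs \<in> carrier (free us)" for cs unfolding free_simps by simp
    have r_ex: "\<exists>cs. length cs = length us \<and> x = ?r cs" if "x \<in> carrier (free us)" for x
    proof (intro exI conjI)
      show "x = ?r (map x [0..<length us])" using that unfolding free_simps by (auto simp: extensional_def)
    qed simp
    have r_inj: "cs = ds" if "length cs = length us" "length ds = length us" "?r cs = ?r ds" for cs ds
      using that by (intro nth_equalityI) (auto dest!: fun_cong split: if_splits simp: restrict_def)
    have "(\<forall>x\<in>carrier M. \<exists>!cs. length cs = length us \<and> x = ?l (?r cs)) \<longleftrightarrow>
        bij_betw ?l (carrier (free us)) (carrier M)" (is "?L \<longleftrightarrow> ?R")
    proof
      assume L: ?L
      show ?R unfolding bij_betw_def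
      proof
        show "inj_on ?l (carrier (free us))"
        proof (rule inj_onI)
          fix x y assume xy: "x \<in> carrier (free us)" "y \<in> carrier (free us)" "?l x = ?l y"
          obtain cs where cs: "length cs = length us" "x = ?r cs" using r_ex[OF xy(1)] by blast
          obtain ds where ds: "length ds = length us" "y = ?r ds" using r_ex[OF xy(2)] by blast
          have "\<exists>!cs. length cs = length us \<and> ?l x = ?l (?r cs)" using L l.closed[OF xy(1)] by blast
          then have "cs = ds" using cs ds xy(3) by (elim ex1E) (metis (no_types))
          then show "x = y" using cs ds by simp
        qed
        show "?l ` carrier (free us) = carrier M"
        proof (rule subset_antisym)
          show "?l ` carrier (free us) \<subseteq> carrier M" using l.closed by (rule image_subsetI)
          show "carrier M \<subseteq> ?l ` carrier (free us)"
          proof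
            fix y assume "y \<in> carrier M"
            then obtain cs where "y = ?l (?r cs)" using L by blast
            then show "y \<in> ?l ` carrier (free us)" using r_c by (rule image_eqI)
          qed
        qed
      qed
    next
      assume R: ?R
      show ?L
      proof
        fix y assume "y \<in> carrier M"
        then obtain x where x: "x \<in> carrier (free us)" "y = ?l x" using R unfolding bij_betw_def by blast
        obtain cs where cs: "length cs = length us" "x = ?r cs" using r_ex[OF x(1)] by blast
        show "\<exists>!cs. length cs = length us \<and> y = ?l (?r cs)"
        proof (rule ex1I[of _ cs])
          fix ds assume ds: "length ds = length us \<and> y = ?l (?r ds)"
          have "?r ds = ?r cs"
            using R ds x(2) cs(2) r_c by (metis (no_types) bij_betw_imp_inj_on inj_onD)
          then show "ds = cs" using r_inj ds cs(1) by blast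
        qed (use cs x in blast)
      qed
    qed
    then show ?thesis
      unfolding r_lin unfolding len graded_iso_def using l.homo by (simp only: simp_thms)
  qed
  then show ?thesis unfolding homogeneous_basis_def by blast
qed

lemma hom_eq_on_free:
  assumes "is_graded_module M" "graded_hom (free us) M \<phi>" "graded_hom (free us) M \<psi>"
    "\<And>i. i < length us \<Longrightarrow> \<phi> (unit_vector (length us) i) = \<psi> (unit_vector (length us) i)"
    "x \<in> carrier (free us)"
  shows "\<phi> x = \<psi> x"
proof -
  interpret \<psi>: graded_homo "free us" M \<psi> by (rule graded_homoI[OF free_is_graded assms(1,3)])
  have "lin M (length us) (\<lambda>i. \<phi> (unit_vector (length us) i)) x = lin M (length us) (\<lambda>i. \<psi> (unit_vector (length us) i)) x"
    unfolding lin_def by (rule \<psi>.N.finsum_cong') (use assms(4) \<psi>.closed[OF unit_vector_carrier] in auto)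
  then show ?thesis
    using hom_from_free[OF assms(1,2,5)] hom_from_free[OF assms(1,3,5)] by simp
qed

text \<open>
  Homogeneous bases of source and target are isomorphisms from standard free modules, and the equations
  between the bases and the entries say that these isomorphisms commute with the maps.
\<close>

theorem matrix_of_iff:
  fixes f :: "('d::finite, 'k::field, 'm, 'n) gmorphism"
  assumes S: "is_graded_module (src f)" and T: "is_graded_module (tgt f)" and f: "graded_hom (src f) (tgt f) (app f)"
  shows "matrix_of f A \<longleftrightarrow> is_gmatrix A \<and> isomorphic_morphisms (matrix_mor A) f"
proof -
  interpret f: graded_homo "src f" "tgt f" "app f" by (rule graded_homoI[OF S T f])
  let ?m = "length (col_grades A)" and ?n = "length (row_grades A)"
  have col: "mat_map (entries A) (unit_vector ?m j) i = entries A $$ (i, j)"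
    if "is_gmatrix A" "i < ?n" "j < ?m" for i j
    using mat_map_unit_vector[of i "entries A" j] is_gmatrixD[OF that(1)] that by simp
  show ?thesis
  proof
    assume "matrix_of f A"
    then obtain bs cs where A: "is_gmatrix A" and bs: "homogeneous_basis (src f) (col_grades A) bs"
      and cs: "homogeneous_basis (tgt f) (row_grades A) cs"
      and e: "\<And>j. j < length bs \<Longrightarrow> app f (bs ! j) =
        (\<Oplus>\<^bsub>tgt f\<^esub>i\<in>{..<length cs}. entries A $$ (i, j) \<odot>\<^bsub>tgt f\<^esub> cs ! i)"
      unfolding matrix_of_def by blast
    let ?g = "lin (src f) ?m (\<lambda>i. bs ! i)" and ?h = "lin (tgt f) ?n (\<lambda>i. cs ! i)"
    have g: "graded_iso (free (col_grades A)) (src f) ?g" "length bs = ?m"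
      "\<And>j. j < ?m \<Longrightarrow> bs ! j \<in> component (src f) (col_grades A ! j)"
      using bs unfolding homogeneous_basis_iff[OF S] by auto
    have h: "graded_iso (free (row_grades A)) (tgt f) ?h" "length cs = ?n"
      "\<And>i. i < ?n \<Longrightarrow> cs ! i \<in> component (tgt f) (row_grades A ! i)"
      using cs unfolding homogeneous_basis_iff[OF T] by auto
    have bc: "bs ! j \<in> carrier (src f)" if "j < ?m" for j using g(3)[OF that] by blast
    have cc: "cs ! i \<in> carrier (tgt f)" if "i < ?n" for i using h(3)[OF that] by blast
    have "?h (mat_map (entries A) x) = app f (?g x)" if "x \<in> carrier (free (col_grades A))" for x
    proof (rule hom_eq_on_free[OF T _ _ _ that])
      show "graded_hom (free (col_grades A)) (tgt f) (\<lambda>x. ?h (mat_map (entries A) x))"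
        by (rule graded_hom_comp[OF mat_map_hom[OF A]]) (use h(1) in \<open>simp only: graded_iso_def\<close>)
      show "graded_hom (free (col_grades A)) (tgt f) (\<lambda>x. app f (?g x))"
        by (rule graded_hom_comp[OF _ f]) (use g(1) in \<open>simp only: graded_iso_def\<close>)
      fix j assume j: "j < ?m"
      have "?h (mat_map (entries A) (unit_vector ?m j)) = (\<Oplus>\<^bsub>tgt f\<^esub>i\<in>{..<?n}. entries A $$ (i, j) \<odot>\<^bsub>tgt f\<^esub> cs ! i)"
        unfolding lin_def by (rule f.N.finsum_cong') (use col[OF A _ j] cc in auto)
      also have "\<dots> = app f (bs ! j)" using e[of j] j g(2) h(2) by simp
      also have "bs ! j = ?g (unit_vector ?m j)"
        using f.M.lin_unit_vector[of ?m "\<lambda>i. bs ! i" j, OF bc j] by simp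
      finally show "?h (mat_map (entries A) (unit_vector ?m j)) = app f (?g (unit_vector ?m j))" .
    qed
    then show "is_gmatrix A \<and> isomorphic_morphisms (matrix_mor A) f"
      using A g(1) h(1) isomorphic_morphismsI[of "matrix_mor A" f ?g ?h] unfolding matrix_mor_simps by blast
  next
    assume *: "is_gmatrix A \<and> isomorphic_morphisms (matrix_mor A) f"
    then have A: "is_gmatrix A" and iso: "isomorphic_morphisms (matrix_mor A) f" by auto
    obtain g h where g: "graded_iso (free (col_grades A)) (src f) g" and h: "graded_iso (free (row_grades A)) (tgt f) h"
      and e: "\<forall>x\<in>carrier (free (col_grades A)). h (mat_map (entries A) x) = app f (g x)"
      using isomorphic_morphismsE[OF iso, unfolded matrix_mor_simps] .
    have basis: "homogeneous_basis M us (map (\<lambda>i. \<phi> (unit_vector (length us) i)) [0..<length us])"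
      if M: "is_graded_module M" and \<phi>: "graded_iso (free us) M \<phi>"
      for us and M :: "('d, 'k, 'x) pmodule" and \<phi> :: "(nat \<Rightarrow> ('d, 'k) mpoly) \<Rightarrow> 'x"
    proof -
      have hom: "graded_hom (free us) M \<phi>" using \<phi> by (simp only: graded_iso_def)
      interpret \<phi>: graded_homo "free us" M \<phi> by (rule graded_homoI[OF free_is_graded M hom])
      let ?bs = "map (\<lambda>i. \<phi> (unit_vector (length us) i)) [0..<length us]"
      have bs: "?bs ! i \<in> component M (us ! i)" if "i < length us" for i
        using \<phi>.component[OF unit_vector_component[OF that]] that by simp
      then have bc: "?bs ! i \<in> carrier M" if "i < length us" for i using that by blast
      have l: "graded_hom (free us) M (lin M (length us) (\<lambda>i. ?bs ! i))" by (rule \<phi>.N.lin_hom[OF bs])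
      have eq: "lin M (length us) (\<lambda>i. ?bs ! i) x = \<phi> x" if x: "x \<in> carrier (free us)" for x
      proof (rule hom_eq_on_free[OF M l hom _ x])
        fix i assume i: "i < length us"
        show "lin M (length us) (\<lambda>i. ?bs ! i) (unit_vector (length us) i) = \<phi> (unit_vector (length us) i)"
          using \<phi>.N.lin_unit_vector[of "length us" "\<lambda>i. ?bs ! i" i, OF bc i] i by simp
      qed
      have "bij_betw (lin M (length us) (\<lambda>i. ?bs ! i)) (carrier (free us)) (carrier M)"
        using \<phi> bij_betw_cong[of "carrier (free us)" "lin M (length us) (\<lambda>i. ?bs ! i)" \<phi> "carrier M", OF eq]
        by (simp only: graded_iso_def)
      then show ?thesis unfolding homogeneous_basis_iff[OF M] graded_iso_def using l bs by simp
    qed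
    let ?bs = "map (\<lambda>i. g (unit_vector ?m i)) [0..<?m]" and ?cs = "map (\<lambda>i. h (unit_vector ?n i)) [0..<?n]"
    have hh: "graded_hom (free (row_grades A)) (tgt f) h" using h by (simp only: graded_iso_def)
    interpret h: graded_homo "free (row_grades A)" "tgt f" h by (rule graded_homoI[OF free_is_graded T hh])
    have "app f (?bs ! j) = (\<Oplus>\<^bsub>tgt f\<^esub>i\<in>{..<length ?cs}. entries A $$ (i, j) \<odot>\<^bsub>tgt f\<^esub> ?cs ! i)"
      if j: "j < length ?bs" for j
    proof -
      have Ac: "mat_map (entries A) (unit_vector ?m j) \<in> carrier (free (row_grades A))"
        unfolding free_simps mat_map_def is_gmatrixD(2)[OF A] by simp
      have "app f (?bs ! j) = h (mat_map (entries A) (unit_vector ?m j))"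
        using bspec[OF e unit_vector_carrier[of "col_grades A" j]] j by (simp del: direct_sum_simps)
      also have "\<dots> = (\<Oplus>\<^bsub>tgt f\<^esub>i\<in>{..<?n}. mat_map (entries A) (unit_vector ?m j) i \<odot>\<^bsub>tgt f\<^esub> h (unit_vector ?n i))"
        using hom_from_free[OF T hh Ac] unfolding lin_def .
      also have "\<dots> = (\<Oplus>\<^bsub>tgt f\<^esub>i\<in>{..<length ?cs}. entries A $$ (i, j) \<odot>\<^bsub>tgt f\<^esub> ?cs ! i)"
        by (rule f.N.finsum_cong') (use col[OF A] j h.closed[OF unit_vector_carrier] in auto)
      finally show ?thesis .
    qed
    then show "matrix_of f A" unfolding matrix_of_def using A basis[OF S g] basis[OF T h] by blast
  qed
qed

text \<open>
  Base changes are the matrices of isomorphisms of standard free modules: they are square because the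
  rank is an invariant, and their inverses are homogeneous because the inverse of a graded isomorphism
  is graded.
\<close>

theorem equivalent_gmatrices_iff:
  fixes A :: "('d::finite, 'k::field) gmatrix"
  shows "equivalent_gmatrices A A' \<longleftrightarrow>
    is_gmatrix A \<and> is_gmatrix A' \<and> isomorphic_morphisms (matrix_mor A) (matrix_mor A')"
proof (intro iffI conjI)
  assume eq: "equivalent_gmatrices A A'"
  then obtain Q P where A: "is_gmatrix A" and A': "is_gmatrix A'"
    and Q: "base_change (row_grades A') (row_grades A) Q" and P: "base_change (col_grades A) (col_grades A') P"
    and e: "entries A' = Q * entries A * P"
    unfolding equivalent_gmatrices_def by blast
  show "is_gmatrix A" "is_gmatrix A'" by fact+
  note D = is_gmatrixD(1)[OF A] is_gmatrixD(1)[OF A']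
  have dQ: "Q \<in> carrier_mat (length (row_grades A')) (length (row_grades A))"
    and dP: "P \<in> carrier_mat (length (col_grades A)) (length (col_grades A'))"
    using Q P by (auto simp: base_change_def is_gmatrix_def)
  note isoP = base_change_iso[OF P] and isoQ = base_change_iso[OF Q]
  obtain g where g: "graded_iso (free (col_grades A)) (free (col_grades A')) g"
      "\<forall>x\<in>carrier (free (col_grades A')). g (mat_map P x) = x"
      "\<forall>y\<in>carrier (free (col_grades A)). mat_map P (g y) = y"
    by (rule graded_iso_inverse[OF free_is_graded free_is_graded isoP])
  show "isomorphic_morphisms (matrix_mor A) (matrix_mor A')"
  proof (rule isomorphic_morphismsI; unfold matrix_mor_simps)
    show "graded_iso (free (col_grades A)) (free (col_grades A')) g" by fact
    show "graded_iso (free (row_grades A)) (free (row_grades A')) (mat_map Q)" by fact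
    fix x :: "nat \<Rightarrow> ('d, 'k) mpoly" assume x: "x \<in> carrier (free (col_grades A))"
    have "mat_map (entries A') (g x) = mat_map Q (mat_map (entries A) (mat_map P (g x)))"
      unfolding e using dQ dP D by (subst mat_map_mult, force, subst mat_map_mult) auto
    then show "mat_map Q (mat_map (entries A) x) = mat_map (entries A') (g x)"
      using g(3) x by (simp del: direct_sum_simps)
  qed
next
  assume "is_gmatrix A \<and> is_gmatrix A' \<and> isomorphic_morphisms (matrix_mor A) (matrix_mor A')"
  then have A: "is_gmatrix A" and A': "is_gmatrix A'" and iso: "isomorphic_morphisms (matrix_mor A) (matrix_mor A')"
    by auto
  note D = is_gmatrixD(1)[OF A] is_gmatrixD(1)[OF A']
  obtain g h where g: "graded_iso (free (col_grades A)) (free (col_grades A')) g"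
      and h: "graded_iso (free (row_grades A)) (free (row_grades A')) h"
      and e: "\<forall>x\<in>carrier (free (col_grades A)). h (mat_map (entries A) x) = mat_map (entries A') (g x)"
    using isomorphic_morphismsE[OF iso, unfolded matrix_mor_simps] .
  obtain g' where g': "graded_iso (free (col_grades A')) (free (col_grades A)) g'"
      "\<forall>x\<in>carrier (free (col_grades A)). g' (g x) = x"
      "\<forall>y\<in>carrier (free (col_grades A')). g (g' y) = y"
    by (rule graded_iso_inverse[OF free_is_graded free_is_graded g])
  obtain Q where Q: "base_change (row_grades A') (row_grades A) Q" "\<forall>x\<in>carrier (free (row_grades A)). h x = mat_map Q x"
    by (rule iso_base_change[OF h])
  obtain P where P: "base_change (col_grades A) (col_grades A') P" "\<forall>x\<in>carrier (free (col_grades A')). g' x = mat_map P x"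
    by (rule iso_base_change[OF g'(1)])
  have dQ: "Q \<in> carrier_mat (length (row_grades A')) (length (row_grades A))"
    and dP: "P \<in> carrier_mat (length (col_grades A)) (length (col_grades A'))"
    using Q P by (auto simp: base_change_def is_gmatrix_def)
  have "entries A' = Q * entries A * P"
  proof (rule mat_map_eq_iff[OF D(2)])
    fix x :: "nat \<Rightarrow> ('d, 'k) mpoly" assume "x \<in> extensional {..<length (col_grades A')}"
    then have x: "x \<in> carrier (free (col_grades A'))" unfolding free_simps .
    note g'x = graded_iso_closed[OF g'(1) x]
    have Ac: "mat_map (entries A) y \<in> carrier (free (row_grades A))" for y
      unfolding free_simps mat_map_def is_gmatrixD(2)[OF A] by simp
    have "mat_map (entries A') x = mat_map (entries A') (g (g' x))" using g'(3) x by simp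
    also have "\<dots> = h (mat_map (entries A) (g' x))" using e g'x by simp
    also have "\<dots> = mat_map Q (mat_map (entries A) (mat_map P x))" using Q(2) Ac P(2) x by simp
    also have "\<dots> = mat_map (Q * entries A * P) x"
      using dQ dP D by (subst mat_map_mult, force, subst mat_map_mult) auto
    finally show "mat_map (entries A') x = mat_map (Q * entries A * P) x" .
  qed (use dQ dP D in auto)
  then show "equivalent_gmatrices A A'"
    unfolding equivalent_gmatrices_def using A A' Q(1) P(1) by blast
qed

section \<open>Block diagonal matrices and direct sums of morphisms\<close>

text \<open>
  The position of \<open>i\<close> in the increasing enumeration of \<open>I\<close>; it is inverse to \<^const>\<open>pick\<close> on \<open>I\<close>.
\<close>

definition pos :: "nat set \<Rightarrow> nat \<Rightarrow> nat" where "pos I i = card {a \<in> I. a < i}"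

lemma pick_pos: "i \<in> I \<Longrightarrow> pick I (pos I i) = i"
  unfolding pos_def by (rule pick_card_in_set)

lemma length_nths_card: "I \<subseteq> {..<length us} \<Longrightarrow> length (nths us I) = card I"
  unfolding length_nths by (rule arg_cong[where f=card]) auto

lemma pick_in: "I \<subseteq> {..<length us} \<Longrightarrow> j < length (nths us I) \<Longrightarrow> pick I j \<in> I"
  and pos_pick: "I \<subseteq> {..<length us} \<Longrightarrow> j < length (nths us I) \<Longrightarrow> pos I (pick I j) = j"
  unfolding length_nths_card pos_def by (simp_all add: pick_in_set_le card_pick_le)

lemma pos_less: assumes "I \<subseteq> {..<length us}" "i \<in> I" shows "pos I i < length (nths us I)"
proof -
  have "finite I" using assms(1) finite_subset by blast
  moreover have "{a \<in> I. a < i} \<subset> I" using assms(2) by auto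
  ultimately show ?thesis unfolding length_nths_card[OF assms(1)] pos_def by (rule psubset_card_mono)
qed

lemma nths_nth: "I \<subseteq> {..<length us} \<Longrightarrow> j < length (nths us I) \<Longrightarrow> nths us I ! j = us ! pick I j"
  by (rule nth_nths) (simp add: length_nths)

text \<open>
  Partitions as lists of index sets. The sets may be empty, because blocks may lack rows or columns.
\<close>

definition cuts :: "nat \<Rightarrow> nat set list \<Rightarrow> bool" where
  "cuts n Is \<longleftrightarrow> (\<Union>(set Is)) = {..<n} \<and>
    (\<forall>k<length Is. \<forall>l<length Is. k \<noteq> l \<longrightarrow> Is ! k \<inter> Is ! l = {})"

lemma cutsD:
  assumes "cuts n Is"
  shows "k < length Is \<Longrightarrow> Is ! k \<subseteq> {..<n}"
    "i < n \<Longrightarrow> \<exists>k<length Is. i \<in> Is ! k"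
    "k < length Is \<Longrightarrow> l < length Is \<Longrightarrow> i \<in> Is ! k \<Longrightarrow> i \<in> Is ! l \<Longrightarrow> k = l"
proof -
  show "k < length Is \<Longrightarrow> Is ! k \<subseteq> {..<n}" using assms nth_mem unfolding cuts_def by blast
  show "k < length Is \<Longrightarrow> l < length Is \<Longrightarrow> i \<in> Is ! k \<Longrightarrow> i \<in> Is ! l \<Longrightarrow> k = l"
    using assms unfolding cuts_def by blast
  assume "i < n"
  then have "i \<in> \<Union>(set Is)" using assms unfolding cuts_def by simp
  then show "\<exists>k<length Is. i \<in> Is ! k" by (auto simp: in_set_conv_nth)
qed

definition split_vector :: "'u list \<Rightarrow> nat set list \<Rightarrow> (nat \<Rightarrow> 'a) \<Rightarrow> nat \<Rightarrow> nat \<Rightarrow> 'a" where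
  "split_vector us Is x = (\<lambda>k \<in> {..<length Is}. \<lambda>j \<in> {..<length (nths us (Is ! k))}. x (pick (Is ! k) j))"

text \<open>
  Every index lies in exactly one of the sets, so a vector is determined by its parts and the parts can
  be prescribed.
\<close>

lemma split_vector_iso:
  fixes us :: "'d::finite grade list"
  assumes cuts: "cuts (length us) Is"
  shows "graded_iso (free us) (direct_sum (map (\<lambda>I. free (nths us I)) Is))
    (split_vector us Is :: (nat \<Rightarrow> ('d, 'k::field) mpoly) \<Rightarrow> _)"
proof -
  let ?s = "split_vector us Is :: (nat \<Rightarrow> ('d, 'k) mpoly) \<Rightarrow> _"
  let ?D = "direct_sum (map (\<lambda>I. free (nths us I)) Is) :: ('d, 'k, nat \<Rightarrow> nat \<Rightarrow> ('d, 'k) mpoly) pmodule"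
  note D = cutsD[OF cuts]
  have D_carrier: "y \<in> carrier ?D \<longleftrightarrow> y \<in> extensional {..<length Is} \<and>
      (\<forall>k<length Is. y k \<in> extensional {..<length (nths us (Is ! k))})" for y
    unfolding direct_sum_simps(1)[of "map (\<lambda>I. free (nths us I)) Is"] PiE_iff
    by (auto simp: free_simps simp del: direct_sum_simps)
  have pick_lt: "pick (Is ! k) j < length us" if "k < length Is" "j < length (nths us (Is ! k))" for k j
    using pick_in[OF D(1)[OF that(1)] that(2)] D(1)[OF that(1)] by auto
  have "graded_hom (free us) ?D ?s"
  proof (rule graded_homI)
    fix x :: "nat \<Rightarrow> ('d, 'k) mpoly" show "?s x \<in> carrier ?D" unfolding D_carrier by (simp add: split_vector_def)
  next
    fix x y :: "nat \<Rightarrow> ('d, 'k) mpoly" show "?s (x \<oplus>\<^bsub>free us\<^esub> y) = ?s x \<oplus>\<^bsub>?D\<^esub> ?s y"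
      unfolding direct_sum_simps(3)[of "map (\<lambda>I. free (nths us I)) Is"] free_simps(4) split_vector_def length_map
    proof (rule restrict_ext)
      fix k assume k: "k \<in> {..<length Is}"
      then show "(\<lambda>j\<in>{..<length (nths us (Is ! k))}. (\<lambda>i\<in>{..<length us}. x i + y i) (pick (Is ! k) j)) =
        (\<lambda>k\<in>{..<length Is}. \<lambda>j\<in>{..<length (nths us (Is ! k))}. x (pick (Is ! k) j)) k \<oplus>\<^bsub>map (\<lambda>I. free (nths us I)) Is ! k\<^esub>
        (\<lambda>k\<in>{..<length Is}. \<lambda>j\<in>{..<length (nths us (Is ! k))}. y (pick (Is ! k) j)) k"
        using pick_lt by (auto simp: free_simps(4) simp del: direct_sum_simps intro!: restrict_ext)
    qed
  next
    fix x :: "nat \<Rightarrow> ('d, 'k) mpoly" and p show "?s (p \<odot>\<^bsub>free us\<^esub> x) = p \<odot>\<^bsub>?D\<^esub> ?s x"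
      unfolding direct_sum_simps(4)[of "map (\<lambda>I. free (nths us I)) Is"] free_simps(5) split_vector_def length_map
    proof (rule restrict_ext)
      fix k assume k: "k \<in> {..<length Is}"
      then show "(\<lambda>j\<in>{..<length (nths us (Is ! k))}. (\<lambda>i\<in>{..<length us}. p * x i) (pick (Is ! k) j)) =
        p \<odot>\<^bsub>map (\<lambda>I. free (nths us I)) Is ! k\<^esub>
        (\<lambda>k\<in>{..<length Is}. \<lambda>j\<in>{..<length (nths us (Is ! k))}. x (pick (Is ! k) j)) k"
        using pick_lt by (auto simp: free_simps(5) simp del: direct_sum_simps intro!: restrict_ext)
    qed
  next
    fix x :: "nat \<Rightarrow> ('d, 'k) mpoly" and u assume x: "x \<in> component (free us) u"
    have "?s x k \<in> component (free (nths us (Is ! k))) u" if k: "k < length Is" for k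
      unfolding free_simps
    proof (intro conjI allI impI)
      fix j assume j: "j < length (nths us (Is ! k))"
      show "?s x k j \<in> homogeneous (u - nths us (Is ! k) ! j)"
        using x pick_lt[OF k j] nths_nth[OF D(1)[OF k] j] j k unfolding free_simps
        by (simp add: split_vector_def)
    qed (use k in \<open>simp add: split_vector_def\<close>)
    then show "?s x \<in> component ?D u"
      unfolding direct_sum_simps(5)[of "map (\<lambda>I. free (nths us I)) Is"] PiE_iff
      by (simp add: split_vector_def del: direct_sum_simps)
  qed
  moreover have "inj_on ?s (carrier (free us))"
  proof (rule inj_onI)
    fix x y :: "nat \<Rightarrow> ('d, 'k) mpoly"
    assume xy: "x \<in> carrier (free us)" "y \<in> carrier (free us)" "?s x = ?s y"
    show "x = y"
    proof (rule extensionalityI)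
      show "x \<in> extensional {..<length us}" "y \<in> extensional {..<length us}" using xy unfolding free_simps by auto
      fix i assume "i \<in> {..<length us}"
      then obtain k where k: "k < length Is" "i \<in> Is ! k" using D(2) by auto
      have "?s x k (pos (Is ! k) i) = ?s y k (pos (Is ! k) i)" using xy(3) by simp
      then show "x i = y i"
        using k pos_less[OF D(1)[OF k(1)] k(2)] pick_pos[OF k(2)] by (simp add: split_vector_def)
    qed
  qed
  moreover have "carrier ?D \<subseteq> ?s ` carrier (free us)"
  proof
    fix y assume "y \<in> carrier ?D"
    then have y: "y \<in> extensional {..<length Is}" "\<And>k. k < length Is \<Longrightarrow> y k \<in> extensional {..<length (nths us (Is ! k))}"
      unfolding D_carrier by auto
    define K where "K i = (SOME k. k < length Is \<and> i \<in> Is ! k)" for i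
    have K: "K i = k" if "k < length Is" "i \<in> Is ! k" for i k
      unfolding K_def by (rule some_equality) (use that D(3) in auto)
    define x where "x = (\<lambda>i\<in>{..<length us}. y (K i) (pos (Is ! K i) i))"
    have "y = ?s x"
    proof (rule extensionalityI[OF y(1)])
      show "?s x \<in> extensional {..<length Is}" by (simp add: split_vector_def)
      fix k assume "k \<in> {..<length Is}"
      then have k: "k < length Is" by simp
      show "y k = ?s x k"
      proof (rule extensionalityI[OF y(2)[OF k]])
        show "?s x k \<in> extensional {..<length (nths us (Is ! k))}" using k by (simp add: split_vector_def)
        fix j assume "j \<in> {..<length (nths us (Is ! k))}"
        then have j: "j < length (nths us (Is ! k))" by simp
        note p = pick_in[OF D(1)[OF k] j]
        show "y k j = ?s x k j"
          using k j pick_lt[OF k j] K[OF k p] pos_pick[OF D(1)[OF k] j] by (simp add: split_vector_def x_def)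
      qed
    qed
    moreover have "x \<in> carrier (free us)" unfolding free_simps by (simp add: x_def)
    ultimately show "y \<in> ?s ` carrier (free us)" by (rule image_eqI)
  qed
  moreover have "?s ` carrier (free us) \<subseteq> carrier ?D"
    by (rule image_subsetI) (unfold D_carrier, simp add: split_vector_def)
  ultimately show ?thesis unfolding graded_iso_def bij_betw_def by blast
qed

text \<open>
  Any list of grade lists is obtained by cutting up their concatenation; direct sums of free modules are
  therefore free, and matrices can be arranged along a diagonal.
\<close>

lemma concat_cuts:
  "\<exists>Is. length Is = length uss \<and> cuts (length (concat uss)) Is \<and> map (nths (concat uss)) Is = uss"
proof (induction uss)
  case Nil
  then show ?case by (simp add: cuts_def)
next
  case (Cons u uss)
  then obtain Is where Is: "length Is = length uss" "cuts (length (concat uss)) Is" "map (nths (concat uss)) Is = uss"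
    by blast
  note D = cutsD[OF Is(2)]
  let ?J = "{..<length u} # map ((`) ((+) (length u))) Is"
  have "cuts (length (concat (u # uss))) ?J"
    unfolding cuts_def
  proof (intro conjI allI impI)
    have "\<Union>(set ?J) = {..<length u} \<union> (+) (length u) ` \<Union>(set Is)" by auto
    also have "\<dots> = {..<length u} \<union> (+) (length u) ` {..<length (concat uss)}"
      using Is(2) by (simp add: cuts_def)
    also have "\<dots> = {..<length (concat (u # uss))}"
    proof (intro Set.set_eqI iffI)
      fix i assume i: "i \<in> {..<length (concat (u # uss))}"
      show "i \<in> {..<length u} \<union> (+) (length u) ` {..<length (concat uss)}"
      proof (cases "i < length u")
        case False
        then have "i = length u + (i - length u)" "i - length u < length (concat uss)" using i by auto
        then show ?thesis by blast
      qed simp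
    qed auto
    finally show "\<Union>(set ?J) = {..<length (concat (u # uss))}" .
    fix k l assume kl: "k < length ?J" "l < length ?J" "k \<noteq> l"
    show "?J ! k \<inter> ?J ! l = {}"
    proof (cases k; cases l)
      fix k' l' assume kl': "k = Suc k'" "l = Suc l'"
      then have "Is ! k' \<inter> Is ! l' = {}" using Is(2) kl unfolding cuts_def by simp
      then show ?thesis using kl kl' by auto
    qed (use kl in auto)
  qed
  moreover have "nths (u @ concat uss) ((+) (length u) ` I) = nths (concat uss) I" for I
  proof -
    have "nths u ((+) (length u) ` I) = nths u {}"
    proof -
      have "set (nths u ((+) (length u) ` I)) = {}" by (auto simp: set_nths)
      then show ?thesis by simp
    qed
    moreover have "{j. j + length u \<in> (+) (length u) ` I} = I" by (auto simp: add.commute)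
    ultimately show ?thesis by (simp add: nths_append)
  qed
  moreover have "nths (u @ concat uss) {..<length u} = u"
    by (simp add: nths_append nths_all)
  ultimately show ?case using Is(1,3) by (intro exI[of _ ?J]) (simp add: o_def)
qed

lemma direct_sum_free: "\<exists>us. isomorphic_modules (free us) (direct_sum (map free uss))"
proof -
  obtain Is where Is: "length Is = length uss" "cuts (length (concat uss)) Is" "map (nths (concat uss)) Is = uss"
    using concat_cuts by blast
  have "map (\<lambda>I. free (nths (concat uss) I)) Is = map free uss"
    by (subst Is(3)[symmetric]) (simp add: o_def)
  then show ?thesis using split_vector_iso[OF Is(2)] unfolding isomorphic_modules_def by metis
qed

lemma free_graded_direct_sum:
  fixes Ms :: "('d::finite, 'k::field, 'm) pmodule list"
  assumes "\<forall>M\<in>set Ms. free_graded M" shows "free_graded (direct_sum Ms)"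
proof -
  have G: "graded_mods Ms" using assms by (simp add: graded_mods_def free_graded_def)
  have "\<forall>M\<in>set Ms. \<exists>us. isomorphic_modules M (free us)" using assms by (simp add: free_graded_def)
  then obtain w where w: "\<forall>M\<in>set Ms. isomorphic_modules M (free (w M))" by metis
  then have "list_all2 isomorphic_modules Ms (map free (map w Ms))"
    by (simp add: list_all2_conv_all_nth del: direct_sum_simps)
  note iso1 = isomorphic_direct_sum[OF this]
  let ?D = "direct_sum (map free (map w Ms)) :: ('d, 'k, nat \<Rightarrow> nat \<Rightarrow> ('d, 'k) mpoly) pmodule"
  obtain us where us: "isomorphic_modules (free us) ?D"
    using direct_sum_free[of "map w Ms"] by (rule exE)
  have gr: "is_graded_module ?D"
    by (rule graded_mods.direct_sum_graded) (simp add: graded_mods_def free_is_graded)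
  show ?thesis unfolding free_graded_def
    using isomorphic_modules_trans[OF iso1 isomorphic_modules_sym[OF free_is_graded gr us]]
    by (intro conjI exI graded_mods.direct_sum_graded[OF G])
qed

text \<open>
  In contrast to \<^const>\<open>block_diagonal\<close> this admits empty blocks; these belong to the trivial summands of
  a morphism.
\<close>

definition diagonal_along :: "('d::finite, 'k::field) gmatrix \<Rightarrow> index_block list \<Rightarrow> bool" where
  "diagonal_along A Bs \<longleftrightarrow> cuts (length (row_grades A)) (map fst Bs) \<and> cuts (length (col_grades A)) (map snd Bs) \<and>
    (\<forall>i < length (row_grades A). \<forall>j < length (col_grades A).
        entries A $$ (i, j) \<noteq> 0 \<longrightarrow> (\<exists>B \<in> set Bs. i \<in> fst B \<and> j \<in> snd B))"

lemma diagonal_alongI: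
  assumes "block_diagonal A (set Bs)" "distinct Bs" shows "diagonal_along A Bs"
proof -
  have "disjnt (fst (Bs ! k)) (fst (Bs ! l)) \<and> disjnt (snd (Bs ! k)) (snd (Bs ! l))"
    if "k < length Bs" "l < length Bs" "k \<noteq> l" for k l
    using assms that unfolding block_diagonal_def pairwise_def
    by (metis nth_eq_iff_index_eq nth_mem)
  then show ?thesis
    using assms(1) by (auto simp: cuts_def block_diagonal_def disjnt_def diagonal_along_def)
qed

abbreviation nonempty :: "index_block \<Rightarrow> bool" where "nonempty B \<equiv> fst B \<noteq> {} \<or> snd B \<noteq> {}"

lemma diagonal_alongD:
  assumes "diagonal_along A Bs"
  shows "distinct (filter nonempty Bs)" "block_diagonal A (set (filter nonempty Bs))"
proof -
  have disj: "fst (Bs ! k) \<inter> fst (Bs ! l) = {} \<and> snd (Bs ! k) \<inter> snd (Bs ! l) = {}"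
    if "k < length Bs" "l < length Bs" "k \<noteq> l" for k l
    using assms that by (simp add: diagonal_along_def cuts_def)
  have sep: "fst B \<inter> fst B' = {} \<and> snd B \<inter> snd B' = {}" if BB: "B \<in> set Bs" "B' \<in> set Bs" "B \<noteq> B'" for B B'
  proof -
    obtain k l where "k < length Bs" "l < length Bs" "B = Bs ! k" "B' = Bs ! l"
      using BB by (auto simp: in_set_conv_nth)
    then show ?thesis using disj BB(3) by metis
  qed
  have "distinct (filter nonempty Bs)" if "\<And>k l. k < length Bs \<Longrightarrow> l < length Bs \<Longrightarrow> k \<noteq> l \<Longrightarrow>
    fst (Bs ! k) \<inter> fst (Bs ! l) = {} \<and> snd (Bs ! k) \<inter> snd (Bs ! l) = {}" for Bs :: "index_block list"
    using that
  proof (induction Bs)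
    case (Cons B Bs)
    have "distinct (filter nonempty Bs)"
    proof (rule Cons(1))
      fix k l assume "k < length Bs" "l < length Bs" "k \<noteq> l"
      then show "fst (Bs ! k) \<inter> fst (Bs ! l) = {} \<and> snd (Bs ! k) \<inter> snd (Bs ! l) = {}"
        using Cons(2)[of "Suc k" "Suc l"] by simp
    qed
    moreover have "B \<notin> set Bs" if "nonempty B"
    proof
      assume "B \<in> set Bs"
      then obtain k where "k < length Bs" "Bs ! k = B" by (auto simp: in_set_conv_nth)
      then show False using Cons(2)[of 0 "Suc k"] that by simp
    qed
    ultimately show ?case by simp
  qed simp
  from this[OF disj] show "distinct (filter nonempty Bs)" .
  have un: "(\<Union>B\<in>set Bs. fst B) = {..<length (row_grades A)}" "(\<Union>B\<in>set Bs. snd B) = {..<length (col_grades A)}"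
    using assms by (simp_all add: diagonal_along_def cuts_def)
  show "block_diagonal A (set (filter nonempty Bs))"
    unfolding block_diagonal_def
  proof (intro conjI allI impI ballI)
    show "(\<Union>B\<in>set (filter nonempty Bs). fst B) = {..<length (row_grades A)}" unfolding un(1)[symmetric] by auto
    show "(\<Union>B\<in>set (filter nonempty Bs). snd B) = {..<length (col_grades A)}" unfolding un(2)[symmetric] by auto
    show "pairwise (\<lambda>B B'. disjnt (fst B) (fst B') \<and> disjnt (snd B) (snd B')) (set (filter nonempty Bs))"
      by (rule pairwiseI) (use sep in \<open>simp add: disjnt_def\<close>)
  next
    fix i j assume ij: "i < length (row_grades A)" "j < length (col_grades A)" "entries A $$ (i, j) \<noteq> 0"
    then obtain B where "B \<in> set Bs" "i \<in> fst B" "j \<in> snd B" using assms unfolding diagonal_along_def by blast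
    then show "\<exists>B\<in>set (filter nonempty Bs). i \<in> fst B \<and> j \<in> snd B" by (intro bexI[of _ B]) auto
  qed auto
qed

lemma restrict_block_entries:
  assumes A: "is_gmatrix A" and B: "fst B \<subseteq> {..<length (row_grades A)}" "snd B \<subseteq> {..<length (col_grades A)}"
  shows "dim_row (entries (restrict_block A B)) = length (nths (row_grades A) (fst B))"
    "dim_col (entries (restrict_block A B)) = length (nths (col_grades A) (snd B))"
    "i < length (nths (row_grades A) (fst B)) \<Longrightarrow> j < length (nths (col_grades A) (snd B)) \<Longrightarrow>
      entries (restrict_block A B) $$ (i, j) = entries A $$ (pick (fst B) i, pick (snd B) j)"
  using is_gmatrixD(2,3)[OF A]
  by (simp_all add: restrict_block_def dim_submatrix submatrix_index length_nths)

lemma restrict_block_gmatrix: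
  assumes A: "is_gmatrix A" and B: "fst B \<subseteq> {..<length (row_grades A)}" "snd B \<subseteq> {..<length (col_grades A)}"
  shows "is_gmatrix (restrict_block A B)"
proof -
  note R = restrict_block_entries[OF A B]
  have g: "row_grades (restrict_block A B) = nths (row_grades A) (fst B)"
    "col_grades (restrict_block A B) = nths (col_grades A) (snd B)" by (simp_all add: restrict_block_def)
  show ?thesis unfolding is_gmatrix_def g
  proof (intro conjI allI impI)
    fix i j assume ij: "i < length (nths (row_grades A) (fst B))" "j < length (nths (col_grades A) (snd B))"
    have "pick (fst B) i < length (row_grades A)" "pick (snd B) j < length (col_grades A)"
      using pick_in[OF B(1) ij(1)] pick_in[OF B(2) ij(2)] B by auto
    from is_gmatrixD(4)[OF A this]
    show "entries (restrict_block A B) $$ (i, j) \<in> homogeneous (nths (col_grades A) (snd B) ! j - nths (row_grades A) (fst B) ! i)"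
      by (simp add: R(3)[OF ij] nths_nth[OF B(1) ij(1)] nths_nth[OF B(2) ij(2)])
  qed (use R in auto)
qed

text \<open>
  Cutting the vectors at the blocks identifies the free modules of the matrix with direct sums. The
  \<open>k\<close>-th part of a product only involves the \<open>k\<close>-th part of the vector since the other entries in these
  rows vanish.
\<close>

theorem block_diagonal_morphism:
  fixes A :: "('d::finite, 'k::field) gmatrix"
  assumes A: "is_gmatrix A" and bd: "diagonal_along A Bs"
  shows "isomorphic_morphisms (matrix_mor A) (direct_sum_morphism (map (\<lambda>B. matrix_mor (restrict_block A B)) Bs))"
proof -
  have rows: "cuts (length (row_grades A)) (map fst Bs)" and cols: "cuts (length (col_grades A)) (map snd Bs)"
    using bd by (simp_all add: diagonal_along_def)
  have sub: "fst (Bs ! k) \<subseteq> {..<length (row_grades A)}" "snd (Bs ! k) \<subseteq> {..<length (col_grades A)}"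
    if "k < length Bs" for k
    using cutsD(1)[OF rows, of k] cutsD(1)[OF cols, of k] that by simp_all
  let ?f = "direct_sum_morphism (map (\<lambda>B. matrix_mor (restrict_block A B)) Bs)"
  have src: "src ?f = direct_sum (map (\<lambda>I. free (nths (col_grades A) I)) (map snd Bs))"
    and tgt: "tgt ?f = direct_sum (map (\<lambda>I. free (nths (row_grades A) I)) (map fst Bs))"
    by (simp_all add: direct_sum_morphism_def o_def restrict_block_def del: direct_sum_simps)
  let ?g = "split_vector (col_grades A) (map snd Bs)" and ?h = "split_vector (row_grades A) (map fst Bs)"
  show ?thesis
  proof (rule isomorphic_morphismsI)
    show "graded_iso (src (matrix_mor A)) (src ?f) ?g"
      unfolding src matrix_mor_simps by (rule split_vector_iso[OF cols])
    show "graded_iso (tgt (matrix_mor A)) (tgt ?f) ?h"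
      unfolding tgt matrix_mor_simps by (rule split_vector_iso[OF rows])
    fix x :: "nat \<Rightarrow> ('d, 'k) mpoly"
    have eq: "(\<Sum>j<length (col_grades A). entries A $$ (pick (fst (Bs ! k)) i, j) * x j) =
      (\<Sum>j<length (nths (col_grades A) (snd (Bs ! k))). entries (restrict_block A (Bs ! k)) $$ (i, j) * x (pick (snd (Bs ! k)) j))"
      if k: "k < length Bs" and i: "i < length (nths (row_grades A) (fst (Bs ! k)))" for k i
    proof -
      let ?R = "fst (Bs ! k)" and ?C = "snd (Bs ! k)"
      note p = pick_in[OF sub(1)[OF k] i]
      have 0: "entries A $$ (pick ?R i, j) = 0" if j: "j < length (col_grades A)" "j \<notin> ?C" for j
      proof (rule ccontr)
        assume "entries A $$ (pick ?R i, j) \<noteq> 0"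
        moreover have "pick ?R i < length (row_grades A)" using p sub(1)[OF k] by auto
        ultimately obtain B where B: "B \<in> set Bs" "pick ?R i \<in> fst B" "j \<in> snd B"
          using bd j(1) unfolding diagonal_along_def by blast
        then obtain l where l: "l < length Bs" "B = Bs ! l" by (auto simp: in_set_conv_nth)
        have "l = k" using cutsD(3)[OF rows, of l k "pick ?R i"] l k p B by simp
        then show False using B l j(2) by simp
      qed
      have "bij_betw (pick ?C) {..<length (nths (col_grades A) ?C)} ?C"
        by (rule bij_betw_byWitness[where f'="pos ?C"])
          (use pick_in[OF sub(2)[OF k]] pos_pick[OF sub(2)[OF k]] pick_pos pos_less[OF sub(2)[OF k]] in auto)
      then have "(\<Sum>j<length (nths (col_grades A) ?C). entries A $$ (pick ?R i, pick ?C j) * x (pick ?C j)) =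
          (\<Sum>j\<in>?C. entries A $$ (pick ?R i, j) * x j)"
        by (rule sum.reindex_bij_betw)
      also have "\<dots> = (\<Sum>j<length (col_grades A). entries A $$ (pick ?R i, j) * x j)"
        by (rule sum.mono_neutral_left) (use sub(2)[OF k] 0 in auto)
      finally show ?thesis
        using restrict_block_entries(3)[OF A sub[OF k] i] by simp
    qed
    show "?h (app (matrix_mor A) x) = app ?f (?g x)"
      unfolding matrix_mor_simps
    proof (rule extensionalityI[of _ "{..<length Bs}"])
      show "?h (mat_map (entries A) x) \<in> extensional {..<length Bs}"
        "app ?f (?g x) \<in> extensional {..<length Bs}"
        by (simp_all add: split_vector_def direct_sum_morphism_def)
      fix k assume "k \<in> {..<length Bs}"
      then have k: "k < length Bs" by simp
      note R = restrict_block_entries(1,2)[OF A sub[OF k]]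
      have lhs: "?h (mat_map (entries A) x) k =
        (\<lambda>i\<in>{..<length (nths (row_grades A) (fst (Bs ! k)))}. mat_map (entries A) x (pick (fst (Bs ! k)) i))"
        using k by (simp add: split_vector_def)
      have rhs: "app ?f (?g x) k = mat_map (entries (restrict_block A (Bs ! k)))
        (\<lambda>j\<in>{..<length (nths (col_grades A) (snd (Bs ! k)))}. x (pick (snd (Bs ! k)) j))"
        using k by (simp add: direct_sum_morphism_def split_vector_def)
      show "?h (mat_map (entries A) x) k = app ?f (?g x) k"
        unfolding lhs rhs mat_map_def[of "entries (restrict_block A (Bs ! k))"] R
      proof (rule restrict_ext)
        fix i assume "i \<in> {..<length (nths (row_grades A) (fst (Bs ! k)))}"
        then have i: "i < length (nths (row_grades A) (fst (Bs ! k)))" by simp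
        have "pick (fst (Bs ! k)) i < length (row_grades A)" using pick_in[OF sub(1)[OF k] i] sub(1)[OF k] by auto
        then show "mat_map (entries A) x (pick (fst (Bs ! k)) i) =
          (\<Sum>j<length (nths (col_grades A) (snd (Bs ! k))). entries (restrict_block A (Bs ! k)) $$ (i, j) *
            (\<lambda>j\<in>{..<length (nths (col_grades A) (snd (Bs ! k)))}. x (pick (snd (Bs ! k)) j)) j)"
          using eq[OF k i] is_gmatrixD(2,3)[OF A] by (simp add: mat_map_def)
      qed
    qed
  qed
qed

text \<open>
  The blocks are the pieces of the concatenated row and column grades, and an entry belongs to the unique
  block, if any, that contains both its indices.
\<close>

theorem block_diagonal_exists:
  fixes As :: "('d::finite, 'k::field) gmatrix list"
  assumes gm: "\<forall>A\<in>set As. is_gmatrix A"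
  obtains A Bs where "is_gmatrix A" "diagonal_along A Bs" "map (restrict_block A) Bs = As"
proof -
  define us vs where "us = concat (map row_grades As)" and "vs = concat (map col_grades As)"
  obtain Rs where Rs: "length Rs = length As" "cuts (length us) Rs" "map (nths us) Rs = map row_grades As"
    using concat_cuts[of "map row_grades As"] unfolding us_def by auto
  obtain Cs where Cs: "length Cs = length As" "cuts (length vs) Cs" "map (nths vs) Cs = map col_grades As"
    using concat_cuts[of "map col_grades As"] unfolding vs_def by auto
  note DR = cutsD[OF Rs(2)] and DC = cutsD[OF Cs(2)]
  have R: "nths us (Rs ! k) = row_grades (As ! k)" and C: "nths vs (Cs ! k) = col_grades (As ! k)"
    if "k < length As" for k
    using arg_cong[OF Rs(3), of "\<lambda>l. l ! k"] arg_cong[OF Cs(3), of "\<lambda>l. l ! k"] that Rs(1) Cs(1) by simp_all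
  define K where "K i j = (SOME k. k < length As \<and> i \<in> Rs ! k \<and> j \<in> Cs ! k)" for i j
  have K: "K i j = k" if "k < length As" "i \<in> Rs ! k" "j \<in> Cs ! k" for i j k
    unfolding K_def by (rule some_equality) (use that DR(3) Rs(1) in auto)
  define E where "E = mat (length us) (length vs) (\<lambda>(i, j).
    if \<exists>k<length As. i \<in> Rs ! k \<and> j \<in> Cs ! k
    then entries (As ! K i j) $$ (pos (Rs ! K i j) i, pos (Cs ! K i j) j) else 0)"
  define A where "A = \<lparr>row_grades = us, col_grades = vs, entries = E\<rparr>"
  have E: "E $$ (i, j) = entries (As ! k) $$ (pos (Rs ! k) i, pos (Cs ! k) j)"
    if "i < length us" "j < length vs" "k < length As" "i \<in> Rs ! k" "j \<in> Cs ! k" for i j k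
    using that K[OF that(3-5)] by (auto simp: E_def)
  have gA: "is_gmatrix A" unfolding is_gmatrix_def A_def gmatrix.simps
  proof (intro conjI allI impI)
    fix i j assume ij: "i < length us" "j < length vs"
    show "E $$ (i, j) \<in> homogeneous (vs ! j - us ! i)"
    proof (cases "\<exists>k<length As. i \<in> Rs ! k \<and> j \<in> Cs ! k")
      case True
      then obtain k where k: "k < length As" "i \<in> Rs ! k" "j \<in> Cs ! k" by blast
      have sub: "Rs ! k \<subseteq> {..<length us}" "Cs ! k \<subseteq> {..<length vs}" using DR(1) DC(1) k(1) Rs(1) Cs(1) by auto
      note p = pos_less[OF sub(1) k(2)] pos_less[OF sub(2) k(3)]
      have "us ! i = row_grades (As ! k) ! pos (Rs ! k) i" "vs ! j = col_grades (As ! k) ! pos (Cs ! k) j"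
        using nths_nth[OF sub(1) p(1)] nths_nth[OF sub(2) p(2)] pick_pos[OF k(2)] pick_pos[OF k(3)]
        by (simp_all add: R[OF k(1)] C[OF k(1)])
      moreover have "is_gmatrix (As ! k)" using gm k(1) by simp
      ultimately show ?thesis
        using is_gmatrixD(4)[of "As ! k" "pos (Rs ! k) i" "pos (Cs ! k) j"] p E[OF ij k]
        by (simp add: R[OF k(1)] C[OF k(1)])
    next
      case False
      show ?thesis unfolding E_def index_mat(1)[OF ij] prod.case if_not_P[OF False] by (rule homogeneous_zero)
    qed
  qed (simp add: E_def)
  define Bs where "Bs = zip Rs Cs"
  have Bs: "length Bs = length As" "\<And>k. k < length As \<Longrightarrow> Bs ! k = (Rs ! k, Cs ! k)"
    using Rs(1) Cs(1) by (simp_all add: Bs_def)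
  have "diagonal_along A Bs"
    unfolding diagonal_along_def
  proof (intro conjI allI impI)
    show "cuts (length (row_grades A)) (map fst Bs)" "cuts (length (col_grades A)) (map snd Bs)"
      using Rs(1,2) Cs(1,2) by (simp_all add: Bs_def A_def)
    fix i j assume "i < length (row_grades A)" "j < length (col_grades A)" "entries A $$ (i, j) \<noteq> 0"
    then have "i < length us" "j < length vs" "E $$ (i, j) \<noteq> 0" by (simp_all add: A_def)
    then obtain k where k: "k < length As" "i \<in> Rs ! k" "j \<in> Cs ! k" by (auto simp: E_def split: if_splits)
    then have "Bs ! k \<in> set Bs" using Bs(1) by simp
    then show "\<exists>B\<in>set Bs. i \<in> fst B \<and> j \<in> snd B" using k Bs(2)[OF k(1)] by (intro bexI[of _ "Bs ! k"]) simp_all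
  qed
  moreover have "restrict_block A (Bs ! k) = As ! k" if k: "k < length As" for k
  proof -
    have sub: "Rs ! k \<subseteq> {..<length us}" "Cs ! k \<subseteq> {..<length vs}" using DR(1) DC(1) k Rs(1) Cs(1) by auto
    have sub': "fst (Bs ! k) \<subseteq> {..<length (row_grades A)}" "snd (Bs ! k) \<subseteq> {..<length (col_grades A)}"
      using sub by (simp_all add: A_def Bs(2)[OF k])
    note RE = restrict_block_entries[OF gA sub', unfolded A_def gmatrix.simps Bs(2)[OF k] fst_conv snd_conv, folded A_def]
    have gk: "is_gmatrix (As ! k)" using gm k by simp
    have "entries (restrict_block A (Rs ! k, Cs ! k)) = entries (As ! k)"
    proof (rule eq_matI)
      fix i j assume ij: "i < dim_row (entries (As ! k))" "j < dim_col (entries (As ! k))"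
      then have ij': "i < length (nths us (Rs ! k))" "j < length (nths vs (Cs ! k))"
        using is_gmatrixD(2,3)[OF gk] by (simp_all add: R[OF k] C[OF k])
      note p = pick_in[OF sub(1) ij'(1)] pick_in[OF sub(2) ij'(2)]
      have "entries (restrict_block A (Rs ! k, Cs ! k)) $$ (i, j) = E $$ (pick (Rs ! k) i, pick (Cs ! k) j)"
        using RE(3)[OF ij'] by (simp add: A_def)
      also have "\<dots> = entries (As ! k) $$ (i, j)"
        using E[OF _ _ k p] p sub pos_pick[OF sub(1) ij'(1)] pos_pick[OF sub(2) ij'(2)] by auto
      finally show "entries (restrict_block A (Rs ! k, Cs ! k)) $$ (i, j) = entries (As ! k) $$ (i, j)" .
    qed (use RE is_gmatrixD(2,3)[OF gk] in \<open>simp_all add: R[OF k] C[OF k]\<close>)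
    moreover have "row_grades (restrict_block A (Rs ! k, Cs ! k)) = row_grades (As ! k)"
      "col_grades (restrict_block A (Rs ! k, Cs ! k)) = col_grades (As ! k)"
      using R[OF k] C[OF k] by (simp_all add: restrict_block_def A_def)
    ultimately show ?thesis unfolding Bs(2)[OF k] by simp
  qed
  then have "map (restrict_block A) Bs = As" using Bs(1) by (intro nth_equalityI) auto
  ultimately show ?thesis using that gA by blast
qed

section \<open>Minimal presentations\<close>

text \<open>
  The properties of the first map of a minimal free resolution. The image condition says that the target
  is a minimal cover of the cokernel, the kernel condition that the source is one of the image.
\<close>

definition minimal_mor :: "('d::finite, 'k::field, 'm, 'n) gmorphism \<Rightarrow> bool" where
  "minimal_mor f \<longleftrightarrow> free_graded (src f) \<and> free_graded (tgt f) \<and> graded_hom (src f) (tgt f) (app f) \<and>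
     app f ` carrier (src f) \<subseteq> max_ideal_times (tgt f) \<and>
     mor_kernel (src f) (tgt f) (app f) \<subseteq> max_ideal_times (src f)"

lemma minimal_morD:
  assumes "minimal_mor f"
  shows "free_graded (src f)" "free_graded (tgt f)" "graded_hom (src f) (tgt f) (app f)"
    "is_graded_module (src f)" "is_graded_module (tgt f)" "graded_homo (src f) (tgt f) (app f)"
    "app f ` carrier (src f) \<subseteq> max_ideal_times (tgt f)"
    "mor_kernel (src f) (tgt f) (app f) \<subseteq> max_ideal_times (src f)"
  using assms by (auto simp: minimal_mor_def free_graded_is_graded intro!: graded_homoI)

lemma minimal_presentation_mapD:
  assumes "minimal_presentation_map f H" shows "minimal_mor f" "presents f H"
proof -
  obtain F \<delta> \<epsilon> where res: "graded_free_resolution F \<delta> \<epsilon> H"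
    and min: "\<And>k. \<delta> k ` carrier (F (Suc k)) \<subseteq> max_ideal_times (F k)"
    and f: "f = \<lparr>src = F 1, tgt = F 0, app = \<delta> 0\<rparr>"
    using assms unfolding minimal_presentation_map_def minimal_graded_free_resolution_def by blast
  have free: "free_graded (F k)" and hom: "graded_hom (F (Suc k)) (F k) (\<delta> k)"
    and ker: "mor_kernel (F (Suc k)) (F k) (\<delta> k) = \<delta> (Suc k) ` carrier (F (Suc (Suc k)))" for k
    using res by (simp_all add: graded_free_resolution_def)
  have eps: "graded_hom (F 0) H \<epsilon>" "\<epsilon> ` carrier (F 0) = carrier H" "mor_kernel (F 0) H \<epsilon> = \<delta> 0 ` carrier (F 1)"
    using res by (simp_all add: graded_free_resolution_def)
  show "minimal_mor f"
    using free hom[of 0] min[of 0] min[of 1] ker[of 0] by (simp add: minimal_mor_def f)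
  show "presents f H"
    unfolding presents_def f gmorphism.simps using free hom[of 0] eps by auto
qed

lemma gmorphismD:
  assumes "is_gmorphism f"
  shows "is_graded_module (src f)" "is_graded_module (tgt f)" "graded_hom (src f) (tgt f) (app f)"
    "graded_homo (src f) (tgt f) (app f)" "finitely_generated (src f)" "finitely_generated (tgt f)"
  using assms by (auto simp: is_gmorphism_def persistence_module_def intro!: graded_homoI)

lemma minimal_mor_gmorphism: "minimal_mor f \<Longrightarrow> is_gmorphism f"
  using minimal_morD[of f] free_graded_finitely_generated[of "src f"] free_graded_finitely_generated[of "tgt f"]
  by (simp add: is_gmorphism_def persistence_module_def)

lemma free_graded_iso:
  assumes "free_graded P" "is_graded_module Q" "isomorphic_modules P Q" shows "free_graded Q"
proof -
  obtain us where us: "isomorphic_modules P (free us)" using assms(1) unfolding free_graded_def by (elim conjE exE)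
  have "isomorphic_modules Q (free us)"
    by (rule isomorphic_modules_trans[OF isomorphic_modules_sym[OF free_graded_is_graded[OF assms(1)] assms(2,3)] us])
  then show ?thesis unfolding free_graded_def using assms(2) by blast
qed

lemma isomorphic_if_graded_iso: "graded_iso M N \<phi> \<Longrightarrow> isomorphic_modules M N"
  unfolding isomorphic_modules_def by (rule exI)

lemma graded_iso_hom: "graded_iso M N \<phi> \<Longrightarrow> graded_hom M N \<phi>"
  and graded_iso_inj: "graded_iso M N \<phi> \<Longrightarrow> inj_on \<phi> (carrier M)"
  and graded_iso_image: "graded_iso M N \<phi> \<Longrightarrow> \<phi> ` carrier M = carrier N"
  by (simp_all add: graded_iso_def bij_betw_def)

lemma graded_iso_zero_iff:
  assumes "is_graded_module M" "is_graded_module N" "graded_iso M N \<phi>" "x \<in> carrier M"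
  shows "\<phi> x = \<zero>\<^bsub>N\<^esub> \<longleftrightarrow> x = \<zero>\<^bsub>M\<^esub>"
proof -
  interpret graded_homo M N \<phi> by (rule graded_homoI[OF assms(1,2) graded_iso_hom[OF assms(3)]])
  show ?thesis
    using inj_onD[OF graded_iso_inj[OF assms(3)], of x "\<zero>\<^bsub>M\<^esub>"] assms(4) by auto
qed

text \<open>
  The isomorphisms between the sources and between the targets carry kernels, images and multiples of
  the maximal ideal over.
\<close>

lemma isomorphic_morphisms_transfer:
  assumes f: "free_graded (src f)" "free_graded (tgt f)" "graded_hom (src f) (tgt f) (app f)"
    and f': "is_graded_module (src f')" "is_graded_module (tgt f')" "graded_hom (src f') (tgt f') (app f')"
    and iso: "isomorphic_morphisms f f'"
  shows "minimal_mor f \<Longrightarrow> minimal_mor f'" "presents f M \<Longrightarrow> presents f' M"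
proof -
  obtain g h where gh: "graded_iso (src f) (src f') g" "graded_iso (tgt f) (tgt f') h"
    "\<forall>x\<in>carrier (src f). h (app f x) = app f' (g x)" by (rule isomorphic_morphismsE[OF iso])
  note gf = free_graded_is_graded[OF f(1)] free_graded_is_graded[OF f(2)]
  interpret f: graded_homo "src f" "tgt f" "app f" by (rule graded_homoI[OF gf f(3)])
  interpret f': graded_homo "src f'" "tgt f'" "app f'" by (rule graded_homoI[OF f'])
  interpret g: graded_homo "src f" "src f'" g by (rule graded_homoI[OF gf(1) f'(1) graded_iso_hom[OF gh(1)]])
  interpret h: graded_homo "tgt f" "tgt f'" h by (rule graded_homoI[OF gf(2) f'(2) graded_iso_hom[OF gh(2)]])
  have free: "free_graded (src f')" "free_graded (tgt f')"
    using free_graded_iso[OF f(1) f'(1) isomorphic_if_graded_iso[OF gh(1)]]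
      free_graded_iso[OF f(2) f'(2) isomorphic_if_graded_iso[OF gh(2)]] by auto
  have g_surj: "\<exists>x\<in>carrier (src f). y = g x" if "y \<in> carrier (src f')" for y
    using that unfolding graded_iso_image[OF gh(1), symmetric] by blast
  {
    assume min: "minimal_mor f"
    have "app f' y \<in> max_ideal_times (tgt f')" if y: "y \<in> carrier (src f')" for y
    proof -
      obtain x where x: "x \<in> carrier (src f)" "y = g x" using g_surj[OF y] by blast
      have "app f x \<in> max_ideal_times (tgt f)" using min x(1) unfolding minimal_mor_def by blast
      from h.max_ideal_times[OF this] show ?thesis using gh(3) x by simp
    qed
    moreover have "y \<in> max_ideal_times (src f')" if y: "y \<in> mor_kernel (src f') (tgt f') (app f')" for y
    proof -
      obtain x where x: "x \<in> carrier (src f)" "y = g x" using g_surj[OF f'.kernel_closed[OF y]] by blast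
      have "h (app f x) = \<zero>\<^bsub>tgt f'\<^esub>" using gh(3) x y by (simp add: mor_kernel_def)
      then have "app f x = \<zero>\<^bsub>tgt f\<^esub>"
        using graded_iso_zero_iff[OF gf(2) f'(2) gh(2)] x(1) by simp
      then have "x \<in> max_ideal_times (src f)" using min x(1) by (auto simp: minimal_mor_def mor_kernel_def)
      then show ?thesis using g.max_ideal_times x(2) by simp
    qed
    ultimately show "minimal_mor f'"
      unfolding minimal_mor_def using free f'(3) by blast
  next
    assume pres: "presents f M"
    then obtain p where p: "graded_hom (tgt f) M p" "p ` carrier (tgt f) = carrier M"
      "mor_kernel (tgt f) M p = app f ` carrier (src f)" unfolding presents_def by blast
    obtain h' where h': "graded_iso (tgt f') (tgt f) h'" "\<forall>x\<in>carrier (tgt f). h' (h x) = x"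
        "\<forall>y\<in>carrier (tgt f'). h (h' y) = y"
      by (rule graded_iso_inverse[OF gf(2) f'(2) gh(2)])
    note h'c = graded_iso_closed[OF h'(1)]
    have "(\<lambda>y. p (h' y)) ` carrier (tgt f') = p ` (h' ` carrier (tgt f'))" by (simp add: image_image)
    then have surj: "(\<lambda>y. p (h' y)) ` carrier (tgt f') = carrier M"
      using graded_iso_image[OF h'(1)] p(2) by simp
    have ker: "y \<in> mor_kernel (tgt f') M (\<lambda>y. p (h' y)) \<longleftrightarrow> y \<in> app f' ` carrier (src f')" for y
    proof
      assume y: "y \<in> mor_kernel (tgt f') M (\<lambda>y. p (h' y))"
      then have yc: "y \<in> carrier (tgt f')" by (simp add: mor_kernel_def)
      then have "h' y \<in> mor_kernel (tgt f) M p" using y h'c by (simp add: mor_kernel_def)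
      then obtain x where x: "x \<in> carrier (src f)" "h' y = app f x" unfolding p(3) by blast
      have "y = app f' (g x)" using h'(3) yc gh(3) x by force
      then show "y \<in> app f' ` carrier (src f')" using g.closed[OF x(1)] by blast
    next
      assume "y \<in> app f' ` carrier (src f')"
      then obtain z where z: "z \<in> carrier (src f')" "y = app f' z" by blast
      obtain x where x: "x \<in> carrier (src f)" "z = g x" using g_surj[OF z(1)] by blast
      have "h' y = app f x" using h'(2) gh(3) x z by force
      then have "h' y \<in> mor_kernel (tgt f) M p" unfolding p(3) using x(1) by blast
      then show "y \<in> mor_kernel (tgt f') M (\<lambda>y. p (h' y))" using z by (simp add: mor_kernel_def)
    qed
    have "mor_kernel (tgt f') M (\<lambda>y. p (h' y)) = app f' ` carrier (src f')" using ker by (rule Set.set_eqI)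
    then have "\<exists>p. graded_hom (tgt f') M p \<and> p ` carrier (tgt f') = carrier M \<and> mor_kernel (tgt f') M p = app f' ` carrier (src f')"
      using surj graded_hom_comp[OF graded_iso_hom[OF h'(1)] p(1)] by (rule_tac exI[of _ "\<lambda>y. p (h' y)"]) simp
    then show "presents f' M" unfolding presents_def using free f'(3) by simp
  }
qed

lemma presents_isomorphic_module:
  assumes "presents f M" "is_graded_module M" "is_graded_module M'" "isomorphic_modules M M'"
  shows "presents f M'"
proof -
  obtain \<theta> where \<theta>: "graded_iso M M' \<theta>" using assms(4) unfolding isomorphic_modules_def by blast
  from assms(1) obtain p where p: "graded_hom (tgt f) M p" "p ` carrier (tgt f) = carrier M"
    "mor_kernel (tgt f) M p = app f ` carrier (src f)" unfolding presents_def by blast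
  have c: "p x \<in> carrier M" if "x \<in> carrier (tgt f)" for x using p(2) that by blast
  have "(\<lambda>x. \<theta> (p x)) ` carrier (tgt f) = \<theta> ` (p ` carrier (tgt f))" by (simp add: image_image)
  then have "(\<lambda>x. \<theta> (p x)) ` carrier (tgt f) = carrier M'" using p(2) graded_iso_image[OF \<theta>] by simp
  moreover have "mor_kernel (tgt f) M' (\<lambda>x. \<theta> (p x)) = mor_kernel (tgt f) M p"
    using graded_iso_zero_iff[OF assms(2,3) \<theta> c] by (auto simp: mor_kernel_def)
  ultimately have "\<exists>p. graded_hom (tgt f) M' p \<and> p ` carrier (tgt f) = carrier M' \<and>
      mor_kernel (tgt f) M' p = app f ` carrier (src f)"
    using p(3) graded_hom_comp[OF p(1) graded_iso_hom[OF \<theta>]] by (rule_tac exI[of _ "\<lambda>x. \<theta> (p x)"]) simp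
  then show ?thesis using assms(1) unfolding presents_def by simp
qed

text \<open>
  By induction on the total degree: the coefficients of a homogeneous multiple have smaller degree and
  vanish.
\<close>

lemma nakayama_trivial:
  assumes "is_graded_module P" "bounded_below P" "carrier P \<subseteq> max_ideal_times P" shows "trivial_module P"
proof -
  interpret graded_mod P using assms(1) by (simp add: graded_mod_def)
  have *: "x = \<zero>\<^bsub>P\<^esub>" if "x \<in> component P u" for x u
    using assms(2) that
  proof (induction rule: bounded_below_induct)
    case (step u x)
    have "x \<in> max_ideal_times P" using assms(3) component_closed[OF step(1)] by blast
    then obtain z where z: "\<forall>i. z i \<in> component P (u - unit_grade i)" "x = (\<Oplus>\<^bsub>P\<^esub>i\<in>UNIV. indet i \<odot>\<^bsub>P\<^esub> z i)"
      by (rule max_ideal_times_homogeneous[OF _ step(1)])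
    have "z i = \<zero>\<^bsub>P\<^esub>" for i using step(2)[OF z(1)[rule_format]] .
    then show ?case using z(2) by simp
  qed simp
  have "x = \<zero>\<^bsub>P\<^esub>" if "x \<in> carrier P" for x
    by (rule zero_if_parts_zero[OF that]) (rule *[OF part_component[OF that]])
  then show ?thesis unfolding trivial_module_def by auto
qed

text \<open>
  A trivial module is covered minimally only by the trivial module. So discarding trivial summands has
  the same effect on both sides of the correspondence between modules and morphisms.
\<close>

lemma minimal_trivial_iff:
  assumes "minimal_mor f" "presents f M" "is_graded_module M"
  shows "trivial_morphism f \<longleftrightarrow> trivial_module M"
proof -
  note D = minimal_morD[OF assms(1)]
  from assms(2) obtain p where p: "graded_hom (tgt f) M p" "p ` carrier (tgt f) = carrier M"
    "mor_kernel (tgt f) M p = app f ` carrier (src f)" unfolding presents_def by blast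
  interpret p: graded_homo "tgt f" M p by (rule graded_homoI[OF D(5) assms(3) p(1)])
  interpret f: graded_homo "src f" "tgt f" "app f" by (rule D(6))
  show ?thesis
  proof
    assume "trivial_morphism f"
    then have "carrier (tgt f) = {\<zero>\<^bsub>tgt f\<^esub>}" by (simp add: trivial_morphism_def trivial_module_def)
    then show "trivial_module M" using p(2) by (simp add: trivial_module_def)
  next
    assume "trivial_module M"
    then have "carrier (tgt f) \<subseteq> mor_kernel (tgt f) M p"
      using p.closed by (auto simp: trivial_module_def mor_kernel_def)
    then have "carrier (tgt f) \<subseteq> max_ideal_times (tgt f)" using p(3) D(7) by simp
    then have 1: "trivial_module (tgt f)" by (rule nakayama_trivial[OF D(5) free_graded_bounded_below[OF D(2)]])
    then have "carrier (src f) \<subseteq> mor_kernel (src f) (tgt f) (app f)"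
      using f.closed by (auto simp: trivial_module_def mor_kernel_def)
    then have "carrier (src f) \<subseteq> max_ideal_times (src f)" using D(8) by simp
    then have "trivial_module (src f)" by (rule nakayama_trivial[OF D(4) free_graded_bounded_below[OF D(1)]])
    then show "trivial_morphism f" using 1 by (simp add: trivial_morphism_def)
  qed
qed

text \<open>
  The targets are minimal covers of the module and the sources are minimal covers of the images, so the
  uniqueness of minimal covers applies twice.
\<close>

theorem minimal_presentation_unique:
  assumes f: "minimal_mor f" "presents f M" and f': "minimal_mor f'" "presents f' M" and M: "is_graded_module M"
  shows "isomorphic_morphisms f f'"
proof -
  note D = minimal_morD[OF f(1)] and D' = minimal_morD[OF f'(1)]
  obtain p where p: "graded_hom (tgt f) M p" "p ` carrier (tgt f) = carrier M"
    "mor_kernel (tgt f) M p = app f ` carrier (src f)" using f(2) unfolding presents_def by blast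
  obtain p' where p': "graded_hom (tgt f') M p'" "p' ` carrier (tgt f') = carrier M"
    "mor_kernel (tgt f') M p' = app f' ` carrier (src f')" using f'(2) unfolding presents_def by blast
  have "minimal_cover (tgt f) M p" "minimal_cover (tgt f') M p'"
    using p p' D(7) D'(7) by (simp_all add: minimal_cover_def)
  then obtain h where h: "graded_iso (tgt f) (tgt f') h" "\<forall>x\<in>carrier (tgt f). p' (h x) = p x"
    by (rule minimal_cover_unique[OF D(2) D'(2) M])
  interpret h: graded_homo "tgt f" "tgt f'" h by (rule graded_homoI[OF D(5) D'(5) graded_iso_hom[OF h(1)]])
  interpret f: graded_homo "src f" "tgt f" "app f" by (rule D(6))
  interpret f': graded_homo "src f'" "tgt f'" "app f'" by (rule D'(6))
  have ker: "h x \<in> mor_kernel (tgt f') M p' \<longleftrightarrow> x \<in> mor_kernel (tgt f) M p" if "x \<in> carrier (tgt f)" for x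
    using that h(2) by (simp add: mor_kernel_def)
  let ?I = "restr (tgt f') (app f' ` carrier (src f'))"
  have I: "is_graded_module ?I" by (rule h.N.restr_graded[OF f'.image_submodule])
  have hf: "(\<lambda>x. h (app f x)) ` carrier (src f) = carrier ?I"
  proof -
    have "y \<in> (\<lambda>x. h (app f x)) ` carrier (src f) \<longleftrightarrow> y \<in> app f' ` carrier (src f')" for y
    proof
      assume "y \<in> (\<lambda>x. h (app f x)) ` carrier (src f)"
      then obtain x where x: "x \<in> carrier (src f)" "y = h (app f x)" by blast
      have "app f x \<in> mor_kernel (tgt f) M p" unfolding p(3) using x(1) by blast
      then show "y \<in> app f' ` carrier (src f')" using ker[of "app f x"] x unfolding p'(3) by simp
    next
      assume y: "y \<in> app f' ` carrier (src f')"
      then have "y \<in> carrier (tgt f')" using f'.closed by blast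
      then obtain z where z: "z \<in> carrier (tgt f)" "y = h z" using graded_iso_image[OF h(1)] by blast
      then have "z \<in> mor_kernel (tgt f) M p" using ker[OF z(1)] y unfolding p'(3) by simp
      then show "y \<in> (\<lambda>x. h (app f x)) ` carrier (src f)" unfolding p(3) z(2) by blast
    qed
    then show ?thesis by auto
  qed
  have c1: "minimal_cover (src f) ?I (\<lambda>x. h (app f x))"
    unfolding minimal_cover_def
  proof (intro conjI)
    have hom: "graded_hom (src f) (tgt f') (\<lambda>x. h (app f x))" by (rule graded_hom_comp[OF D(3) graded_iso_hom[OF h(1)]])
    interpret hf: graded_homo "src f" "tgt f'" "\<lambda>x. h (app f x)" by (rule graded_homoI[OF D(4) D'(5) hom])
    show "graded_hom (src f) ?I (\<lambda>x. h (app f x))" using hf.image_hom unfolding hf by simp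
    have "mor_kernel (src f) ?I (\<lambda>x. h (app f x)) = mor_kernel (src f) (tgt f) (app f)"
      using graded_iso_zero_iff[OF D(5) D'(5) h(1)] by (auto simp: mor_kernel_def)
    then show "mor_kernel (src f) ?I (\<lambda>x. h (app f x)) \<subseteq> max_ideal_times (src f)" using D(8) by simp
  qed (rule hf)
  have c2: "minimal_cover (src f') ?I (app f')"
    unfolding minimal_cover_def using f'.image_hom D'(8) by (simp add: mor_kernel_def)
  obtain g where g: "graded_iso (src f) (src f') g" "\<forall>x\<in>carrier (src f). app f' (g x) = h (app f x)"
    by (rule minimal_cover_unique[OF D(1) D'(1) I c1 c2])
  show ?thesis by (rule isomorphic_morphismsI[OF g(1) h(1)]) (use g(2) in simp)
qed


section \<open>Direct sums of morphisms\<close>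

lemma direct_sum_morphism_simps [simp]:
  "src (direct_sum_morphism fs) = direct_sum (map src fs)"
  "tgt (direct_sum_morphism fs) = direct_sum (map tgt fs)"
  "app (direct_sum_morphism fs) = sum_map (length fs) (\<lambda>i. app (fs ! i))"
  by (simp_all add: direct_sum_morphism_def sum_map_def fun_eq_iff del: direct_sum_simps)

locale gmorphisms =
  fixes fs :: "('d::finite, 'k::field, 'm, 'n) gmorphism list"
  assumes all_gmorphism: "\<forall>f\<in>set fs. is_gmorphism f"
begin

lemma src_mods: "graded_mods (map src fs)" and tgt_mods: "graded_mods (map tgt fs)"
  using all_gmorphism gmorphismD by (auto simp: graded_mods_def)

lemma nth_gmorphism: "i < length fs \<Longrightarrow> is_gmorphism (fs ! i)"
  using all_gmorphism by simp

lemma sum_homo: "graded_homo (direct_sum (map src fs)) (direct_sum (map tgt fs)) (sum_map (length fs) (\<lambda>i. app (fs ! i)))"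
  by (rule graded_homoI[OF graded_mods.direct_sum_graded[OF src_mods] graded_mods.direct_sum_graded[OF tgt_mods] sum_map_hom])
    (simp_all add: gmorphismD(3)[OF nth_gmorphism])

abbreviation src_inj where "src_inj \<equiv> graded_mods.inj (map src fs)"
abbreviation tgt_inj where "tgt_inj \<equiv> graded_mods.inj (map tgt fs)"

lemma src_inj_closed: "i < length fs \<Longrightarrow> x \<in> carrier (src (fs ! i)) \<Longrightarrow> src_inj i x \<in> carrier (direct_sum (map src fs))"
  and tgt_inj_closed: "i < length fs \<Longrightarrow> y \<in> carrier (tgt (fs ! i)) \<Longrightarrow> tgt_inj i y \<in> carrier (direct_sum (map tgt fs))"
  using graded_mods.inj_hom[OF src_mods, of i] graded_mods.inj_hom[OF tgt_mods, of i]
  unfolding graded_hom_def hom_def by (auto simp del: direct_sum_simps)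

lemma sum_map_inj:
  assumes i: "i < length fs" and x: "x \<in> carrier (src (fs ! i))"
  shows "sum_map (length fs) (\<lambda>i. app (fs ! i)) (src_inj i x) = tgt_inj i (app (fs ! i) x)"
  unfolding sum_map_def graded_mods.inj_def[OF src_mods] graded_mods.inj_def[OF tgt_mods] length_map
proof (rule restrict_ext)
  fix j assume "j \<in> {..<length fs}"
  then have j: "j < length fs" by simp
  interpret j: graded_homo "src (fs ! j)" "tgt (fs ! j)" "app (fs ! j)" by (rule gmorphismD(4)[OF nth_gmorphism[OF j]])
  show "app (fs ! j) ((\<lambda>j\<in>{..<length fs}. if j = i then x else \<zero>\<^bsub>map src fs ! j\<^esub>) j) =
      (if j = i then app (fs ! i) x else \<zero>\<^bsub>map tgt fs ! j\<^esub>)"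
    using j by auto
qed

end

lemma isomorphic_direct_sum_morphism:
  assumes "list_all2 isomorphic_morphisms fs fs'"
  shows "isomorphic_morphisms (direct_sum_morphism fs) (direct_sum_morphism fs')"
proof -
  have len: "length fs = length fs'" using assms by (rule list_all2_lengthD)
  have "\<forall>i. \<exists>g. \<exists>h. i < length fs \<longrightarrow> graded_iso (src (fs ! i)) (src (fs' ! i)) g \<and>
      graded_iso (tgt (fs ! i)) (tgt (fs' ! i)) h \<and> (\<forall>x\<in>carrier (src (fs ! i)). h (app (fs ! i) x) = app (fs' ! i) (g x))"
    using list_all2_nthD[OF assms] unfolding isomorphic_morphisms_def by blast
  from choice[OF this] obtain g where "\<forall>i. \<exists>h. i < length fs \<longrightarrow> graded_iso (src (fs ! i)) (src (fs' ! i)) (g i) \<and>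
      graded_iso (tgt (fs ! i)) (tgt (fs' ! i)) h \<and> (\<forall>x\<in>carrier (src (fs ! i)). h (app (fs ! i) x) = app (fs' ! i) (g i x))" ..
  from choice[OF this] obtain h where gh: "\<forall>i. i < length fs \<longrightarrow> graded_iso (src (fs ! i)) (src (fs' ! i)) (g i) \<and>
      graded_iso (tgt (fs ! i)) (tgt (fs' ! i)) (h i) \<and> (\<forall>x\<in>carrier (src (fs ! i)). h i (app (fs ! i) x) = app (fs' ! i) (g i x))" ..
  show ?thesis
  proof (rule isomorphic_morphismsI; unfold direct_sum_morphism_simps)
    show "graded_iso (direct_sum (map src fs)) (direct_sum (map src fs')) (sum_map (length fs) g)"
      by (rule sum_map_iso) (use gh len in simp_all)
    show "graded_iso (direct_sum (map tgt fs)) (direct_sum (map tgt fs')) (sum_map (length fs) h)"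
      by (rule sum_map_iso) (use gh len in simp_all)
    fix x assume "x \<in> carrier (direct_sum (map src fs))"
    then show "sum_map (length fs) h (sum_map (length fs) (\<lambda>i. app (fs ! i)) x) =
        sum_map (length fs') (\<lambda>i. app (fs' ! i)) (sum_map (length fs) g x)"
      using gh len by (auto simp: sum_map_def PiE_iff intro!: restrict_ext)
  qed
qed

text \<open>
  Replacing each summand by its image in \<open>f\<close> moves a decomposition with summands of any type to the
  types of \<open>f\<close>.
\<close>

theorem transport_decomposition:
  fixes f :: "('d::finite, 'k::field, 'm, 'n) gmorphism"
  assumes f: "is_gmorphism f" and gs: "\<forall>g\<in>set gs. is_gmorphism g"
    and iso: "isomorphic_morphisms f (direct_sum_morphism gs)"
  obtains fs :: "('d, 'k, 'm, 'n) gmorphism list" where "fs \<in> morphism_decompositions f"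
    "list_all2 isomorphic_morphisms gs fs"
proof -
  interpret gs: gmorphisms gs using gs by (simp add: gmorphisms_def)
  obtain g h where gh: "graded_iso (src f) (direct_sum (map src gs)) g" "graded_iso (tgt f) (direct_sum (map tgt gs)) h"
    "\<forall>x\<in>carrier (src f). h (app f x) = sum_map (length gs) (\<lambda>i. app (gs ! i)) (g x)"
    using isomorphic_morphismsE[OF iso, unfolded direct_sum_morphism_simps] .
  note F = gmorphismD[OF f]
  interpret f: graded_homo "src f" "tgt f" "app f" by (rule F(4))
  note GS = graded_mods.direct_sum_graded[OF gs.src_mods] and GT = graded_mods.direct_sum_graded[OF gs.tgt_mods]
  obtain g' where g': "graded_iso (direct_sum (map src gs)) (src f) g'" "\<forall>x\<in>carrier (src f). g' (g x) = x"
      "\<forall>y\<in>carrier (direct_sum (map src gs)). g (g' y) = y"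
    by (rule graded_iso_inverse[OF F(1) GS gh(1)])
  obtain h' where h': "graded_iso (direct_sum (map tgt gs)) (tgt f) h'" "\<forall>x\<in>carrier (tgt f). h' (h x) = x"
      "\<forall>y\<in>carrier (direct_sum (map tgt gs)). h (h' y) = y"
    by (rule graded_iso_inverse[OF F(2) GT gh(2)])
  define s t where "s i = (\<lambda>x. g' (gs.src_inj i x))" and "t i = (\<lambda>x. h' (gs.tgt_inj i x))" for i
  define F where "F i = \<lparr>src = restr (src f) (s i ` carrier (src (gs ! i))),
    tgt = restr (tgt f) (t i ` carrier (tgt (gs ! i))), app = app f\<rparr>" for i
  have *: "isomorphic_morphisms (gs ! i) (F i) \<and> is_gmorphism (F i)" if i: "i < length gs" for i
  proof -
    note I = gs.nth_gmorphism[OF i]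
    have si: "graded_hom (src (gs ! i)) (src f) (s i)" and ti: "graded_hom (tgt (gs ! i)) (tgt f) (t i)"
      unfolding s_def t_def
      using graded_hom_comp[OF graded_mods.inj_hom[OF gs.src_mods] graded_iso_hom[OF g'(1)], of i]
        graded_hom_comp[OF graded_mods.inj_hom[OF gs.tgt_mods] graded_iso_hom[OF h'(1)], of i] i
      by (simp_all del: direct_sum_simps)
    interpret s: graded_homo "src (gs ! i)" "src f" "s i" by (rule graded_homoI[OF gmorphismD(1)[OF I] F(1) si])
    interpret t: graded_homo "tgt (gs ! i)" "tgt f" "t i" by (rule graded_homoI[OF gmorphismD(2)[OF I] F(2) ti])
    interpret gi: graded_homo "src (gs ! i)" "tgt (gs ! i)" "app (gs ! i)" by (rule gmorphismD(4)[OF I])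
    have inj_s: "inj_on (s i) (carrier (src (gs ! i)))"
    proof (rule inj_onI)
      fix x y assume xy: "x \<in> carrier (src (gs ! i))" "y \<in> carrier (src (gs ! i))" "s i x = s i y"
      then have "gs.src_inj i x = gs.src_inj i y"
        using inj_onD[OF graded_iso_inj[OF g'(1)]] gs.src_inj_closed[OF i] unfolding s_def by blast
      then show "x = y" using graded_mods.inj_proj[OF gs.src_mods, of i] i by (metis length_map)
    qed
    have inj_t: "inj_on (t i) (carrier (tgt (gs ! i)))"
    proof (rule inj_onI)
      fix x y assume xy: "x \<in> carrier (tgt (gs ! i))" "y \<in> carrier (tgt (gs ! i))" "t i x = t i y"
      then have "gs.tgt_inj i x = gs.tgt_inj i y"
        using inj_onD[OF graded_iso_inj[OF h'(1)]] gs.tgt_inj_closed[OF i] unfolding t_def by blast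
      then show "x = y" using graded_mods.inj_proj[OF gs.tgt_mods, of i] i by (metis length_map)
    qed
    have comm: "t i (app (gs ! i) x) = app f (s i x)" if x: "x \<in> carrier (src (gs ! i))" for x
    proof -
      note c = gs.src_inj_closed[OF i x]
      have "h (app f (s i x)) = gs.tgt_inj i (app (gs ! i) x)"
        using gh(3) graded_iso_closed[OF g'(1) c] g'(3) c gs.sum_map_inj[OF i x]
        by (simp add: s_def del: direct_sum_simps)
      then have "h' (h (app f (s i x))) = t i (app (gs ! i) x)" by (simp only: t_def)
      then show ?thesis using bspec[OF h'(2) f.closed[OF s.closed[OF x]]] by simp
    qed
    have fi: "graded_iso (src (gs ! i)) (src (F i)) (s i)" "graded_iso (tgt (gs ! i)) (tgt (F i)) (t i)"
      unfolding graded_iso_def bij_betw_def F_def gmorphism.simps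
      using s.image_hom t.image_hom inj_s inj_t by simp_all
    have mods: "is_graded_module (src (F i))" "is_graded_module (tgt (F i))"
      unfolding F_def gmorphism.simps
      by (rule f.M.restr_graded[OF s.image_submodule], rule f.N.restr_graded[OF t.image_submodule])
    have iso: "isomorphic_morphisms (gs ! i) (F i)"
      by (rule isomorphic_morphismsI[OF fi]) (simp add: F_def comm)
    have "graded_hom (src (F i)) (tgt (F i)) (app (F i))"
      unfolding F_def gmorphism.simps
    proof (rule graded_homI; unfold restr_simps)
      show c: "app f x \<in> t i ` carrier (tgt (gs ! i))" if "x \<in> s i ` carrier (src (gs ! i))" for x
      proof -
        from that obtain y where y: "x = s i y" "y \<in> carrier (src (gs ! i))" by (rule imageE)
        show ?thesis unfolding y(1) comm[OF y(2), symmetric] by (rule imageI[OF gi.closed[OF y(2)]])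
      qed
      show "app f x \<in> component (tgt f) u \<inter> t i ` carrier (tgt (gs ! i))"
        if "x \<in> component (src f) u \<inter> s i ` carrier (src (gs ! i))" for x u
      proof (rule IntI)
        show "app f x \<in> component (tgt f) u" by (rule f.component[OF IntD1[OF that]])
        show "app f x \<in> t i ` carrier (tgt (gs ! i))" by (rule c[OF IntD2[OF that]])
      qed
    next
      fix x y assume "x \<in> s i ` carrier (src (gs ! i))" "y \<in> s i ` carrier (src (gs ! i))"
      then have "x \<in> carrier (src f)" "y \<in> carrier (src f)" using s.closed by blast+
      then show "app f (x \<oplus>\<^bsub>src f\<^esub> y) = app f x \<oplus>\<^bsub>tgt f\<^esub> app f y" by (rule f.add)
    next
      fix x p assume "x \<in> s i ` carrier (src (gs ! i))"
      then have "x \<in> carrier (src f)" using s.closed by blast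
      then show "app f (p \<odot>\<^bsub>src f\<^esub> x) = p \<odot>\<^bsub>tgt f\<^esub> app f x" by (rule f.smult)
    qed
    moreover have "finitely_generated (src (F i))" "finitely_generated (tgt (F i))"
      using finitely_generated_iso[OF gmorphismD(1)[OF I] mods(1) isomorphic_if_graded_iso[OF fi(1)] gmorphismD(5)[OF I]]
        finitely_generated_iso[OF gmorphismD(2)[OF I] mods(2) isomorphic_if_graded_iso[OF fi(2)] gmorphismD(6)[OF I]]
      by auto
    ultimately show ?thesis using iso mods by (simp add: is_gmorphism_def persistence_module_def)
  qed
  define fs where "fs = map F [0..<length gs]"
  have "list_all2 isomorphic_morphisms gs fs"
    unfolding list_all2_conv_all_nth fs_def using * by simp
  moreover have "\<forall>f\<in>set fs. is_gmorphism f" using * by (auto simp: fs_def)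
  ultimately show ?thesis
    using that isomorphic_morphisms_trans[OF iso isomorphic_direct_sum_morphism]
    unfolding morphism_decompositions_def by blast
qed

text \<open>
  The inclusions and projections of summands are graded homomorphisms and so preserve multiples of the
  maximal ideal; source and target are free as summands of free modules.
\<close>

lemma minimal_summands:
  assumes f: "minimal_mor f" and fs: "fs \<in> morphism_decompositions f" and g: "g \<in> set fs"
  shows "minimal_mor g"
proof -
  have all: "\<forall>f\<in>set fs. is_gmorphism f" and iso: "isomorphic_morphisms f (direct_sum_morphism fs)"
    using fs by (auto simp: morphism_decompositions_def)
  interpret fs: gmorphisms fs using all by (simp add: gmorphisms_def)
  note D = minimal_morD[OF f]
  interpret S: graded_homo "direct_sum (map src fs)" "direct_sum (map tgt fs)" "sum_map (length fs) (\<lambda>i. app (fs ! i))"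
    by (rule fs.sum_homo)
  have sum: "minimal_mor (direct_sum_morphism fs)"
    by (rule isomorphic_morphisms_transfer(1)[OF D(1-3) _ _ _ iso f]; unfold direct_sum_morphism_simps)
      (rule S.M.graded S.N.graded S.homo)+
  note DS = minimal_morD[OF sum, unfolded direct_sum_morphism_simps]
  obtain i where i: "i < length fs" "g = fs ! i" using g by (auto simp: in_set_conv_nth)
  note I = fs.nth_gmorphism[OF i(1)]
  interpret gi: graded_homo "src g" "tgt g" "app g" using gmorphismD(4)[OF I] i(2) by simp
  have inj: "graded_hom (src g) (direct_sum (map src fs)) (fs.src_inj i)" "graded_hom (tgt g) (direct_sum (map tgt fs)) (fs.tgt_inj i)"
    using graded_mods.inj_hom[OF fs.src_mods, of i] graded_mods.inj_hom[OF fs.tgt_mods, of i] i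
    by (simp_all del: direct_sum_simps)
  have proj: "graded_hom (direct_sum (map src fs)) (src g) (\<lambda>x. x i)" "graded_hom (direct_sum (map tgt fs)) (tgt g) (\<lambda>x. x i)"
    using graded_mods.proj_hom[OF fs.src_mods, of i] graded_mods.proj_hom[OF fs.tgt_mods, of i] i
    by (simp_all del: direct_sum_simps)
  have inj_proj: "fs.src_inj i x i = x" "fs.tgt_inj i y i = y" for x y
    using graded_mods.inj_proj[OF fs.src_mods, of i] graded_mods.inj_proj[OF fs.tgt_mods, of i] i by simp_all
  show ?thesis unfolding minimal_mor_def
  proof (intro conjI subsetI)
    show "free_graded (src g)"
      by (rule free_graded_summand[OF DS(1) gi.M.graded inj(1) proj(1)]) (rule inj_proj(1))
    show "free_graded (tgt g)"
      by (rule free_graded_summand[OF DS(2) gi.N.graded inj(2) proj(2)]) (rule inj_proj(2))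
    fix y assume "y \<in> app g ` carrier (src g)"
    then obtain x where x: "x \<in> carrier (src g)" "y = app g x" by blast
    have "fs.tgt_inj i y = sum_map (length fs) (\<lambda>i. app (fs ! i)) (fs.src_inj i x)"
      using fs.sum_map_inj[OF i(1)] x i(2) by simp
    then have "fs.tgt_inj i y \<in> max_ideal_times (direct_sum (map tgt fs))"
      using DS(7) fs.src_inj_closed[OF i(1)] x(1) i(2) by (simp add: image_subset_iff del: direct_sum_simps)
    from graded_mods.max_ideal_times_sumD[OF fs.tgt_mods this, of i] show "y \<in> max_ideal_times (tgt g)"
      using i inj_proj(2) by simp
  next
    fix x assume x: "x \<in> mor_kernel (src g) (tgt g) (app g)"
    then have xc: "x \<in> carrier (src (fs ! i))" "app (fs ! i) x = \<zero>\<^bsub>tgt g\<^esub>" by (simp_all add: mor_kernel_def i(2))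
    interpret t: graded_homo "tgt g" "direct_sum (map tgt fs)" "fs.tgt_inj i" by (rule graded_homoI[OF gi.N.graded S.N.graded inj(2)])
    have "sum_map (length fs) (\<lambda>i. app (fs ! i)) (fs.src_inj i x) = \<zero>\<^bsub>direct_sum (map tgt fs)\<^esub>"
      unfolding fs.sum_map_inj[OF i(1) xc(1)] xc(2) by (rule t.zero)
    then have "fs.src_inj i x \<in> max_ideal_times (direct_sum (map src fs))"
      using DS(8) fs.src_inj_closed[OF i(1) xc(1)] by (auto simp: mor_kernel_def simp del: direct_sum_simps)
    from graded_mods.max_ideal_times_sumD[OF fs.src_mods this, of i] show "x \<in> max_ideal_times (src g)"
      using i inj_proj(1) by simp
  qed (rule gi.homo)
qed

section \<open>Decompositions of a module and of its minimal presentation\<close>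

text \<open>Both modules are the quotient of \<open>L\<close> by the common kernel.\<close>

lemma isomorphic_if_same_kernel:
  assumes \<alpha>: "graded_homo L A \<alpha>" "\<alpha> ` carrier L = carrier A" and \<beta>: "graded_homo L B \<beta>" "\<beta> ` carrier L = carrier B"
    and ker: "mor_kernel L A \<alpha> = mor_kernel L B \<beta>"
  shows "isomorphic_modules A B"
proof -
  interpret s: graded_homo L A \<alpha> by fact
  interpret t: graded_homo L B \<beta> by fact
  have eq: "\<alpha> x = \<alpha> y \<longleftrightarrow> \<beta> x = \<beta> y" if "x \<in> carrier L" "y \<in> carrier L" for x y
  proof -
    have "x \<ominus>\<^bsub>L\<^esub> y \<in> mor_kernel L A \<alpha> \<longleftrightarrow> x \<ominus>\<^bsub>L\<^esub> y \<in> mor_kernel L B \<beta>" using ker by simp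
    then show ?thesis using that by (simp add: mor_kernel_def s.diff t.diff s.N.diff_eq_zero t.N.diff_eq_zero)
  qed
  define \<phi> where "\<phi> a = \<beta> (SOME x. x \<in> carrier L \<and> \<alpha> x = a)" for a
  have \<phi>: "\<phi> (\<alpha> x) = \<beta> x" if x: "x \<in> carrier L" for x
  proof -
    have "(SOME y. y \<in> carrier L \<and> \<alpha> y = \<alpha> x) \<in> carrier L \<and> \<alpha> (SOME y. y \<in> carrier L \<and> \<alpha> y = \<alpha> x) = \<alpha> x"
      by (rule someI[of _ x]) (use x in simp)
    then show ?thesis unfolding \<phi>_def using eq x by blast
  qed
  have pre: "\<exists>x\<in>carrier L. a = \<alpha> x" if "a \<in> carrier A" for a using that \<alpha>(2) by blast
  have "graded_hom A B \<phi>"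
  proof (rule graded_homI)
    fix a assume "a \<in> carrier A"
    with pre obtain x where x: "x \<in> carrier L" "a = \<alpha> x" by blast
    then show "\<phi> a \<in> carrier B" by (simp add: \<phi>)
    fix p show "\<phi> (p \<odot>\<^bsub>A\<^esub> a) = p \<odot>\<^bsub>B\<^esub> \<phi> a"
      using x \<phi>[of "p \<odot>\<^bsub>L\<^esub> x"] by (simp add: \<phi> s.smult t.smult)
    fix b assume "b \<in> carrier A"
    with pre obtain y where y: "y \<in> carrier L" "b = \<alpha> y" by blast
    show "\<phi> (a \<oplus>\<^bsub>A\<^esub> b) = \<phi> a \<oplus>\<^bsub>B\<^esub> \<phi> b"
      using x y \<phi>[of "x \<oplus>\<^bsub>L\<^esub> y"] by (simp add: \<phi> s.add t.add)
  next
    fix u a assume a: "a \<in> component A u"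
    then obtain x where x: "x \<in> carrier L" "a = \<alpha> x" using pre s.N.component_closed by blast
    then have c: "part L u x \<in> component L u" "\<alpha> (part L u x) = a"
      using s.component_preimage[of x u] a by auto
    have "\<phi> a = \<beta> (part L u x)" using \<phi>[of "part L u x"] c x(1) by simp
    then show "\<phi> a \<in> component B u" using t.component[OF c(1)] by simp
  qed
  moreover have "inj_on \<phi> (carrier A)"
  proof (rule inj_onI)
    fix a b assume ab: "a \<in> carrier A" "b \<in> carrier A" "\<phi> a = \<phi> b"
    obtain x where x: "x \<in> carrier L" "a = \<alpha> x" using pre[OF ab(1)] by blast
    obtain y where y: "y \<in> carrier L" "b = \<alpha> y" using pre[OF ab(2)] by blast
    have "\<beta> x = \<beta> y" using ab(3) \<phi> x y by simp
    then show "a = b" using eq[OF x(1) y(1)] x y by simp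
  qed
  moreover have "\<phi> ` carrier A = carrier B"
  proof -
    have "\<phi> ` carrier A = (\<lambda>x. \<phi> (\<alpha> x)) ` carrier L" unfolding \<alpha>(2)[symmetric] by (simp add: image_image)
    also have "\<dots> = \<beta> ` carrier L" by (rule image_cong) (simp_all add: \<phi>)
    finally show ?thesis using \<beta>(2) by simp
  qed
  ultimately have "graded_iso A B \<phi>" by (simp add: graded_iso_def bij_betw_def)
  then show ?thesis by (rule isomorphic_if_graded_iso)
qed

text \<open>
  The summands of \<open>H\<close> are the images of the targets of the summands of \<open>f\<close>. Their direct sum and \<open>H\<close> are
  quotients of the same module, the direct sum of the targets, by the image of the direct sum of the
  summands of \<open>f\<close>.
\<close>

theorem module_decomposition_of_morphism_decomposition:
  fixes H :: "('d::finite, 'k::field, 'h) pmodule"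
  assumes H: "persistence_module H" and f: "minimal_mor f" "presents f H" and fs: "fs \<in> morphism_decompositions f"
  obtains Hs where "Hs \<in> module_decompositions H" "list_all2 (\<lambda>M f. presents f M) Hs fs"
proof -
  have all: "\<forall>f\<in>set fs. is_gmorphism f" and iso: "isomorphic_morphisms f (direct_sum_morphism fs)"
    using fs by (auto simp: morphism_decompositions_def)
  interpret fs: gmorphisms fs using all by (simp add: gmorphisms_def)
  note D = minimal_morD[OF f(1)]
  have min: "minimal_mor (fs ! i)" if "i < length fs" for i
    using minimal_summands[OF f(1) fs, of "fs ! i"] that by simp
  obtain p where p: "graded_hom (tgt f) H p" "p ` carrier (tgt f) = carrier H"
    "mor_kernel (tgt f) H p = app f ` carrier (src f)" using f(2) unfolding presents_def by blast
  obtain g h where gh: "graded_iso (src f) (direct_sum (map src fs)) g" "graded_iso (tgt f) (direct_sum (map tgt fs)) h"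
    "\<forall>x\<in>carrier (src f). h (app f x) = sum_map (length fs) (\<lambda>i. app (fs ! i)) (g x)"
    using isomorphic_morphismsE[OF iso, unfolded direct_sum_morphism_simps] .
  let ?S = "direct_sum (map src fs)" and ?T = "direct_sum (map tgt fs)"
  interpret S: graded_homo ?S ?T "sum_map (length fs) (\<lambda>i. app (fs ! i))" by (rule fs.sum_homo)
  obtain h' where h': "graded_iso ?T (tgt f) h'" "\<forall>x\<in>carrier (tgt f). h' (h x) = x" "\<forall>y\<in>carrier ?T. h (h' y) = y"
    by (rule graded_iso_inverse[OF D(5) S.N.graded gh(2)])
  have gH: "is_graded_module H" using H by (simp add: persistence_module_def)
  let ?\<sigma> = "\<lambda>x. p (h' x)"
  have \<sigma>: "graded_homo ?T H ?\<sigma>"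
    by (rule graded_homoI[OF S.N.graded gH graded_hom_comp[OF graded_iso_hom[OF h'(1)] p(1)]])
  interpret \<sigma>: graded_homo ?T H ?\<sigma> by (rule \<sigma>)
  have "?\<sigma> ` carrier ?T = p ` (h' ` carrier ?T)" by (simp add: image_image)
  then have \<sigma>_surj: "?\<sigma> ` carrier ?T = carrier H" using graded_iso_image[OF h'(1)] p(2) by simp
  have \<sigma>_ker: "y \<in> mor_kernel ?T H ?\<sigma> \<longleftrightarrow> y \<in> sum_map (length fs) (\<lambda>i. app (fs ! i)) ` carrier ?S" for y
  proof
    assume y: "y \<in> mor_kernel ?T H ?\<sigma>"
    then have yc: "y \<in> carrier ?T" by (rule \<sigma>.kernel_closed)
    have "h' y \<in> mor_kernel (tgt f) H p" using y graded_iso_closed[OF h'(1) yc] by (simp add: mor_kernel_def)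
    then obtain x where x: "x \<in> carrier (src f)" "h' y = app f x" unfolding p(3) by blast
    have "y = h (h' y)" using h'(3) yc by simp
    also have "\<dots> = sum_map (length fs) (\<lambda>i. app (fs ! i)) (g x)" using x gh(3) by simp
    finally show "y \<in> sum_map (length fs) (\<lambda>i. app (fs ! i)) ` carrier ?S"
      using graded_iso_closed[OF gh(1) x(1)] by (rule image_eqI)
  next
    assume "y \<in> sum_map (length fs) (\<lambda>i. app (fs ! i)) ` carrier ?S"
    then obtain z where z: "y = sum_map (length fs) (\<lambda>i. app (fs ! i)) z" "z \<in> carrier ?S" by (rule imageE)
    then obtain x where x: "z = g x" "x \<in> carrier (src f)" unfolding graded_iso_image[OF gh(1), symmetric] by blast
    have fx: "app f x \<in> mor_kernel (tgt f) H p" unfolding p(3) using x(2) by (rule imageI)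
    then have "app f x \<in> carrier (tgt f)" by (simp add: mor_kernel_def)
    then have "h' y = app f x" using h'(2) gh(3) x z by force
    moreover have "y \<in> carrier ?T" unfolding z(1) by (rule S.closed[OF z(2)])
    ultimately show "y \<in> mor_kernel ?T H ?\<sigma>" using fx by (simp add: mor_kernel_def del: direct_sum_simps)
  qed
  define P where "P i = (\<lambda>x. ?\<sigma> (fs.tgt_inj i x))" for i
  define N where "N i = restr H (P i ` carrier (tgt (fs ! i)))" for i
  have *: "persistence_module (N i) \<and> graded_hom (tgt (fs ! i)) (N i) (P i) \<and> P i ` carrier (tgt (fs ! i)) = carrier (N i) \<and>
      mor_kernel (tgt (fs ! i)) (N i) (P i) = app (fs ! i) ` carrier (src (fs ! i))" if i: "i < length fs" for i
  proof -
    note I = gmorphismD[OF fs.nth_gmorphism[OF i]]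
    have "graded_hom (tgt (fs ! i)) ?T (fs.tgt_inj i)"
      using graded_mods.inj_hom[OF fs.tgt_mods, of i] i by (simp del: direct_sum_simps)
    then have hom: "graded_hom (tgt (fs ! i)) H (P i)" unfolding P_def by (rule graded_hom_comp[OF _ \<sigma>.homo])
    interpret P: graded_homo "tgt (fs ! i)" H "P i" by (rule graded_homoI[OF I(2) gH hom])
    have gN: "is_graded_module (N i)" unfolding N_def by (rule \<sigma>.N.restr_graded[OF P.image_submodule])
    have homN: "graded_hom (tgt (fs ! i)) (N i) (P i)" unfolding N_def by (rule P.image_hom)
    interpret PN: graded_homo "tgt (fs ! i)" "N i" "P i" by (rule graded_homoI[OF I(2) gN homN])
    have surj: "P i ` carrier (tgt (fs ! i)) = carrier (N i)" by (simp add: N_def)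
    have "x \<in> mor_kernel (tgt (fs ! i)) (N i) (P i) \<longleftrightarrow> x \<in> app (fs ! i) ` carrier (src (fs ! i))" for x
    proof
      assume x: "x \<in> mor_kernel (tgt (fs ! i)) (N i) (P i)"
      then have xc: "x \<in> carrier (tgt (fs ! i))" by (rule PN.kernel_closed)
      have "fs.tgt_inj i x \<in> mor_kernel ?T H ?\<sigma>"
        using x fs.tgt_inj_closed[OF i xc] by (simp add: mor_kernel_def P_def N_def del: direct_sum_simps)
      then obtain z where z: "z \<in> carrier ?S" "fs.tgt_inj i x = sum_map (length fs) (\<lambda>i. app (fs ! i)) z"
        unfolding \<sigma>_ker by blast
      have "x = fs.tgt_inj i x i" using graded_mods.inj_proj[OF fs.tgt_mods, of i] i by simp
      also have "\<dots> = app (fs ! i) (z i)" using z(2) i by (simp add: sum_map_def)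
      finally show "x \<in> app (fs ! i) ` carrier (src (fs ! i))"
        by (rule image_eqI) (use z(1) i in \<open>auto simp: PiE_iff\<close>)
    next
      assume "x \<in> app (fs ! i) ` carrier (src (fs ! i))"
      then obtain w where w: "x = app (fs ! i) w" "w \<in> carrier (src (fs ! i))" by (rule imageE)
      have "fs.tgt_inj i x \<in> mor_kernel ?T H ?\<sigma>"
        unfolding \<sigma>_ker w(1) fs.sum_map_inj[OF i w(2), symmetric] by (rule imageI[OF fs.src_inj_closed[OF i w(2)]])
      moreover have "x \<in> carrier (tgt (fs ! i))" using w graded_homo.closed[OF I(4)] by simp
      ultimately show "x \<in> mor_kernel (tgt (fs ! i)) (N i) (P i)"
        by (simp add: mor_kernel_def P_def N_def)
    qed
    then have "mor_kernel (tgt (fs ! i)) (N i) (P i) = app (fs ! i) ` carrier (src (fs ! i))" by (rule Set.set_eqI)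
    then show ?thesis
      using gN homN surj PN.finitely_generated_image[OF I(6) surj] by (simp add: persistence_module_def)
  qed
  define Hs where "Hs = map N [0..<length fs]"
  have len: "length Hs = length fs" by (simp add: Hs_def)
  have nth: "Hs ! i = N i" if "i < length fs" for i using that by (simp add: Hs_def)
  have Hs_mods: "graded_mods Hs" using * by (auto simp: graded_mods_def Hs_def persistence_module_def)
  have \<tau>: "graded_homo ?T (direct_sum Hs) (sum_map (length fs) P)"
    by (rule graded_homoI[OF S.N.graded graded_mods.direct_sum_graded[OF Hs_mods] sum_map_hom])
      (use * len nth in simp_all)
  have \<tau>_surj: "sum_map (length fs) P ` carrier ?T = carrier (direct_sum Hs)"
  proof -
    have "sum_map (length fs) P ` carrier ?T = (\<Pi>\<^sub>E i \<in> {..<length fs}. carrier (N i))"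
      by (rule sum_map_image[where Ns=Hs]) (use * len in simp_all)
    also have "\<dots> = carrier (direct_sum Hs)"
      unfolding direct_sum_simps(1)[of Hs] len by (rule PiE_cong) (simp add: nth)
    finally show ?thesis .
  qed
  have "mor_kernel ?T (direct_sum Hs) (sum_map (length fs) P) = (\<Pi>\<^sub>E i \<in> {..<length fs}. app (fs ! i) ` carrier (src (fs ! i)))"
    unfolding sum_map_kernel[OF length_map len] by (rule PiE_cong) (simp add: nth *)
  also have "\<dots> = sum_map (length fs) (\<lambda>i. app (fs ! i)) ` carrier ?S"
    by (rule sum_map_image[symmetric, where Ns="map tgt fs"]) simp_all
  also have "\<dots> = mor_kernel ?T H ?\<sigma>" using \<sigma>_ker by auto
  finally have "isomorphic_modules H (direct_sum Hs)"
    using isomorphic_if_same_kernel[OF \<sigma> \<sigma>_surj \<tau> \<tau>_surj] by simp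
  then have "Hs \<in> module_decompositions H" using * by (auto simp: module_decompositions_def Hs_def)
  moreover have "presents (fs ! i) (N i)" if i: "i < length fs" for i
    using minimal_morD(1-3)[OF min[OF i]] *[OF i] unfolding presents_def by blast
  then have "list_all2 (\<lambda>M f. presents f M) Hs fs" using len nth by (simp add: list_all2_conv_all_nth)
  ultimately show ?thesis by (rule that)
qed

lemma minimal_cover_sum:
  assumes "length Ps = n" "length Ms = n" "\<forall>P\<in>set Ps. is_graded_module P"
    "\<And>i. i < n \<Longrightarrow> minimal_cover (Ps ! i) (Ms ! i) (p i)"
  shows "minimal_cover (direct_sum Ps) (direct_sum Ms) (sum_map n p)"
  unfolding minimal_cover_def
proof (intro conjI)
  show "graded_hom (direct_sum Ps) (direct_sum Ms) (sum_map n p)"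
    using assms by (intro sum_map_hom) (simp_all add: minimal_cover_def)
  show "sum_map n p ` carrier (direct_sum Ps) = carrier (direct_sum Ms)"
    using sum_map_image[OF assms(1,2), of p "\<lambda>i. carrier (Ms ! i)"] assms by (simp add: minimal_cover_def)
  show "mor_kernel (direct_sum Ps) (direct_sum Ms) (sum_map n p) \<subseteq> max_ideal_times (direct_sum Ps)"
  proof
    fix x assume x: "x \<in> mor_kernel (direct_sum Ps) (direct_sum Ms) (sum_map n p)"
    have G: "graded_mods Ps" using assms(3) by (simp add: graded_mods_def)
    show "x \<in> max_ideal_times (direct_sum Ps)"
    proof (rule graded_mods.max_ideal_times_sum[OF G])
      show "x \<in> carrier (direct_sum Ps)" using x unfolding mor_kernel_def by blast
      fix i assume i: "i < length Ps"
      have "x i \<in> mor_kernel (Ps ! i) (Ms ! i) (p i)"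
        using x i assms(1) unfolding sum_map_kernel[OF assms(1,2)] by (auto simp: PiE_iff)
      then show "x i \<in> max_ideal_times (Ps ! i)" using assms(1,4) i unfolding minimal_cover_def by blast
    qed
  qed
qed

text \<open>
  The converse: minimal covers of the summands add up to a minimal cover of the module, hence to the
  target of its minimal presentation, and their kernels add up to the kernel of that cover.
  The kernels are finitely generated because their sum is a quotient of the source.
\<close>

theorem morphism_decomposition_of_module_decomposition:
  fixes H :: "('d::finite, 'k::field, 'h) pmodule" and f :: "('d, 'k, 'm, 'n) gmorphism"
  assumes H: "persistence_module H" and f: "minimal_mor f" "presents f H" and Hs: "Hs \<in> module_decompositions H"
  obtains fs where "fs \<in> morphism_decompositions f" "list_all2 (\<lambda>M f. presents f M) Hs fs"
proof -
  let ?n = "length Hs"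
  have pers: "persistence_module (Hs ! i)" if "i < ?n" for i using Hs that by (simp add: module_decompositions_def)
  obtain \<theta> where \<theta>: "graded_iso H (direct_sum Hs) \<theta>"
    using Hs unfolding module_decompositions_def isomorphic_modules_def by blast
  have gH: "is_graded_module H" using H by (simp add: persistence_module_def)
  have Hs_mods: "graded_mods Hs" using Hs by (simp add: module_decompositions_def graded_mods_def persistence_module_def)
  note gHs = graded_mods.direct_sum_graded[OF Hs_mods]
  note D = minimal_morD[OF f(1)]
  obtain p where p: "graded_hom (tgt f) H p" "p ` carrier (tgt f) = carrier H"
    "mor_kernel (tgt f) H p = app f ` carrier (src f)" using f(2) unfolding presents_def by blast
  have p_closed: "p x \<in> carrier H" if "x \<in> carrier (tgt f)" for x using that p(2) by blast
  interpret f: graded_homo "src f" "tgt f" "app f" by (rule D(6))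
  have "\<forall>i. \<exists>us. \<exists>q. i < ?n \<longrightarrow> minimal_cover (free us) (Hs ! i) q"
    using minimal_cover_exists pers unfolding persistence_module_def by metis
  then obtain us q where q: "\<And>i. i < ?n \<Longrightarrow> minimal_cover (free (us i)) (Hs ! i) (q i)" by metis
  define Ps :: "('d, 'k, nat \<Rightarrow> ('d, 'k) mpoly) pmodule list" where "Ps = map (\<lambda>i. free (us i)) [0..<?n]"
  have Ps: "length Ps = ?n" "\<And>i. i < ?n \<Longrightarrow> Ps ! i = free (us i)" by (simp_all add: Ps_def)
  have PD: "free_graded (direct_sum Ps)"
    by (rule free_graded_direct_sum) (use free_is_free in \<open>auto simp: Ps_def\<close>)
  note gP = free_graded_is_graded[OF PD]
  have coverP: "minimal_cover (direct_sum Ps) (direct_sum Hs) (sum_map ?n q)"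
    by (rule minimal_cover_sum) (use Ps q free_is_graded in \<open>auto simp: Ps_def simp del: direct_sum_simps\<close>)
  have p\<theta>_ker: "mor_kernel (tgt f) (direct_sum Hs) (\<lambda>x. \<theta> (p x)) = app f ` carrier (src f)"
    unfolding p(3)[symmetric] using graded_iso_zero_iff[OF gH gHs \<theta>] p_closed
    by (auto simp: mor_kernel_def simp del: direct_sum_simps)
  have coverF: "minimal_cover (tgt f) (direct_sum Hs) (\<lambda>x. \<theta> (p x))"
  proof -
    have "(\<lambda>x. \<theta> (p x)) ` carrier (tgt f) = \<theta> ` (p ` carrier (tgt f))" by (simp add: image_image)
    then have "(\<lambda>x. \<theta> (p x)) ` carrier (tgt f) = carrier (direct_sum Hs)"
      using p(2) graded_iso_image[OF \<theta>] by (simp del: direct_sum_simps)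
    then show ?thesis
      using graded_hom_comp[OF p(1) graded_iso_hom[OF \<theta>]] p\<theta>_ker D(7) by (simp add: minimal_cover_def del: direct_sum_simps)
  qed
  obtain h where h: "graded_iso (tgt f) (direct_sum Ps) h" "\<forall>x\<in>carrier (tgt f). sum_map ?n q (h x) = \<theta> (p x)"
    by (rule minimal_cover_unique[OF D(2) PD gHs coverF coverP])
  define K where "K i = restr (free (us i)) (mor_kernel (free (us i)) (Hs ! i) (q i))" for i
  have q_homo: "graded_homo (free (us i)) (Hs ! i) (q i)" if i: "i < ?n" for i
    using q[OF i] pers[OF i] by (intro graded_homoI free_is_graded) (simp_all add: minimal_cover_def persistence_module_def)
  have K_graded: "is_graded_module (K i)" if i: "i < ?n" for i
    unfolding K_def by (rule graded_mod.restr_graded[OF free_graded_mod graded_homo.kernel_submodule[OF q_homo[OF i]]])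
  define Ks where "Ks = map K [0..<?n]"
  have Ks: "length Ks = ?n" "\<And>i. i < ?n \<Longrightarrow> Ks ! i = K i" by (simp_all add: Ks_def)
  have Ks_mods: "graded_mods Ks" using K_graded by (auto simp: graded_mods_def Ks_def)
  have Ks_carrier: "carrier (direct_sum Ks) = mor_kernel (direct_sum Ps) (direct_sum Hs) (sum_map ?n q)"
    unfolding sum_map_kernel[OF Ps(1) refl] direct_sum_simps(1)[of Ks] Ks(1)
    by (rule PiE_cong) (simp add: Ks(2) Ps(2) K_def del: direct_sum_simps)
  let ?hf = "\<lambda>x. h (app f x)"
  have hf_homo: "graded_homo (src f) (direct_sum Ps) ?hf"
    by (rule graded_homoI[OF D(4) gP graded_hom_comp[OF D(3) graded_iso_hom[OF h(1)]]])
  interpret hf: graded_homo "src f" "direct_sum Ps" ?hf by (rule hf_homo)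
  have hf_image: "?hf ` carrier (src f) = carrier (direct_sum Ks)"
  proof -
    have "y \<in> ?hf ` carrier (src f) \<longleftrightarrow> y \<in> mor_kernel (direct_sum Ps) (direct_sum Hs) (sum_map ?n q)" for y
    proof
      assume "y \<in> ?hf ` carrier (src f)"
      then obtain x where x: "y = h (app f x)" "x \<in> carrier (src f)" by (rule imageE)
      have "app f x \<in> mor_kernel (tgt f) (direct_sum Hs) (\<lambda>x. \<theta> (p x))" unfolding p\<theta>_ker using x(2) by (rule imageI)
      then show "y \<in> mor_kernel (direct_sum Ps) (direct_sum Hs) (sum_map ?n q)"
        using h(2) graded_iso_closed[OF h(1)] unfolding mor_kernel_def x(1) by simp
    next
      assume y: "y \<in> mor_kernel (direct_sum Ps) (direct_sum Hs) (sum_map ?n q)"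
      then have "y \<in> h ` carrier (tgt f)" unfolding graded_iso_image[OF h(1)] mor_kernel_def by blast
      then obtain z where z: "y = h z" "z \<in> carrier (tgt f)" by (rule imageE)
      then have "z \<in> mor_kernel (tgt f) (direct_sum Hs) (\<lambda>x. \<theta> (p x))" using y h(2) unfolding mor_kernel_def by simp
      then show "y \<in> ?hf ` carrier (src f)" unfolding p\<theta>_ker z(1) by blast
    qed
    then show ?thesis unfolding Ks_carrier by auto
  qed
  have K_ops: "x \<oplus>\<^bsub>direct_sum Ks\<^esub> y = x \<oplus>\<^bsub>direct_sum Ps\<^esub> y" "r \<odot>\<^bsub>direct_sum Ks\<^esub> x = r \<odot>\<^bsub>direct_sum Ps\<^esub> x"
    "\<zero>\<^bsub>direct_sum Ks\<^esub> = \<zero>\<^bsub>direct_sum Ps\<^esub>" for x y r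
    unfolding direct_sum_simps(2,3,4)[of Ks] direct_sum_simps(2,3,4)[of Ps] Ks(1) Ps(1)
    by (rule restrict_ext, simp add: Ks(2) Ps(2) K_def del: direct_sum_simps)+
  have K_comp: "x \<in> component (direct_sum Ks) u" if "x \<in> component (direct_sum Ps) u" "x \<in> carrier (direct_sum Ks)" for x u
    using that unfolding direct_sum_simps(5)[of Ks] direct_sum_simps(5)[of Ps] direct_sum_simps(1)[of Ks] Ks(1) Ps(1)
    by (auto simp: PiE_iff Ks(2) Ps(2) K_def simp del: direct_sum_simps)
  have hfK: "?hf x \<in> carrier (direct_sum Ks)" if "x \<in> carrier (src f)" for x
    unfolding hf_image[symmetric] using that by (rule imageI)
  have hf_hom: "graded_hom (src f) (direct_sum Ks) ?hf"
  proof (rule graded_homI)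
    fix x y assume "x \<in> carrier (src f)" "y \<in> carrier (src f)"
    then show "?hf (x \<oplus>\<^bsub>src f\<^esub> y) = ?hf x \<oplus>\<^bsub>direct_sum Ks\<^esub> ?hf y" unfolding K_ops by (rule hf.add)
  next
    fix x r assume "x \<in> carrier (src f)"
    then show "?hf (r \<odot>\<^bsub>src f\<^esub> x) = r \<odot>\<^bsub>direct_sum Ks\<^esub> ?hf x" unfolding K_ops by (rule hf.smult)
  next
    fix x u assume x: "x \<in> component (src f) u"
    show "?hf x \<in> component (direct_sum Ks) u"
      by (rule K_comp[OF hf.component[OF x] hfK[OF f.M.component_closed[OF x]]])
  qed (rule hfK)
  note gK = graded_mods.direct_sum_graded[OF Ks_mods]
  interpret hfK: graded_homo "src f" "direct_sum Ks" ?hf by (rule graded_homoI[OF D(4) gK hf_hom])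
  have coverS: "minimal_cover (src f) (direct_sum Ks) ?hf"
  proof -
    have "mor_kernel (src f) (direct_sum Ks) ?hf \<subseteq> mor_kernel (src f) (tgt f) (app f)"
    proof
      fix x assume x: "x \<in> mor_kernel (src f) (direct_sum Ks) ?hf"
      then have "x \<in> carrier (src f)" "h (app f x) = \<zero>\<^bsub>direct_sum Ps\<^esub>"
        unfolding mor_kernel_def K_ops by auto
      then show "x \<in> mor_kernel (src f) (tgt f) (app f)"
        using graded_iso_zero_iff[OF D(5) gP h(1)] by (simp add: mor_kernel_def)
    qed
    then show ?thesis unfolding minimal_cover_def using hf_hom hf_image D(8) by blast
  qed
  have K_fg: "finitely_generated (K i)" if i: "i < ?n" for i
  proof -
    have proj: "graded_hom (direct_sum Ks) (K i) (\<lambda>x. x i)"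
      using graded_mods.proj_hom[OF Ks_mods, of i] i Ks by simp
    have "graded_homo (src f) (K i) (\<lambda>x. ?hf x i)"
      by (rule graded_homoI[OF D(4) K_graded[OF i] graded_hom_comp[OF hf_hom proj]])
    then interpret c: graded_homo "src f" "K i" "\<lambda>x. ?hf x i" .
    have "(\<lambda>x. ?hf x i) ` carrier (src f) = carrier (K i)"
    proof
      show "(\<lambda>x. ?hf x i) ` carrier (src f) \<subseteq> carrier (K i)" using c.closed by blast
      show "carrier (K i) \<subseteq> (\<lambda>x. ?hf x i) ` carrier (src f)"
      proof
        fix y assume y: "y \<in> carrier (K i)"
        have "graded_mods.inj Ks i y \<in> carrier (direct_sum Ks)"
          using graded_mods.inj_hom[OF Ks_mods, of i] i Ks y by (auto simp: graded_hom_def hom_def simp del: direct_sum_simps)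
        then obtain x where x: "graded_mods.inj Ks i y = ?hf x" "x \<in> carrier (src f)"
          unfolding hf_image[symmetric] by (rule imageE)
        then have "y = ?hf x i" using graded_mods.inj_proj[OF Ks_mods, of i y] i Ks by simp
        then show "y \<in> (\<lambda>x. ?hf x i) ` carrier (src f)" using x(2) by (rule image_eqI)
      qed
    qed
    then show ?thesis by (rule c.finitely_generated_image[OF free_graded_finitely_generated[OF D(1)]])
  qed
  have "\<forall>i. \<exists>vs. \<exists>r. i < ?n \<longrightarrow> minimal_cover (free vs) (K i) r"
    using minimal_cover_exists K_graded K_fg by metis
  then obtain vs r where r: "\<And>i. i < ?n \<Longrightarrow> minimal_cover (free (vs i)) (K i) (r i)" by metis
  define gs :: "('d, 'k, nat \<Rightarrow> ('d, 'k) mpoly, nat \<Rightarrow> ('d, 'k) mpoly) gmorphism list"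
    where "gs = map (\<lambda>i. \<lparr>src = free (vs i), tgt = free (us i), app = r i\<rparr>) [0..<?n]"
  have gs: "length gs = ?n" "\<And>i. i < ?n \<Longrightarrow> gs ! i = \<lparr>src = free (vs i), tgt = free (us i), app = r i\<rparr>"
    by (simp_all add: gs_def)
  have r_hom: "graded_hom (free (vs i)) (free (us i)) (r i)" if i: "i < ?n" for i
  proof (rule graded_hom_comp[where \<psi>="\<lambda>x. x" and N="K i"])
    show "graded_hom (free (vs i)) (K i) (r i)" using r[OF i] by (simp add: minimal_cover_def)
    show "graded_hom (K i) (free (us i)) (\<lambda>x. x)"
      unfolding K_def by (rule graded_mod.restr_incl[OF free_graded_mod graded_homo.kernel_submodule[OF q_homo[OF i]]])
  qed
  have gs_mor: "\<forall>g\<in>set gs. is_gmorphism g"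
    using r_hom by (auto simp: gs_def is_gmorphism_def persistence_module_def free_is_graded free_finitely_generated simp del: direct_sum_simps)
  have gs_pres: "presents (gs ! i) (Hs ! i)" if i: "i < ?n" for i
    unfolding presents_def gs(2)[OF i] gmorphism.simps
  proof (intro conjI free_is_free r_hom[OF i] exI[of _ "q i"])
    show "graded_hom (free (us i)) (Hs ! i) (q i)" "q i ` carrier (free (us i)) = carrier (Hs ! i)"
      using q[OF i] by (simp_all only: minimal_cover_def)
    show "mor_kernel (free (us i)) (Hs ! i) (q i) = r i ` carrier (free (vs i))"
      using r[OF i] by (simp only: minimal_cover_def K_def restr_simps)
  qed
  define Qs :: "('d, 'k, nat \<Rightarrow> ('d, 'k) mpoly) pmodule list" where "Qs = map src gs"
  have Qs: "length Qs = ?n" "\<And>i. i < ?n \<Longrightarrow> Qs ! i = free (vs i)" by (simp_all add: Qs_def gs)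
  have QD: "free_graded (direct_sum Qs)"
    by (rule free_graded_direct_sum) (use free_is_free in \<open>auto simp: Qs_def gs_def\<close>)
  have coverQ: "minimal_cover (direct_sum Qs) (direct_sum Ks) (sum_map ?n r)"
    by (rule minimal_cover_sum) (use Qs Ks r free_is_graded in \<open>auto simp: Qs_def gs_def simp del: direct_sum_simps\<close>)
  obtain g where g: "graded_iso (src f) (direct_sum Qs) g" "\<forall>x\<in>carrier (src f). sum_map ?n r (g x) = ?hf x"
    by (rule minimal_cover_unique[OF D(1) QD gK coverS coverQ])
  have "map tgt gs = Ps" by (simp add: gs_def Ps_def)
  have sm: "sum_map (length gs) (\<lambda>i. app (gs ! i)) = sum_map ?n r"
    by (rule ext) (auto simp: sum_map_def gs intro!: restrict_ext)
  have "isomorphic_morphisms f (direct_sum_morphism gs)"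
    by (rule isomorphic_morphismsI[where g=g and h=h]; unfold direct_sum_morphism_simps \<open>map tgt gs = Ps\<close> Qs_def[symmetric] sm)
      (use g h(1) in \<open>simp_all del: direct_sum_simps\<close>)
  from transport_decomposition[OF minimal_mor_gmorphism[OF f(1)] gs_mor this]
  obtain fs where fs: "fs \<in> morphism_decompositions f" "list_all2 isomorphic_morphisms gs fs" .
  have "presents (fs ! i) (Hs ! i)" if i: "i < ?n" for i
  proof -
    have "is_gmorphism (fs ! i)" using fs i list_all2_lengthD[OF fs(2)] gs(1) by (auto simp: morphism_decompositions_def)
    note F = gmorphismD[OF this]
    show ?thesis
      by (rule isomorphic_morphisms_transfer(2)[of "gs ! i", OF _ _ _ F(1,2,3) list_all2_nthD[OF fs(2)] gs_pres[OF i]])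
        (use i gs(2)[OF i] gs(1) free_is_free r_hom[OF i] in \<open>simp_all del: direct_sum_simps\<close>)
  qed
  then have "list_all2 (\<lambda>M f. presents f M) Hs fs"
    using list_all2_lengthD[OF fs(2)] gs(1) by (simp add: list_all2_conv_all_nth)
  with fs(1) show ?thesis by (rule that)
qed

section \<open>Correspondences between classes and between multisets\<close>

lemma equiv_rel_on:
  assumes E: "\<And>x. x \<in> S \<Longrightarrow> E x x" "\<And>x y. x \<in> S \<Longrightarrow> y \<in> S \<Longrightarrow> E x y \<Longrightarrow> E y x"
      "\<And>x y z. x \<in> S \<Longrightarrow> y \<in> S \<Longrightarrow> z \<in> S \<Longrightarrow> E x y \<Longrightarrow> E y z \<Longrightarrow> E x z"
  shows "equiv S (rel_on S E)"
proof (rule equivI)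
  show "rel_on S E \<subseteq> S \<times> S" by (auto simp: rel_on_def)
  show "refl_on S (rel_on S E)" by (rule refl_onI) (simp add: rel_on_def E(1))
  show "sym (rel_on S E)" by (rule symI) (simp add: rel_on_def E(2))
  show "trans (rel_on S E)"
  proof (rule transI)
    fix x y z assume "(x, y) \<in> rel_on S E" "(y, z) \<in> rel_on S E"
    then show "(x, z) \<in> rel_on S E" using E(3)[of x y z] by (simp add: rel_on_def)
  qed
qed

text \<open>
  The bijection sends a class to the class of any partner of any of its members.
\<close>

lemma one_to_one_correspondenceI:
  assumes E: "\<And>x. x \<in> S \<Longrightarrow> E x x" "\<And>x y. x \<in> S \<Longrightarrow> y \<in> S \<Longrightarrow> E x y \<Longrightarrow> E y x"
      "\<And>x y z. x \<in> S \<Longrightarrow> y \<in> S \<Longrightarrow> z \<in> S \<Longrightarrow> E x y \<Longrightarrow> E y z \<Longrightarrow> E x z"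
    and E': "\<And>x. x \<in> T \<Longrightarrow> E' x x" "\<And>x y. x \<in> T \<Longrightarrow> y \<in> T \<Longrightarrow> E' x y \<Longrightarrow> E' y x"
      "\<And>x y z. x \<in> T \<Longrightarrow> y \<in> T \<Longrightarrow> z \<in> T \<Longrightarrow> E' x y \<Longrightarrow> E' y z \<Longrightarrow> E' x z"
    and total: "\<And>x. x \<in> S \<Longrightarrow> \<exists>y\<in>T. C x y" "\<And>y. y \<in> T \<Longrightarrow> \<exists>x\<in>S. C x y"
    and compatible: "\<And>x x' y. x \<in> S \<Longrightarrow> x' \<in> S \<Longrightarrow> y \<in> T \<Longrightarrow> E x' x \<Longrightarrow> C x y \<Longrightarrow> C x' y"
      "\<And>x y y'. x \<in> S \<Longrightarrow> y \<in> T \<Longrightarrow> y' \<in> T \<Longrightarrow> C x y \<Longrightarrow> E' y y' \<Longrightarrow> C x y'"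
    and unique: "\<And>x y y'. x \<in> S \<Longrightarrow> y \<in> T \<Longrightarrow> y' \<in> T \<Longrightarrow> C x y \<Longrightarrow> C x y' \<Longrightarrow> E' y y'"
      "\<And>x x' y. x \<in> S \<Longrightarrow> x' \<in> S \<Longrightarrow> y \<in> T \<Longrightarrow> C x y \<Longrightarrow> C x' y \<Longrightarrow> E x x'"
  shows "one_to_one_correspondence S E T E' C"
proof -
  have eqS: "equiv S (rel_on S E)" by (rule equiv_rel_on) (fact E)+
  have eqT: "equiv T (rel_on T E')" by (rule equiv_rel_on) (fact E')+
  have clS: "rel_on S E `` {x} = rel_on S E `` {x'} \<longleftrightarrow> E x x'" if "x \<in> S" "x' \<in> S" for x x'
    using eq_equiv_class_iff[OF eqS that] that by (simp add: rel_on_def)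
  have clT: "rel_on T E' `` {y} = rel_on T E' `` {y'} \<longleftrightarrow> E' y y'" if "y \<in> T" "y' \<in> T" for y y'
    using eq_equiv_class_iff[OF eqT that] that by (simp add: rel_on_def)
  define \<Phi> where "\<Phi> Q = rel_on T E' `` {SOME y. y \<in> T \<and> (\<exists>x\<in>Q. C x y)}" for Q
  have \<Phi>: "\<Phi> (rel_on S E `` {x}) = rel_on T E' `` {y}" if xy: "x \<in> S" "y \<in> T" "C x y" for x y
  proof -
    let ?y = "SOME z. z \<in> T \<and> (\<exists>w\<in>rel_on S E `` {x}. C w z)"
    have "?y \<in> T \<and> (\<exists>w\<in>rel_on S E `` {x}. C w ?y)"
      proof (rule someI[of _ y])
      have "x \<in> rel_on S E `` {x}" using xy(1) E(1)[OF xy(1)] by (simp add: rel_on_def)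
      then show "y \<in> T \<and> (\<exists>w\<in>rel_on S E `` {x}. C w y)" using xy(2,3) by blast
    qed
    then obtain w where w: "?y \<in> T" "w \<in> S" "E x w" "C w ?y" by (auto simp: rel_on_def)
    then have "C x ?y" using compatible(1)[of w x ?y] xy by blast
    then have "E' ?y y" using unique(1)[of x ?y y] xy w by blast
    then show ?thesis unfolding \<Phi>_def using clT w(1) xy(2) by blast
  qed
  have C_iff: "C x y \<longleftrightarrow> \<Phi> (rel_on S E `` {x}) = rel_on T E' `` {y}" if xy: "x \<in> S" "y \<in> T" for x y
  proof
    assume eq: "\<Phi> (rel_on S E `` {x}) = rel_on T E' `` {y}"
    obtain y0 where y0: "y0 \<in> T" "C x y0" using total(1)[OF xy(1)] by blast
    then have "E' y0 y" using \<Phi>[OF xy(1) y0] eq clT[OF y0(1) xy(2)] by simp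
    then show "C x y" using compatible(2) xy y0 by blast
  qed (rule \<Phi>[OF xy])
  have "bij_betw \<Phi> (S // rel_on S E) (T // rel_on T E')"
  proof (rule bij_betw_imageI)
    show "inj_on \<Phi> (S // rel_on S E)"
    proof (rule inj_onI)
      fix Q Q' assume "Q \<in> S // rel_on S E" "Q' \<in> S // rel_on S E" and eq: "\<Phi> Q = \<Phi> Q'"
      then obtain x x' where x: "x \<in> S" "Q = rel_on S E `` {x}" "x' \<in> S" "Q' = rel_on S E `` {x'}"
        by (auto elim!: quotientE)
      obtain y where y: "y \<in> T" "C x y" using total(1)[OF x(1)] by blast
      then have "C x' y" using C_iff[OF x(1) y(1)] C_iff[OF x(3) y(1)] eq x by simp
      then show "Q = Q'" using unique(2)[OF x(1,3) y(1,2)] clS x by simp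
    qed
    show "\<Phi> ` (S // rel_on S E) = T // rel_on T E'"
    proof (intro subset_antisym subsetI)
      fix Y assume "Y \<in> \<Phi> ` (S // rel_on S E)"
      then obtain x where x: "x \<in> S" "Y = \<Phi> (rel_on S E `` {x})" by (auto elim!: quotientE)
      obtain y where y: "y \<in> T" "C x y" using total(1)[OF x(1)] by blast
      then show "Y \<in> T // rel_on T E'" using \<Phi>[OF x(1) y] x(2) by (auto intro: quotientI)
    next
      fix Y assume "Y \<in> T // rel_on T E'"
      then obtain y where y: "y \<in> T" "Y = rel_on T E' `` {y}" by (auto elim!: quotientE)
      obtain x where x: "x \<in> S" "C x y" using total(2)[OF y(1)] by blast
      then show "Y \<in> \<Phi> ` (S // rel_on S E)"
        using \<Phi>[OF x(1) y(1) x(2)] y(2) by (intro image_eqI[of _ _ "rel_on S E `` {x}"]) (auto intro: quotientI)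
    qed
  qed
  then show ?thesis unfolding one_to_one_correspondence_def using eqS eqT C_iff by blast
qed

lemma rel_mset_refl_on: "(\<And>x. x \<in># A \<Longrightarrow> R x x) \<Longrightarrow> rel_mset R A A"
  by (rule multiset.rel_refl_strong)

lemma rel_mset_flip:
  assumes "rel_mset R A B" "\<And>x y. x \<in># A \<Longrightarrow> y \<in># B \<Longrightarrow> R x y \<Longrightarrow> R' y x" shows "rel_mset R' B A"
proof -
  have "rel_mset R'\<inverse>\<inverse> A B" by (rule multiset.rel_mono_strong[OF assms(1)]) (use assms(2) in simp)
  then show ?thesis by (simp only: multiset.rel_flip)
qed

lemma rel_mset_comp:
  assumes "rel_mset R A B" "rel_mset R' B C"
    "\<And>x y z. x \<in># A \<Longrightarrow> y \<in># B \<Longrightarrow> z \<in># C \<Longrightarrow> R x y \<Longrightarrow> R' y z \<Longrightarrow> R'' x z"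
  shows "rel_mset R'' A C"
proof -
  have "rel_mset (\<lambda>x y. x \<in># A \<and> y \<in># B \<and> R x y) A B"
    by (rule multiset.rel_mono_strong[OF assms(1)]) simp
  moreover have "rel_mset (\<lambda>y z. z \<in># C \<and> R' y z) B C"
    by (rule multiset.rel_mono_strong[OF assms(2)]) simp
  ultimately have "rel_mset ((\<lambda>x y. x \<in># A \<and> y \<in># B \<and> R x y) OO (\<lambda>y z. z \<in># C \<and> R' y z)) A C"
    by (auto simp: multiset.rel_compp)
  then show ?thesis by (rule multiset.rel_mono_strong) (use assms(3) in blast)
qed

lemma list_all2_filter_iff:
  assumes "list_all2 R xs ys" "\<And>x y. x \<in> set xs \<Longrightarrow> y \<in> set ys \<Longrightarrow> R x y \<Longrightarrow> P x \<longleftrightarrow> Q y"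
  shows "list_all2 R (filter P xs) (filter Q ys)"
  using assms by (induction rule: list_all2_induct) auto

lemma rel_mset_filter:
  assumes "list_all2 R xs ys" "\<And>x y. x \<in> set xs \<Longrightarrow> y \<in> set ys \<Longrightarrow> R x y \<Longrightarrow> P x \<longleftrightarrow> Q y"
  shows "rel_mset R (mset (filter P xs)) (mset (filter Q ys))"
proof -
  have "list_all2 R (filter P xs) (filter Q ys)"
    by (rule list_all2_filter_iff[OF assms(1)]) (rule assms(2))
  then show ?thesis unfolding rel_mset_def by blast
qed

section \<open>Decompositions of a morphism and diagonalizations of its matrix\<close>

lemma isomorphic_morphisms_gmorphism_sym:
  assumes "is_gmorphism f" "is_gmorphism g" "isomorphic_morphisms f g" shows "isomorphic_morphisms g f"
  by (rule isomorphic_morphisms_sym[OF gmorphismD(1,2)[OF assms(1)] gmorphismD(1,2)[OF assms(2)]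
    gmorphismD(3)[OF assms(1)] assms(3)])

lemma matrix_mor_gmorphism: "is_gmatrix A \<Longrightarrow> is_gmorphism (matrix_mor A)"
  using mat_map_hom[of A]
  by (simp add: is_gmorphism_def persistence_module_def free_is_graded free_finitely_generated del: direct_sum_simps)

lemma direct_sum_morphism_gmorphism:
  assumes "is_gmorphism f" "\<forall>g\<in>set fs. is_gmorphism g" "isomorphic_morphisms f (direct_sum_morphism fs)"
  shows "is_gmorphism (direct_sum_morphism fs)"
proof -
  interpret fs: gmorphisms fs using assms(2) by (simp add: gmorphisms_def)
  interpret S: graded_homo "direct_sum (map src fs)" "direct_sum (map tgt fs)" "sum_map (length fs) (\<lambda>i. app (fs ! i))"
    by (rule fs.sum_homo)
  obtain g h where gh: "graded_iso (src f) (direct_sum (map src fs)) g" "graded_iso (tgt f) (direct_sum (map tgt fs)) h"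
    using isomorphic_morphismsE[OF assms(3), unfolded direct_sum_morphism_simps] .
  note F = gmorphismD[OF assms(1)]
  show ?thesis
    unfolding is_gmorphism_def persistence_module_def direct_sum_morphism_simps
    using S.M.graded S.N.graded S.homo
      finitely_generated_iso[OF F(1) S.M.graded isomorphic_if_graded_iso[OF gh(1)] F(5)]
      finitely_generated_iso[OF F(2) S.N.graded isomorphic_if_graded_iso[OF gh(2)] F(6)]
    by blast
qed

lemma trivial_free_iff: "trivial_module (free us :: ('d::finite, 'k::field, _) pmodule) \<longleftrightarrow> us = []"
proof
  assume triv: "trivial_module (free us :: ('d, 'k, _) pmodule)"
  show "us = []"
  proof (rule ccontr)
    assume "us \<noteq> []"
    then have 0: "0 < length us" by simp
    have "(unit_vector (length us) 0 :: nat \<Rightarrow> ('d, 'k) mpoly) = \<zero>\<^bsub>free us\<^esub>"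
      using triv unit_vector_carrier[of us 0] unfolding trivial_module_def by blast
    from fun_cong[OF this, of 0] show False using 0 unfolding free_simps by (simp add: unit_vector_def)
  qed
next
  assume "us = []"
  then have "x = \<zero>\<^bsub>free us\<^esub>" if "x \<in> carrier (free us)" for x :: "nat \<Rightarrow> ('d, 'k) mpoly"
    using that unfolding free_simps by (auto simp: fun_eq_iff)
  then show "trivial_module (free us :: ('d, 'k, _) pmodule)"
    unfolding trivial_module_def using abelian_monoid.zero_closed[OF abelian_group.axioms(1)[OF graded_mods.sum_abelian_group[OF free_mods]]]
    by blast
qed

lemma trivial_module_iso:
  assumes "is_graded_module M" "is_graded_module N" "graded_iso M N \<phi>"
  shows "trivial_module M \<longleftrightarrow> trivial_module N"
proof -
  interpret graded_homo M N \<phi> by (rule graded_homoI[OF assms(1,2) graded_iso_hom[OF assms(3)]])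
  show ?thesis
  proof
    assume "trivial_module M"
    then show "trivial_module N" using graded_iso_image[OF assms(3)] by (simp add: trivial_module_def)
  next
    assume t: "trivial_module N"
    have "x = \<zero>\<^bsub>M\<^esub>" if "x \<in> carrier M" for x
      using graded_iso_zero_iff[OF assms that] closed[OF that] t by (simp add: trivial_module_def)
    then show "trivial_module M" unfolding trivial_module_def using M.zero_closed by blast
  qed
qed

lemma trivial_matrix_iff:
  assumes "is_gmatrix A" "is_gmorphism f" "isomorphic_morphisms (matrix_mor A) f"
  shows "trivial_morphism f \<longleftrightarrow> row_grades A = [] \<and> col_grades A = []"
proof -
  obtain g h where gh: "graded_iso (free (col_grades A)) (src f) g" "graded_iso (free (row_grades A)) (tgt f) h"
    using isomorphic_morphismsE[OF assms(3), unfolded matrix_mor_simps] .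
  show ?thesis
    using trivial_module_iso[OF free_is_graded gmorphismD(1)[OF assms(2)] gh(1)]
      trivial_module_iso[OF free_is_graded gmorphismD(2)[OF assms(2)] gh(2)]
      trivial_free_iff[of "col_grades A", where 'k='b] trivial_free_iff[of "row_grades A", where 'k='b]
    by (auto simp: trivial_morphism_def)
qed

lemma matrix_of_gmorphism:
  "is_gmorphism f \<Longrightarrow> matrix_of f A \<longleftrightarrow> is_gmatrix A \<and> isomorphic_morphisms (matrix_mor A) f"
  using matrix_of_iff gmorphismD(1-3) by blast

lemma matrix_exists:
  fixes f :: "('d::finite, 'k::field, 'm, 'n) gmorphism"
  assumes "minimal_mor f" obtains A where "is_gmatrix A" "isomorphic_morphisms (matrix_mor A) f"
proof -
  note D = minimal_morD[OF assms]
  obtain vs \<alpha> \<alpha>' where a: "graded_iso (src f) (free vs) \<alpha>" "graded_iso (free vs) (src f) \<alpha>'"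
    "\<forall>x\<in>carrier (src f). \<alpha>' (\<alpha> x) = x" "\<forall>y\<in>carrier (free vs). \<alpha> (\<alpha>' y) = y" by (rule free_gradedE[OF D(1)])
  obtain us \<beta> \<beta>' where b: "graded_iso (tgt f) (free us) \<beta>" "graded_iso (free us) (tgt f) \<beta>'"
    "\<forall>x\<in>carrier (tgt f). \<beta>' (\<beta> x) = x" "\<forall>y\<in>carrier (free us). \<beta> (\<beta>' y) = y" by (rule free_gradedE[OF D(2)])
  have "graded_hom (free vs) (free us) (\<lambda>x. \<beta> (app f (\<alpha>' x)))"
    by (rule graded_hom_comp[OF graded_hom_comp[OF graded_iso_hom[OF a(2)] D(3)] graded_iso_hom[OF b(1)]])
  then obtain Q where Q: "is_gmatrix \<lparr>row_grades = us, col_grades = vs, entries = Q\<rparr>"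
    "\<forall>x\<in>carrier (free vs). \<beta> (app f (\<alpha>' x)) = mat_map Q x" by (rule hom_matrix)
  let ?A = "\<lparr>row_grades = us, col_grades = vs, entries = Q\<rparr>"
  have "isomorphic_morphisms (matrix_mor ?A) f"
  proof (rule isomorphic_morphismsI[where g=\<alpha>' and h=\<beta>']; unfold matrix_mor_simps gmatrix.simps)
    fix x :: "nat \<Rightarrow> ('d, 'k) mpoly" assume x: "x \<in> carrier (free vs)"
    have "app f (\<alpha>' x) \<in> carrier (tgt f)" by (rule graded_homo.closed[OF D(6) graded_iso_closed[OF a(2) x]])
    then show "\<beta>' (mat_map Q x) = app f (\<alpha>' x)" using b(3) bspec[OF Q(2) x] by metis
  qed (rule a(2), rule b(2))
  with Q(1) show ?thesis by (rule that)
qed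

lemma nths_Nil_iff: "I \<subseteq> {..<length us} \<Longrightarrow> nths us I = [] \<longleftrightarrow> I = {}"
  using pos_less[of I us] by fastforce

lemma diagonalization_summands:
  assumes "(A', Bs) \<in> diagonalizations A" "B \<in># matrix_summands (A', Bs)"
  shows "is_gmatrix B" "\<not> (row_grades B = [] \<and> col_grades B = [])"
proof -
  have A': "is_gmatrix A'" and bd: "block_diagonal A' Bs"
    using assms(1) by (simp_all add: diagonalizations_def equivalent_gmatrices_def)
  obtain I where I: "I \<in> Bs" "B = restrict_block A' I"
    using assms(2) bd by (auto simp: matrix_summands_def block_diagonal_def)
  have sub: "fst I \<subseteq> {..<length (row_grades A')}" "snd I \<subseteq> {..<length (col_grades A')}"
    using I(1) bd unfolding block_diagonal_def by blast+
  show "is_gmatrix B" unfolding I(2) by (rule restrict_block_gmatrix[OF A' sub])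
  have "fst I \<noteq> {} \<or> snd I \<noteq> {}" using I(1) bd by (simp add: block_diagonal_def)
  then show "\<not> (row_grades B = [] \<and> col_grades B = [])"
    using nths_Nil_iff[OF sub(1)] nths_Nil_iff[OF sub(2)] by (simp add: I(2) restrict_block_def)
qed

text \<open>
  The diagonalized matrix gives a map isomorphic to \<open>f\<close>, which is the direct sum of the maps given by the
  blocks. Blocks are nonempty, so all summands are nontrivial.
\<close>

theorem morphism_decomposition_of_diagonalization:
  fixes f :: "('d::finite, 'k::field, 'm, 'n) gmorphism"
  assumes f: "is_gmorphism f" and A: "matrix_of f A" and D: "D \<in> diagonalizations A"
  obtains fs where "fs \<in> morphism_decompositions f" "morphism_matrix_match fs D"
proof -
  obtain A' Bs where D_eq: "D = (A', Bs)" by (cases D)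
  have eq: "equivalent_gmatrices A A'" and bd: "block_diagonal A' Bs" using D by (auto simp: diagonalizations_def D_eq)
  have gA: "is_gmatrix A" "is_gmatrix A'" "isomorphic_morphisms (matrix_mor A) (matrix_mor A')"
    using eq unfolding equivalent_gmatrices_iff by auto
  have Af: "isomorphic_morphisms (matrix_mor A) f" using A matrix_of_gmorphism[OF f] by blast
  have "finite Bs" using bd by (simp add: block_diagonal_def)
  then obtain Bl where Bl: "set Bl = Bs" "distinct Bl" using finite_distinct_list by blast
  have diag: "diagonal_along A' Bl" by (rule diagonal_alongI[OF _ Bl(2)]) (simp only: Bl(1) bd)
  let ?Cs = "map (restrict_block A') Bl"
  have ms: "matrix_summands D = mset ?Cs"
    unfolding matrix_summands_def D_eq fst_conv snd_conv mset_map Bl(1)[symmetric] mset_set_set[OF Bl(2)] ..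
  have C: "is_gmatrix C \<and> \<not> (row_grades C = [] \<and> col_grades C = [])" if "C \<in> set ?Cs" for C
  proof -
    have "C \<in># matrix_summands (A', Bs)" using that unfolding D_eq[symmetric] ms by simp
    then show ?thesis using diagonalization_summands[OF D[unfolded D_eq]] by blast
  qed
  have "isomorphic_morphisms f (direct_sum_morphism (map matrix_mor ?Cs))"
    using isomorphic_morphisms_trans[OF isomorphic_morphisms_trans[OF
      isomorphic_morphisms_gmorphism_sym[OF matrix_mor_gmorphism[OF gA(1)] f Af] gA(3)] block_diagonal_morphism[OF gA(2) diag]]
    by (simp add: o_def)
  then obtain fs where fs: "fs \<in> morphism_decompositions f" "list_all2 isomorphic_morphisms (map matrix_mor ?Cs) fs"
    by (rule transport_decomposition[OF f, rotated]) (use C matrix_mor_gmorphism in auto)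
  have gm: "is_gmorphism g" if "g \<in> set fs" for g using fs(1) that by (simp add: morphism_decompositions_def)
  have fs_Cs: "list_all2 (\<lambda>C g. isomorphic_morphisms (matrix_mor C) g) ?Cs fs"
    using fs(2) unfolding list_all2_map1 .
  have "rel_mset (\<lambda>C g. isomorphic_morphisms (matrix_mor C) g) (mset (filter (\<lambda>_. True) ?Cs)) (mset (filter (\<lambda>f. \<not> trivial_morphism f) fs))"
  proof (rule rel_mset_filter[OF fs_Cs])
    fix C g assume "C \<in> set ?Cs" "g \<in> set fs" "isomorphic_morphisms (matrix_mor C) g"
    then show "True \<longleftrightarrow> \<not> trivial_morphism g" using trivial_matrix_iff[of C g] C gm by blast
  qed
  then have "rel_mset (\<lambda>C g. isomorphic_morphisms (matrix_mor C) g) (matrix_summands D) (morphism_summands fs)"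
    by (simp add: ms morphism_summands_def)
  then have "morphism_matrix_match fs D"
    unfolding morphism_matrix_match_def
  proof (rule rel_mset_flip)
    fix C g assume "C \<in># matrix_summands D" "g \<in># morphism_summands fs" "isomorphic_morphisms (matrix_mor C) g"
    then show "matrix_of g C" using C gm matrix_of_gmorphism[of g C] unfolding ms morphism_summands_def by simp
  qed
  with fs(1) show ?thesis by (rule that)
qed

text \<open>
  The summands of \<open>f\<close> are maps of free modules and have matrices. Arranged along a diagonal, these form a
  matrix that is equivalent to \<open>A\<close> because both belong to \<open>f\<close>.
\<close>

theorem diagonalization_of_morphism_decomposition:
  fixes f :: "('d::finite, 'k::field, 'm, 'n) gmorphism"
  assumes f: "minimal_mor f" and A: "matrix_of f A" and fs: "fs \<in> morphism_decompositions f"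
  obtains D where "D \<in> diagonalizations A" "morphism_matrix_match fs D"
proof -
  note gf = minimal_mor_gmorphism[OF f]
  have gm: "\<forall>g\<in>set fs. is_gmorphism g" and iso: "isomorphic_morphisms f (direct_sum_morphism fs)"
    using fs by (auto simp: morphism_decompositions_def)
  have Af: "is_gmatrix A" "isomorphic_morphisms (matrix_mor A) f" using A matrix_of_gmorphism[OF gf] by blast+
  have "\<forall>g. \<exists>C. g \<in> set fs \<longrightarrow> is_gmatrix C \<and> isomorphic_morphisms (matrix_mor C) g"
    using matrix_exists minimal_summands[OF f fs] by metis
  from choice[OF this] obtain w where w: "\<And>g. g \<in> set fs \<Longrightarrow> is_gmatrix (w g)"
    "\<And>g. g \<in> set fs \<Longrightarrow> isomorphic_morphisms (matrix_mor (w g)) g" by blast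
  obtain A' Bl where A': "is_gmatrix A'" "diagonal_along A' Bl" "map (restrict_block A') Bl = map w fs"
    by (rule block_diagonal_exists[of "map w fs"]) (use w in auto)
  have sum_mor: "map (\<lambda>B. matrix_mor (restrict_block A' B)) Bl = map matrix_mor (map w fs)"
    unfolding A'(3)[symmetric] by (simp add: o_def)
  have "list_all2 isomorphic_morphisms (map matrix_mor (map w fs)) fs"
    using w by (simp add: list_all2_conv_all_nth)
  then have "isomorphic_morphisms (direct_sum_morphism (map matrix_mor (map w fs))) (direct_sum_morphism fs)"
    by (rule isomorphic_direct_sum_morphism)
  then have "isomorphic_morphisms (matrix_mor A') (direct_sum_morphism fs)"
    using isomorphic_morphisms_trans[OF block_diagonal_morphism[OF A'(1,2)]] unfolding sum_mor by blast
  then have "isomorphic_morphisms (direct_sum_morphism fs) (matrix_mor A')"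
    by (rule isomorphic_morphisms_gmorphism_sym[OF matrix_mor_gmorphism[OF A'(1)] direct_sum_morphism_gmorphism[OF gf gm iso]])
  then have "isomorphic_morphisms (matrix_mor A) (matrix_mor A')"
    by (rule isomorphic_morphisms_trans[OF isomorphic_morphisms_trans[OF Af(2) iso]])
  then have eq: "equivalent_gmatrices A A'" unfolding equivalent_gmatrices_iff using Af(1) A'(1) by simp
  let ?Bs = "filter nonempty Bl"
  define D where "D = (A', set ?Bs)"
  have D: "D \<in> diagonalizations A"
    using eq diagonal_alongD(2)[OF A'(2)] by (simp add: D_def diagonalizations_def)
  have ms: "matrix_summands D = mset (map (restrict_block A') ?Bs)"
    unfolding matrix_summands_def D_def fst_conv snd_conv mset_map mset_set_set[OF diagonal_alongD(1)[OF A'(2)]] ..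
  have Bl_fs: "list_all2 (\<lambda>B g. isomorphic_morphisms (matrix_mor (restrict_block A' B)) g \<and> is_gmatrix (restrict_block A' B)) Bl fs"
  proof -
    have "list_all2 (\<lambda>C g. isomorphic_morphisms (matrix_mor C) g \<and> is_gmatrix C) (map w fs) fs"
      using w by (simp add: list_all2_conv_all_nth)
    then show ?thesis unfolding A'(3)[symmetric] list_all2_map1 .
  qed
  have sub: "fst B \<subseteq> {..<length (row_grades A')}" "snd B \<subseteq> {..<length (col_grades A')}" if "B \<in> set Bl" for B
    using A'(2) that unfolding diagonal_along_def cuts_def by auto
  have "rel_mset (\<lambda>B g. isomorphic_morphisms (matrix_mor (restrict_block A' B)) g \<and> is_gmatrix (restrict_block A' B))
      (mset ?Bs) (mset (filter (\<lambda>f. \<not> trivial_morphism f) fs))"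
  proof (rule rel_mset_filter[OF Bl_fs])
    fix B g assume B: "B \<in> set Bl" "g \<in> set fs"
      "isomorphic_morphisms (matrix_mor (restrict_block A' B)) g \<and> is_gmatrix (restrict_block A' B)"
    have "trivial_morphism g \<longleftrightarrow> nths (row_grades A') (fst B) = [] \<and> nths (col_grades A') (snd B) = []"
      using trivial_matrix_iff[of "restrict_block A' B" g] B gm by (simp add: restrict_block_def)
    also have "\<dots> \<longleftrightarrow> fst B = {} \<and> snd B = {}"
      by (simp only: nths_Nil_iff[OF sub(1)[OF B(1)]] nths_Nil_iff[OF sub(2)[OF B(1)]])
    finally show "nonempty B \<longleftrightarrow> \<not> trivial_morphism g" by blast
  qed
  then have "rel_mset (\<lambda>C g. isomorphic_morphisms (matrix_mor C) g \<and> is_gmatrix C) (matrix_summands D) (morphism_summands fs)"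
    unfolding ms morphism_summands_def by (simp add: multiset.rel_map)
  then have "morphism_matrix_match fs D"
    unfolding morphism_matrix_match_def
    by (rule rel_mset_flip) (use gm matrix_of_gmorphism in \<open>auto simp: morphism_summands_def\<close>)
  with D show ?thesis by (rule that)
qed

section \<open>The three correspondences\<close>

text \<open>
  On the summands that occur, all relations reduce to isomorphisms, which compose and invert, and to
  presentations, which determine the module as a cokernel and, by minimality, are determined by it.
  The third correspondence is the composition of the other two.
\<close>

theorem theorem3p1:
  fixes H :: "('d::finite, 'k::field, 'h) pmodule"
    and f :: "('d, 'k, 'f, 'f) gmorphism"
    and A :: "('d, 'k) gmatrix"
  assumes "persistence_module H"
    and "minimal_presentation_map f H"
    and "matrix_of f A"
  shows
    "one_to_one_correspondence
       (module_decompositions H) same_module_decomposition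
       (morphism_decompositions f) same_morphism_decomposition
       module_morphism_match \<and>
     one_to_one_correspondence
       (morphism_decompositions f) same_morphism_decomposition
       (diagonalizations A) same_diagonalization
       morphism_matrix_match \<and>
     one_to_one_correspondence
       (module_decompositions H) same_module_decomposition
       (diagonalizations A) same_diagonalization
       (\<lambda>Hs D. \<exists>fs \<in> morphism_decompositions f.
          module_morphism_match Hs fs \<and> morphism_matrix_match fs D)"
proof -
  note min = minimal_presentation_mapD(1)[OF assms(2)] and pres = minimal_presentation_mapD(2)[OF assms(2)]
  note gf = minimal_mor_gmorphism[OF min]
  let ?S = "module_decompositions H" and ?T = "morphism_decompositions f" and ?U = "diagonalizations A"
  have S: "is_graded_module M" if "Hs \<in> ?S" "M \<in># module_summands Hs" for Hs M
    using that by (auto simp: module_decompositions_def module_summands_def persistence_module_def)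
  have T: "minimal_mor g" "is_gmorphism g" if "fs \<in> ?T" "g \<in># morphism_summands fs" for fs g
    using that minimal_summands[OF min that(1)] by (auto simp: morphism_decompositions_def morphism_summands_def)
  have U: "is_gmatrix B" if "D \<in> ?U" "B \<in># matrix_summands D" for D B
    using that diagonalization_summands(1)[of "fst D" "snd D"] by simp
  have U_iff: "equivalent_gmatrices B B' \<longleftrightarrow> isomorphic_morphisms (matrix_mor B) (matrix_mor B')"
    if "D \<in> ?U" "B \<in># matrix_summands D" "D' \<in> ?U" "B' \<in># matrix_summands D'" for D D' B B'
    using U that equivalent_gmatrices_iff by blast
  have C_iff: "matrix_of g B \<longleftrightarrow> isomorphic_morphisms (matrix_mor B) g"
    if "fs \<in> ?T" "g \<in># morphism_summands fs" "D \<in> ?U" "B \<in># matrix_summands D" for fs D g B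
    using U[OF that(3,4)] T(2)[OF that(1,2)] matrix_of_gmorphism by blast

  have S_refl: "same_module_decomposition Hs Hs" if "Hs \<in> ?S" for Hs
    unfolding same_module_decomposition_def by (rule rel_mset_refl_on) (rule isomorphic_modules_refl)
  have S_sym: "same_module_decomposition Hs' Hs" if "Hs \<in> ?S" "Hs' \<in> ?S" "same_module_decomposition Hs Hs'" for Hs Hs'
    using that(3) unfolding same_module_decomposition_def
    by (rule rel_mset_flip) (rule isomorphic_modules_sym[OF S[OF that(1)] S[OF that(2)]])
  have S_trans: "same_module_decomposition Hs Hs''"
    if "Hs \<in> ?S" "Hs' \<in> ?S" "Hs'' \<in> ?S" "same_module_decomposition Hs Hs'" "same_module_decomposition Hs' Hs''" for Hs Hs' Hs''
    using that(4,5) unfolding same_module_decomposition_def by (rule rel_mset_comp) (rule isomorphic_modules_trans)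

  have T_refl: "same_morphism_decomposition fs fs" if "fs \<in> ?T" for fs
    unfolding same_morphism_decomposition_def by (rule rel_mset_refl_on) (rule isomorphic_morphisms_refl)
  have T_sym: "same_morphism_decomposition fs' fs" if "fs \<in> ?T" "fs' \<in> ?T" "same_morphism_decomposition fs fs'" for fs fs'
    using that(3) unfolding same_morphism_decomposition_def
    by (rule rel_mset_flip) (rule isomorphic_morphisms_gmorphism_sym[OF T(2)[OF that(1)] T(2)[OF that(2)]])
  have T_trans: "same_morphism_decomposition fs fs''"
    if "fs \<in> ?T" "fs' \<in> ?T" "fs'' \<in> ?T" "same_morphism_decomposition fs fs'" "same_morphism_decomposition fs' fs''" for fs fs' fs''
    using that(4,5) unfolding same_morphism_decomposition_def by (rule rel_mset_comp) (rule isomorphic_morphisms_trans)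

  have U_refl: "same_diagonalization D D" if "D \<in> ?U" for D
    unfolding same_diagonalization_def
    by (rule rel_mset_refl_on) (use U_iff that isomorphic_morphisms_refl in blast)
  have U_sym: "same_diagonalization D' D" if D: "D \<in> ?U" "D' \<in> ?U" "same_diagonalization D D'" for D D'
    using D(3) unfolding same_diagonalization_def
  proof (rule rel_mset_flip)
    fix B B' assume B: "B \<in># matrix_summands D" "B' \<in># matrix_summands D'" "equivalent_gmatrices B B'"
    then show "equivalent_gmatrices B' B"
      using U_iff[OF D(1) B(1) D(2) B(2)] U_iff[OF D(2) B(2) D(1) B(1)]
        isomorphic_morphisms_gmorphism_sym[OF matrix_mor_gmorphism matrix_mor_gmorphism] U D by blast
  qed
  have U_trans: "same_diagonalization D D''" if D: "D \<in> ?U" "D' \<in> ?U" "D'' \<in> ?U" "same_diagonalization D D'" "same_diagonalization D' D''" for D D' D''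
    using D(4,5) unfolding same_diagonalization_def
  proof (rule rel_mset_comp)
    fix B B' B'' assume B: "equivalent_gmatrices B B'" "equivalent_gmatrices B' B''"
    then show "equivalent_gmatrices B B''"
      unfolding equivalent_gmatrices_iff using isomorphic_morphisms_trans by blast
  qed

  have ST1: "\<exists>fs\<in>?T. module_morphism_match Hs fs" if Hs: "Hs \<in> ?S" for Hs
  proof -
    obtain fs where fs: "fs \<in> ?T" "list_all2 (\<lambda>M f. presents f M) Hs fs"
      by (rule morphism_decomposition_of_module_decomposition[OF assms(1) min pres Hs])
    have "module_morphism_match Hs fs"
      unfolding module_morphism_match_def module_summands_def morphism_summands_def
    proof (rule rel_mset_filter[OF fs(2)])
      fix M g assume "M \<in> set Hs" "g \<in> set fs" "presents g M"
      then show "\<not> trivial_module M \<longleftrightarrow> \<not> trivial_morphism g"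
        using minimal_trivial_iff[OF minimal_summands[OF min fs(1)], of g M] Hs
        by (auto simp: module_decompositions_def persistence_module_def)
    qed
    with fs(1) show ?thesis by blast
  qed
  have ST2: "\<exists>Hs\<in>?S. module_morphism_match Hs fs" if fs: "fs \<in> ?T" for fs
  proof -
    obtain Hs where Hs: "Hs \<in> ?S" "list_all2 (\<lambda>M f. presents f M) Hs fs"
      by (rule module_decomposition_of_morphism_decomposition[OF assms(1) min pres fs])
    have "module_morphism_match Hs fs"
      unfolding module_morphism_match_def module_summands_def morphism_summands_def
    proof (rule rel_mset_filter[OF Hs(2)])
      fix M g assume "M \<in> set Hs" "g \<in> set fs" "presents g M"
      then show "\<not> trivial_module M \<longleftrightarrow> \<not> trivial_morphism g"
        using minimal_trivial_iff[OF minimal_summands[OF min fs], of g M] Hs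
        by (auto simp: module_decompositions_def persistence_module_def)
    qed
    with Hs(1) show ?thesis by blast
  qed
  have ST3: "module_morphism_match Hs' fs"
    if "Hs \<in> ?S" "Hs' \<in> ?S" "fs \<in> ?T" "same_module_decomposition Hs' Hs" "module_morphism_match Hs fs" for Hs Hs' fs
    using that(4,5) unfolding same_module_decomposition_def module_morphism_match_def
  proof (rule rel_mset_comp)
    fix M' M g assume M: "M' \<in># module_summands Hs'" "M \<in># module_summands Hs" "isomorphic_modules M' M" "presents g M"
    note G = S[OF that(2) M(1)] S[OF that(1) M(2)]
    show "presents g M'" by (rule presents_isomorphic_module[OF M(4) G(2,1) isomorphic_modules_sym[OF G M(3)]])
  qed
  have ST4: "module_morphism_match Hs fs'"
    if "Hs \<in> ?S" "fs \<in> ?T" "fs' \<in> ?T" "module_morphism_match Hs fs" "same_morphism_decomposition fs fs'" for Hs fs fs'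
    using that(4,5) unfolding same_morphism_decomposition_def module_morphism_match_def
  proof (rule rel_mset_comp)
    fix M g g' assume g: "g \<in># morphism_summands fs" "g' \<in># morphism_summands fs'" "presents g M" "isomorphic_morphisms g g'"
    show "presents g' M"
      by (rule isomorphic_morphisms_transfer(2)[OF minimal_morD(1-3)[OF T(1)[OF that(2) g(1)]] gmorphismD(1-3)[OF T(2)[OF that(3) g(2)]] g(4,3)])
  qed
  have ST5: "same_morphism_decomposition fs fs'"
    if "Hs \<in> ?S" "fs \<in> ?T" "fs' \<in> ?T" "module_morphism_match Hs fs" "module_morphism_match Hs fs'" for Hs fs fs'
  proof -
    have "rel_mset presents (morphism_summands fs) (module_summands Hs)"
      using that(4) unfolding module_morphism_match_def by (rule rel_mset_flip)
    then show ?thesis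
      using that(5) unfolding module_morphism_match_def same_morphism_decomposition_def
      by (rule rel_mset_comp) (rule minimal_presentation_unique; use T(1) S that in blast)
  qed
  have ST6: "same_module_decomposition Hs Hs'"
    if "Hs \<in> ?S" "Hs' \<in> ?S" "fs \<in> ?T" "module_morphism_match Hs fs" "module_morphism_match Hs' fs" for Hs Hs' fs
  proof -
    have "rel_mset presents (morphism_summands fs) (module_summands Hs')"
      using that(5) unfolding module_morphism_match_def by (rule rel_mset_flip)
    with that(4) show ?thesis
      unfolding module_morphism_match_def same_module_decomposition_def
    proof (rule rel_mset_comp)
      fix M g M' assume M: "M \<in># module_summands Hs" "g \<in># morphism_summands fs" "M' \<in># module_summands Hs'" "presents g M" "presents g M'"
      obtain p where p: "graded_hom (tgt g) M p" "p ` carrier (tgt g) = carrier M" "mor_kernel (tgt g) M p = app g ` carrier (src g)"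
        using M(4) unfolding presents_def by blast
      obtain p' where p': "graded_hom (tgt g) M' p'" "p' ` carrier (tgt g) = carrier M'" "mor_kernel (tgt g) M' p' = app g ` carrier (src g)"
        using M(5) unfolding presents_def by blast
      note gg = gmorphismD(2)[OF T(2)[OF that(3) M(2)]]
      show "isomorphic_modules M M'"
        by (rule isomorphic_if_same_kernel[OF graded_homoI[OF gg S[OF that(1) M(1)] p(1)] p(2) graded_homoI[OF gg S[OF that(2) M(3)] p'(1)] p'(2)])
          (simp add: p p')
    qed
  qed

  have TU1: "\<exists>D\<in>?U. morphism_matrix_match fs D" if "fs \<in> ?T" for fs
    using diagonalization_of_morphism_decomposition[OF min assms(3) that] by blast
  have TU2: "\<exists>fs\<in>?T. morphism_matrix_match fs D" if "D \<in> ?U" for D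
    using morphism_decomposition_of_diagonalization[OF gf assms(3) that] by blast
  have TU3: "morphism_matrix_match fs' D"
    if fs: "fs \<in> ?T" "fs' \<in> ?T" "D \<in> ?U" "same_morphism_decomposition fs' fs" "morphism_matrix_match fs D" for fs fs' D
    using fs(4,5) unfolding same_morphism_decomposition_def morphism_matrix_match_def
  proof (rule rel_mset_comp)
    fix g' g B assume g: "g' \<in># morphism_summands fs'" "g \<in># morphism_summands fs" "B \<in># matrix_summands D"
      "isomorphic_morphisms g' g" "matrix_of g B"
    have "isomorphic_morphisms (matrix_mor B) g" using C_iff[OF fs(1) g(2) fs(3) g(3)] g(5) by blast
    then show "matrix_of g' B"
      using C_iff[OF fs(2) g(1) fs(3) g(3)] isomorphic_morphisms_trans
        isomorphic_morphisms_gmorphism_sym[OF T(2)[OF fs(2) g(1)] T(2)[OF fs(1) g(2)] g(4)] by blast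
  qed
  have TU4: "morphism_matrix_match fs D'"
    if fs: "fs \<in> ?T" "D \<in> ?U" "D' \<in> ?U" "morphism_matrix_match fs D" "same_diagonalization D D'" for fs D D'
    using fs(4,5) unfolding same_diagonalization_def morphism_matrix_match_def
  proof (rule rel_mset_comp)
    fix g B B' assume g: "g \<in># morphism_summands fs" "B \<in># matrix_summands D" "B' \<in># matrix_summands D'"
      "matrix_of g B" "equivalent_gmatrices B B'"
    have "isomorphic_morphisms (matrix_mor B') (matrix_mor B)"
      using U_iff[OF fs(2) g(2) fs(3) g(3)] g(5)
        isomorphic_morphisms_gmorphism_sym[OF matrix_mor_gmorphism[OF U[OF fs(2) g(2)]] matrix_mor_gmorphism[OF U[OF fs(3) g(3)]]] by blast
    then show "matrix_of g B'"
      using C_iff[OF fs(1) g(1) fs(2) g(2)] C_iff[OF fs(1) g(1) fs(3) g(3)] g(4) isomorphic_morphisms_trans by blast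
  qed
  have TU5: "same_diagonalization D D'"
    if fs: "fs \<in> ?T" "D \<in> ?U" "D' \<in> ?U" "morphism_matrix_match fs D" "morphism_matrix_match fs D'" for fs D D'
  proof -
    have "rel_mset (\<lambda>B g. matrix_of g B) (matrix_summands D) (morphism_summands fs)"
      using fs(4) unfolding morphism_matrix_match_def by (rule rel_mset_flip)
    then show ?thesis
      using fs(5) unfolding morphism_matrix_match_def same_diagonalization_def
    proof (rule rel_mset_comp)
      fix B g B' assume g: "B \<in># matrix_summands D" "g \<in># morphism_summands fs" "B' \<in># matrix_summands D'"
        "matrix_of g B" "matrix_of g B'"
      have "isomorphic_morphisms (matrix_mor B) g" "isomorphic_morphisms (matrix_mor B') g"
        using C_iff[OF fs(1) g(2) fs(2) g(1)] C_iff[OF fs(1) g(2) fs(3) g(3)] g(4,5) by auto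
      then show "equivalent_gmatrices B B'"
        using U_iff[OF fs(2) g(1) fs(3) g(3)] isomorphic_morphisms_trans
          isomorphic_morphisms_gmorphism_sym[OF matrix_mor_gmorphism[OF U[OF fs(3) g(3)]] T(2)[OF fs(1) g(2)]] by blast
    qed
  qed
  have TU6: "same_morphism_decomposition fs fs'"
    if fs: "fs \<in> ?T" "fs' \<in> ?T" "D \<in> ?U" "morphism_matrix_match fs D" "morphism_matrix_match fs' D" for fs fs' D
  proof -
    have "rel_mset (\<lambda>B g. matrix_of g B) (matrix_summands D) (morphism_summands fs')"
      using fs(5) unfolding morphism_matrix_match_def by (rule rel_mset_flip)
    with fs(4) show ?thesis
      unfolding morphism_matrix_match_def same_morphism_decomposition_def
    proof (rule rel_mset_comp)
      fix g B g' assume g: "g \<in># morphism_summands fs" "B \<in># matrix_summands D" "g' \<in># morphism_summands fs'"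
        "matrix_of g B" "matrix_of g' B"
      have "isomorphic_morphisms (matrix_mor B) g" "isomorphic_morphisms (matrix_mor B) g'"
        using C_iff[OF fs(1) g(1) fs(3) g(2)] C_iff[OF fs(2) g(3) fs(3) g(2)] g(4,5) by auto
      then show "isomorphic_morphisms g g'"
        using isomorphic_morphisms_trans
          isomorphic_morphisms_gmorphism_sym[OF matrix_mor_gmorphism[OF U[OF fs(3) g(2)]] T(2)[OF fs(1) g(1)]] by blast
    qed
  qed

  have 1: "one_to_one_correspondence ?S same_module_decomposition ?T same_morphism_decomposition module_morphism_match"
    by (rule one_to_one_correspondenceI) (fact S_refl S_sym S_trans T_refl T_sym T_trans ST1 ST2 ST3 ST4 ST5 ST6)+
  have 2: "one_to_one_correspondence ?T same_morphism_decomposition ?U same_diagonalization morphism_matrix_match"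
    by (rule one_to_one_correspondenceI) (fact T_refl T_sym T_trans U_refl U_sym U_trans TU1 TU2 TU3 TU4 TU5 TU6)+
  have 3: "one_to_one_correspondence ?S same_module_decomposition ?U same_diagonalization
    (\<lambda>Hs D. \<exists>fs\<in>?T. module_morphism_match Hs fs \<and> morphism_matrix_match fs D)" (is "one_to_one_correspondence _ _ _ _ ?C")
  proof (rule one_to_one_correspondenceI)
    show "\<exists>D\<in>?U. ?C Hs D" if "Hs \<in> ?S" for Hs using ST1[OF that] TU1 by blast
    show "\<exists>Hs\<in>?S. ?C Hs D" if "D \<in> ?U" for D using TU2[OF that] ST2 by blast
    show "?C Hs' D" if "Hs \<in> ?S" "Hs' \<in> ?S" "same_module_decomposition Hs' Hs" "?C Hs D" for Hs Hs' D
      using that ST3 by blast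
    show "?C Hs D'" if "D \<in> ?U" "D' \<in> ?U" "?C Hs D" "same_diagonalization D D'" for Hs D D'
      using that TU4 by blast
    show "same_diagonalization D D'" if A: "Hs \<in> ?S" "D \<in> ?U" "D' \<in> ?U" "?C Hs D" "?C Hs D'" for Hs D D'
    proof -
      obtain fs fs' where fs: "fs \<in> ?T" "module_morphism_match Hs fs" "morphism_matrix_match fs D"
        "fs' \<in> ?T" "module_morphism_match Hs fs'" "morphism_matrix_match fs' D'" using A(4,5) by blast
      have "same_morphism_decomposition fs fs'" by (rule ST5[OF A(1) fs(1,4,2,5)])
      from TU5[OF fs(1) A(2,3) fs(3) TU3[OF fs(4,1) A(3) this fs(6)]] show ?thesis .
    qed
    show "same_module_decomposition Hs Hs'" if A: "Hs \<in> ?S" "Hs' \<in> ?S" "D \<in> ?U" "?C Hs D" "?C Hs' D" for Hs Hs' D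
    proof -
      obtain fs fs' where fs: "fs \<in> ?T" "module_morphism_match Hs fs" "morphism_matrix_match fs D"
        "fs' \<in> ?T" "module_morphism_match Hs' fs'" "morphism_matrix_match fs' D" using A(4,5) by blast
      have "same_morphism_decomposition fs fs'" by (rule TU6[OF fs(1,4) A(3) fs(3,6)])
      from ST6[OF A(1,2) fs(4) ST4[OF A(1) fs(1,4,2) this] fs(5)] show ?thesis .
    qed
  qed (fact S_refl S_sym S_trans U_refl U_sym U_trans)+
  from 1 2 3 show ?thesis by blast
qed

end
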